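(* For every $n\ge 4$, the generalized $4$-connectivity of the $n$-dimensional dual cube satisfies $\kappa_4(D_n)=n-1$.
   Context: The $n$-dimensional dual cube $D_n$ has vertex set all $(2n-1)$-bit binary strings $u_1u_2\cdots u_{2n-1}$. Two vertices $u,v$ are adjacent iff they differ in exactly one bit position $i$, and moreover: if $1\le i\le n-1$ then $u_{2n-1}=v_{2n-1}=0$; if $n\le i\le 2n-2$ then $u_{2n-1}=v_{2n-1}=1$; (if $i=2n-1$ there is no further condition). It is $n$-regular. For a graph $G$ and $S\subseteq V(G)$, $\kappa_G(S)$ is the maximum number $m$ of trees $T_1,\dots,T_m$ in $G$, each containing all vertices of $S$, that are pairwise edge-disjoint and satisfy $V(T_i)\cap V(T_j)=S$ for all $i\ne j$. For $2\le r\le |V(G)|$, the generalized $r$-connectivity is $\kappa_r(G)=\min\{\kappa_G(S): S\subseteq V(G),\ |S|=r\}$. *)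

theory Defs
  imports Main
begin

text \<open>A graph is a pair (V, adj) with adj a symmetric irreflexive relation.
Edges are two-element sets {x,y}.\<close>

definition graph_edges :: "'a set \<Rightarrow> ('a \<Rightarrow> 'a \<Rightarrow> bool) \<Rightarrow> 'a set set" where
  "graph_edges V adj = {{x, y} | x y. x \<in> V \<and> y \<in> V \<and> adj x y}"

definition joined :: "'a set set \<Rightarrow> 'a \<Rightarrow> 'a \<Rightarrow> bool" where
  "joined ET x y = (\<lambda>a b. {a, b} \<in> ET)\<^sup>*\<^sup>* x y"

text \<open>A tree of G = (V, adj): a subgraph (VT, ET) with nonempty finite vertex set
that is connected and acyclic (no edge lies on a cycle, i.e. the ends of an edge
are never joined after removing that edge).\<close>
definition is_tree_in :: "'a set \<Rightarrow> ('a \<Rightarrow> 'a \<Rightarrow> bool) \<Rightarrow> 'a set \<times> 'a set set \<Rightarrow> bool" where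
  "is_tree_in V adj T \<longleftrightarrow>
     (let VT = fst T; ET = snd T in
       VT \<subseteq> V \<and> finite VT \<and> VT \<noteq> {} \<and>
       ET \<subseteq> graph_edges V adj \<and> (\<forall>e\<in>ET. e \<subseteq> VT) \<and>
       (\<forall>x\<in>VT. \<forall>y\<in>VT. joined ET x y) \<and>
       (\<forall>e\<in>ET. \<forall>x y. e = {x, y} \<longrightarrow> \<not> joined (ET - {e}) x y))"

definition kappa_set :: "'a set \<Rightarrow> ('a \<Rightarrow> 'a \<Rightarrow> bool) \<Rightarrow> 'a set \<Rightarrow> nat" where
  "kappa_set V adj S = (GREATEST m. \<exists>T :: nat \<Rightarrow> 'a set \<times> 'a set set.
      (\<forall>i<m. is_tree_in V adj (T i) \<and> S \<subseteq> fst (T i)) \<and>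
      (\<forall>i<m. \<forall>j<m. i \<noteq> j \<longrightarrow> snd (T i) \<inter> snd (T j) = {} \<and> fst (T i) \<inter> fst (T j) = S))"

definition gen_connectivity :: "'a set \<Rightarrow> ('a \<Rightarrow> 'a \<Rightarrow> bool) \<Rightarrow> nat \<Rightarrow> nat" where
  "gen_connectivity V adj r = Min {kappa_set V adj S | S. S \<subseteq> V \<and> card S = r}"

text \<open>Vertices: bit strings u_1 ... u_{2n-1}, as bool lists of length 2n-1;
bit u_i is u ! (i - 1).\<close>
definition dual_cube_V :: "nat \<Rightarrow> bool list set" where
  "dual_cube_V n = {u. length u = 2 * n - 1}"

definition dual_cube_adj :: "nat \<Rightarrow> bool list \<Rightarrow> bool list \<Rightarrow> bool" where
  "dual_cube_adj n u v \<longleftrightarrow>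
     length u = 2 * n - 1 \<and> length v = 2 * n - 1 \<and>
     (\<exists>i. 1 \<le> i \<and> i \<le> 2 * n - 1 \<and>
        u ! (i - 1) \<noteq> v ! (i - 1) \<and>
        (\<forall>j. 1 \<le> j \<and> j \<le> 2 * n - 1 \<and> j \<noteq> i \<longrightarrow> u ! (j - 1) = v ! (j - 1)) \<and>
        (1 \<le> i \<and> i \<le> n - 1 \<longrightarrow> \<not> u ! (2 * n - 2) \<and> \<not> v ! (2 * n - 2)) \<and>
        (n \<le> i \<and> i \<le> 2 * n - 2 \<longrightarrow> u ! (2 * n - 2) \<and> v ! (2 * n - 2)))"

end

theory Submission
  imports Defs
begin

text \<open>
  If \<open>S\<close> contains adjacent vertices \<open>x\<close> and \<open>y\<close>, then \<open>n\<close> trees would use exactly one edge each at \<open>x\<close>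
  and at \<open>y\<close>, so the tree through \<open>xy\<close> would have no further vertex; this is the upper bound.

  For the lower bound put \<open>m = n - 1\<close> and write a vertex as \<open>(A, B, c)\<close> with \<open>A\<close>, \<open>B\<close> vertices of the
  cube \<open>Q\<^sub>m\<close>. The class \<open>c = 0\<close> splits into rows (fixed \<open>B\<close>) and the class \<open>c = 1\<close> into columns (fixed \<open>A\<close>),
  each an \<open>m\<close>-cube, and every row is joined to every column by exactly one cross edge. Rows and columns
  that avoid \<open>S\<close> therefore serve as hubs: it suffices to lead every terminal, inside its own cluster, along
  \<open>m\<close> disjoint routes to cross edges, such that routes with different labels use different
  columns (or rows). One or two terminals in a cluster are handled by the \<open>m\<close> disjoint paths of
  the cube. For three or four terminals each terminal takes, for every label, one of its neighbours
  or its own cross edge; common neighbours must then receive the same label, which is arranged by splitting the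
  cube along a coordinate, leaving four small configurations to be labelled by hand.
\<close>

section \<open>Trees from disjoint connected pieces\<close>

text \<open>Trees are labelled by the \<open>m\<close> directions of the cube, so that "label
  \<open>i\<close> moves in direction \<open>i\<close>" is a default and only coinciding neighbours
  need repair. No tree is built explicitly: disjoint connected pieces suffice. The obstacle is
  coordination between clusters. All rows must agree on which columns belong to which label, and hub
  columns must miss \<open>S\<close>. Agreement comes from a common pattern: the exits of a cluster
  with at most three terminals contain the neighbours of some vertex \<open>p\<close>, one of them
  possibly replaced by \<open>p\<close> itself, and a single terminal anywhere can reach this
  pattern. Avoidance of \<open>S\<close> is not arranged when one class has one cluster and all
  clusters of the other class hold one terminal each; there an exit may hit a column with a
  terminal, and the vertex left free by the paths of that column serves as the entry. The assumption
  \<open>n \<ge> 4\<close> gives \<open>m \<ge> 3\<close>, which the counts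
  \<open>2 * m < 2 ^ m\<close> and \<open>m + 4 \<le> 2 ^ m\<close> require.\<close>

lemma joined_refl [simp]: "joined E x x"
  by (simp add: joined_def)

lemma joined_trans: "joined E x y \<Longrightarrow> joined E y z \<Longrightarrow> joined E x z"
  by (simp add: joined_def)

lemma joined_sym: "joined E x y \<Longrightarrow> joined E y x"
  unfolding joined_def
proof (induction rule: rtranclp_induct)
  case (step y z)
  then have "{z, y} \<in> E" by (simp add: insert_commute)
  then show ?case using step.IH by (rule converse_rtranclp_into_rtranclp)
qed simp

lemma joined_edge: "{x, y} \<in> E \<Longrightarrow> joined E x y"
  by (auto simp: joined_def)

lemma joined_replace_edges:
  assumes "joined E x y" and "\<And>a b. {a, b} \<in> E \<Longrightarrow> joined F a b"
  shows "joined F x y"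
  using assms(1) unfolding joined_def[of E]
proof (induction rule: rtranclp_induct)
  case (step y z)
  then show ?case using joined_trans assms(2) by metis
qed simp

lemma joined_mono: "joined E x y \<Longrightarrow> E \<subseteq> F \<Longrightarrow> joined F x y"
  by (erule joined_replace_edges) (blast intro: joined_edge)

lemma joined_image:
  assumes "joined E x y"
  shows "joined ((`) f ` E) (f x) (f y)"
  using assms unfolding joined_def[of E]
proof (induction rule: rtranclp_induct)
  case (step y z)
  have "f ` {y, z} \<in> (`) f ` E" using step by blast
  then have "joined ((`) f ` E) (f y) (f z)" by (simp add: joined_edge)
  with step.IH show ?case by (rule joined_trans)
qed simp

lemma joined_first_edge:
  assumes "joined E x y" "x \<noteq> y"
  obtains v where "{x, v} \<in> E"
  using assms(1) unfolding joined_def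
proof (cases rule: converse_rtranclpE)
  case base
  then show ?thesis using assms(2) by simp
next
  case (step v)
  then show ?thesis using that by simp
qed

text \<open>An inclusion-minimal edge set that keeps \<open>VT\<close> connected is acyclic: an edge
  whose ends stay joined without it could be deleted.\<close>

lemma spanning_tree_exists:
  assumes fin: "finite VT" and ne: "VT \<noteq> {}" and sub: "VT \<subseteq> V"
    and E: "E \<subseteq> graph_edges V adj" "\<forall>e\<in>E. e \<subseteq> VT"
    and conn: "\<forall>x\<in>VT. \<forall>y\<in>VT. joined E x y"
  obtains F where "F \<subseteq> E" "is_tree_in V adj (VT, F)"
proof -
  define A where "A = {F. F \<subseteq> E \<and> (\<forall>x\<in>VT. \<forall>y\<in>VT. joined F x y)}"
  have "finite E" using E(2) fin by (meson Pow_iff finite_Pow_iff finite_subset subsetI)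
  then have "finite A" by (simp add: A_def)
  moreover have "E \<in> A" using conn by (simp add: A_def)
  ultimately obtain F where F: "F \<in> A" and min: "\<And>F'. F' \<in> A \<Longrightarrow> F' \<subseteq> F \<Longrightarrow> F = F'"
    using finite_has_minimal[of A] by blast
  have "\<not> joined (F - {{x, y}}) x y" if e: "{x, y} \<in> F" for x y
  proof
    assume j: "joined (F - {{x, y}}) x y"
    have "joined (F - {{x, y}}) a b" if ab: "{a, b} \<in> F" for a b
    proof (cases "{a, b} = {x, y}")
      case True
      then show ?thesis using j joined_sym[OF j] by (auto simp: doubleton_eq_iff)
    next
      case False
      then show ?thesis using ab by (auto intro: joined_edge)
    qed
    then have "F - {{x, y}} \<in> A"
      using F joined_replace_edges[of F _ _ "F - {{x, y}}"] unfolding A_def by blast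
    then have "F = F - {{x, y}}" using min by blast
    then show False using e by blast
  qed
  then have "is_tree_in V adj (VT, F)"
    using F fin ne sub E by (auto simp: is_tree_in_def A_def)
  then show ?thesis using that F by (auto simp: A_def)
qed

text \<open>The pieces \<open>W i\<close> are the trees without \<open>S\<close>; edges inside \<open>S\<close> have to be distributed explicitly, as \<open>G i\<close>.\<close>

definition piece_edges :: "('a \<Rightarrow> 'a \<Rightarrow> bool) \<Rightarrow> 'a set \<Rightarrow> 'a set \<Rightarrow> 'a set set \<Rightarrow> 'a set set" where
  "piece_edges adj S W G = {{u, v} | u v. u \<in> W \<and> v \<in> W \<union> S \<and> adj u v} \<union> G"

text \<open>The index type is arbitrary because the labels will be directions of a cube.\<close>

definition has_pieces :: "'a set \<Rightarrow> ('a \<Rightarrow> 'a \<Rightarrow> bool) \<Rightarrow> 'a set \<Rightarrow> 'i set \<Rightarrow> bool" where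
  "has_pieces V adj S I \<longleftrightarrow> (\<exists>W G.
     (\<forall>i\<in>I. W i \<subseteq> V - S \<and> G i \<subseteq> {{s, t} | s t. s \<in> S \<and> t \<in> S \<and> adj s t} \<and>
        (\<forall>u\<in>W i \<union> S. \<forall>v\<in>W i \<union> S. joined (piece_edges adj S (W i) (G i)) u v)) \<and>
     (\<forall>i\<in>I. \<forall>j\<in>I. i \<noteq> j \<longrightarrow> W i \<inter> W j = {} \<and> G i \<inter> G j = {}))"

text \<open>This is verbatim the property under \<open>GREATEST\<close> in
  \<open>kappa_set\<close>.\<close>

definition packs_trees :: "'a set \<Rightarrow> ('a \<Rightarrow> 'a \<Rightarrow> bool) \<Rightarrow> 'a set \<Rightarrow> nat \<Rightarrow> bool" where
  "packs_trees V adj S m \<longleftrightarrow> (\<exists>T :: nat \<Rightarrow> 'a set \<times> 'a set set.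
      (\<forall>i<m. is_tree_in V adj (T i) \<and> S \<subseteq> fst (T i)) \<and>
      (\<forall>i<m. \<forall>j<m. i \<noteq> j \<longrightarrow> snd (T i) \<inter> snd (T j) = {} \<and> fst (T i) \<inter> fst (T j) = S))"

lemma is_tree_inD:
  assumes "is_tree_in V adj T"
  shows "x \<in> fst T \<Longrightarrow> y \<in> fst T \<Longrightarrow> joined (snd T) x y"
    and "e \<in> snd T \<Longrightarrow> e \<in> graph_edges V adj"
  using assms unfolding is_tree_in_def Let_def by (simp, meson subsetD)

lemma packs_treesE:
  assumes "packs_trees V adj S m"
  obtains T where "\<And>i. i < m \<Longrightarrow> is_tree_in V adj (T i) \<and> S \<subseteq> fst (T i)"
    "\<And>i j. i < m \<Longrightarrow> j < m \<Longrightarrow> i \<noteq> j \<Longrightarrow> snd (T i) \<inter> snd (T j) = {}"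
proof -
  obtain T where "\<forall>i<m. is_tree_in V adj (T i) \<and> S \<subseteq> fst (T i)"
    and "\<forall>i<m. \<forall>j<m. i \<noteq> j \<longrightarrow> snd (T i) \<inter> snd (T j) = {} \<and> fst (T i) \<inter> fst (T j) = S"
    using assms unfolding packs_trees_def by (elim exE conjE)
  then show ?thesis by (intro that[of T]) simp_all
qed

lemma packs_trees_if_pieces:
  assumes fin: "finite V" and S: "S \<subseteq> V" "S \<noteq> {}" and p: "has_pieces V adj S {..<m}"
  shows "packs_trees V adj S m"
proof -
  obtain W G where
    WG0: "\<forall>i\<in>{..<m}. W i \<subseteq> V - S \<and> G i \<subseteq> {{s, t} | s t. s \<in> S \<and> t \<in> S \<and> adj s t} \<and>
        (\<forall>u\<in>W i \<union> S. \<forall>v\<in>W i \<union> S. joined (piece_edges adj S (W i) (G i)) u v)"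
    and dis0: "\<forall>i\<in>{..<m}. \<forall>j\<in>{..<m}. i \<noteq> j \<longrightarrow> W i \<inter> W j = {} \<and> G i \<inter> G j = {}"
    using p unfolding has_pieces_def by (elim exE conjE)
  have WG: "W i \<subseteq> V - S" "G i \<subseteq> {{s, t} | s t. s \<in> S \<and> t \<in> S \<and> adj s t}"
      "\<forall>u\<in>W i \<union> S. \<forall>v\<in>W i \<union> S. joined (piece_edges adj S (W i) (G i)) u v" if "i < m" for i
    using WG0 that by blast+
  have dis: "W i \<inter> W j = {} \<and> G i \<inter> G j = {}" if "i < m" "j < m" "i \<noteq> j" for i j
    using dis0 that by blast
  have "\<exists>F. F \<subseteq> piece_edges adj S (W i) (G i) \<and> is_tree_in V adj (W i \<union> S, F)" if i: "i < m" for i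
  proof -
    have "piece_edges adj S (W i) (G i) \<subseteq> graph_edges V adj"
      using WG(1,2)[OF i] S unfolding piece_edges_def graph_edges_def by fast
    moreover have "\<forall>e\<in>piece_edges adj S (W i) (G i). e \<subseteq> W i \<union> S"
      using WG(1,2)[OF i] unfolding piece_edges_def by blast
    moreover have "finite (W i \<union> S)" "W i \<union> S \<subseteq> V" "W i \<union> S \<noteq> {}"
      using WG(1)[OF i] S fin by (auto intro: finite_subset)
    ultimately show ?thesis using WG(3)[OF i] spanning_tree_exists by metis
  qed
  then obtain F where F: "\<And>i. i < m \<Longrightarrow> F i \<subseteq> piece_edges adj S (W i) (G i)"
      "\<And>i. i < m \<Longrightarrow> is_tree_in V adj (W i \<union> S, F i)" by metis
  have "piece_edges adj S (W i) (G i) \<inter> piece_edges adj S (W j) (G j) = {}"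
    if "i < m" "j < m" "i \<noteq> j" for i j
  proof -
    \<comment> \<open>An edge of the \<open>k\<close>-th piece lies in \<open>G k\<close> or meets
      \<open>W k\<close>, and it stays within \<open>W k\<close> and \<open>S\<close>; so it cannot
      belong to two pieces.\<close>
    have *: "e \<subseteq> W k \<union> S \<and> (e \<in> G k \<or> e \<inter> W k \<noteq> {})"
      if "k < m" "e \<in> piece_edges adj S (W k) (G k)" for e k
      using that(2) WG(2)[OF that(1)] unfolding piece_edges_def by blast
    have "e \<notin> piece_edges adj S (W j) (G j)" if e: "e \<in> piece_edges adj S (W i) (G i)" for e
    proof
      assume ej: "e \<in> piece_edges adj S (W j) (G j)"
      have "W i \<inter> (W j \<union> S) = {}" "W j \<inter> (W i \<union> S) = {}" "G i \<inter> G j = {}"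
        using dis[OF \<open>i < m\<close> \<open>j < m\<close> \<open>i \<noteq> j\<close>] WG(1)[OF \<open>i < m\<close>] WG(1)[OF \<open>j < m\<close>] by blast+
      then show False
        using *[OF \<open>i < m\<close> e] *[OF \<open>j < m\<close> ej] by blast
    qed
    then show ?thesis by blast
  qed
  then have "\<forall>i<m. \<forall>j<m. i \<noteq> j \<longrightarrow> F i \<inter> F j = {}" using F(1) by blast
  moreover have "\<forall>i<m. \<forall>j<m. i \<noteq> j \<longrightarrow> (W i \<union> S) \<inter> (W j \<union> S) = S" using dis by blast
  ultimately show ?thesis unfolding packs_trees_def
    using F(2) by (intro exI[of _ "\<lambda>i. (W i \<union> S, F i)"]) auto
qed

text \<open>Adjacency is preserved in one direction only, which is enough since pieces merely need
  their edges to exist. Applied to the exchange of the two classes and to the encoding as bit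
  strings.\<close>

lemma has_pieces_image:
  assumes p: "has_pieces V adj S I" and inj: "inj_on f V" and S: "S \<subseteq> V"
    and img: "f ` V \<subseteq> V'"
    and adj: "\<And>u v. u \<in> V \<Longrightarrow> v \<in> V \<Longrightarrow> adj u v \<Longrightarrow> adj' (f u) (f v)"
  shows "has_pieces V' adj' (f ` S) I"
proof -
  obtain W G where
    WG: "\<forall>i\<in>I. W i \<subseteq> V - S \<and> G i \<subseteq> {{s, t} | s t. s \<in> S \<and> t \<in> S \<and> adj s t} \<and>
        (\<forall>u\<in>W i \<union> S. \<forall>v\<in>W i \<union> S. joined (piece_edges adj S (W i) (G i)) u v)"
    and dis0: "\<forall>i\<in>I. \<forall>j\<in>I. i \<noteq> j \<longrightarrow> W i \<inter> W j = {} \<and> G i \<inter> G j = {}"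
    using p unfolding has_pieces_def by (elim exE conjE)
  have W: "W i \<subseteq> V - S" and G: "G i \<subseteq> {{s, t} | s t. s \<in> S \<and> t \<in> S \<and> adj s t}" if "i \<in> I" for i
    using WG that by blast+
  have J: "joined (piece_edges adj S (W i) (G i)) u v" if "i \<in> I" "u \<in> W i \<union> S" "v \<in> W i \<union> S" for i u v
    using WG that by blast
  have dis: "W i \<inter> W j = {} \<and> G i \<inter> G j = {}" if "i \<in> I" "j \<in> I" "i \<noteq> j" for i j
    using dis0 that by blast
  have injP: "inj_on ((`) f) (Pow V)" using inj by (simp add: inj_on_image_Pow)
  have GV: "G i \<subseteq> Pow V" if "i \<in> I" for i using G[OF that] S by blast
  have 1: "f ` W i \<subseteq> V' - f ` S" if "i \<in> I" for i
  proof -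
    have "f ` W i \<inter> f ` S = f ` (W i \<inter> S)"
      using W[OF that] S by (intro inj_on_image_Int[OF inj, symmetric]) auto
    moreover have "W i \<inter> S = {}" using W[OF that] by blast
    ultimately show ?thesis using W[OF that] img by blast
  qed
  have 2: "(`) f ` G i \<subseteq> {{s, t} | s t. s \<in> f ` S \<and> t \<in> f ` S \<and> adj' s t}" if i: "i \<in> I" for i
  proof
    fix e assume "e \<in> (`) f ` G i"
    then obtain s t where "e = f ` {s, t}" "s \<in> S" "t \<in> S" "adj s t" using G[OF i] by blast
    moreover from this have "adj' (f s) (f t)" using adj S by blast
    ultimately show "e \<in> {{s, t} | s t. s \<in> f ` S \<and> t \<in> f ` S \<and> adj' s t}" by blast
  qed
  have 3: "joined (piece_edges adj' (f ` S) (f ` W i) ((`) f ` G i)) (f u) (f v)"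
    if "i \<in> I" "u \<in> W i \<union> S" "v \<in> W i \<union> S" for i u v
  proof -
    have "(`) f ` piece_edges adj S (W i) (G i) \<subseteq> piece_edges adj' (f ` S) (f ` W i) ((`) f ` G i)"
    proof
      fix e assume "e \<in> (`) f ` piece_edges adj S (W i) (G i)"
      then consider u v where "e = {f u, f v}" "u \<in> W i" "v \<in> W i \<union> S" "adj u v" | "e \<in> (`) f ` G i"
        unfolding piece_edges_def by auto
      then show "e \<in> piece_edges adj' (f ` S) (f ` W i) ((`) f ` G i)"
      proof cases
        case 1
        then have "adj' (f u) (f v)" using adj W[OF that(1)] S by blast
        then show ?thesis using 1 unfolding piece_edges_def by blast
      qed (simp add: piece_edges_def)
    qed
    then show ?thesis by (rule joined_mono[OF joined_image[OF J[OF that]]])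
  qed
  have 4: "f ` W i \<inter> f ` W j = {} \<and> (`) f ` G i \<inter> (`) f ` G j = {}"
    if "i \<in> I" "j \<in> I" "i \<noteq> j" for i j
  proof -
    have "f ` W i \<inter> f ` W j = f ` (W i \<inter> W j)"
      using W that by (intro inj_on_image_Int[OF inj, symmetric]) blast+
    moreover have "(`) f ` G i \<inter> (`) f ` G j = (`) f ` (G i \<inter> G j)"
      using GV that by (intro inj_on_image_Int[OF injP, symmetric]) blast+
    ultimately show ?thesis using dis[OF that] by simp
  qed
  show ?thesis unfolding has_pieces_def
  proof (intro exI conjI ballI impI)
    fix i u v assume i: "i \<in> I" and "u \<in> f ` W i \<union> f ` S" "v \<in> f ` W i \<union> f ` S"
    then obtain u' v' where "u = f u'" "v = f v'" "u' \<in> W i \<union> S" "v' \<in> W i \<union> S" by blast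
    then show "joined (piece_edges adj' (f ` S) (f ` W i) ((`) f ` G i)) u v" using 3[OF i] by simp
  qed (use 1 2 4 in simp_all)
qed

text \<open>Each tree leaves \<open>x\<close> towards \<open>z\<close> by an edge of its own, and
  the far ends of these edges are distinct neighbours of \<open>x\<close>.\<close>

lemma packs_trees_le_degree:
  assumes p: "packs_trees V adj S m" and x: "x \<in> S" "z \<in> S" "x \<noteq> z"
    and N: "finite N" "\<And>v. v \<in> V \<Longrightarrow> adj x v \<or> adj v x \<Longrightarrow> v \<in> N"
  shows "m \<le> card N"
proof -
  obtain T where T: "\<And>i. i < m \<Longrightarrow> is_tree_in V adj (T i) \<and> S \<subseteq> fst (T i)"
    and dis: "\<And>i j. i < m \<Longrightarrow> j < m \<Longrightarrow> i \<noteq> j \<Longrightarrow> snd (T i) \<inter> snd (T j) = {}"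
    by (rule packs_treesE[OF p]) blast
  have "\<exists>v. {x, v} \<in> snd (T i)" if "i < m" for i
  proof -
    have "joined (snd (T i)) x z" using T[OF that] x is_tree_inD(1)[of V adj "T i"] by blast
    then show ?thesis using x(3) joined_first_edge by metis
  qed
  then obtain v where v: "\<And>i. i < m \<Longrightarrow> {x, v i} \<in> snd (T i)" by metis
  have "inj_on v {..<m}" using v dis by (fastforce intro: inj_onI)
  moreover have "v ` {..<m} \<subseteq> N"
  proof
    fix w assume "w \<in> v ` {..<m}"
    then obtain i where i: "i < m" "{x, w} \<in> snd (T i)" using v by auto
    then have "{x, w} \<in> graph_edges V adj" using T[OF i(1)] i(2) is_tree_inD(2)[of V adj "T i"] by blast
    then show "w \<in> N" using N(2) unfolding graph_edges_def by (auto simp: doubleton_eq_iff)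
  qed
  ultimately show ?thesis using N(1) by (metis card_image card_lessThan card_mono)
qed

text \<open>With as many trees as the degree of \<open>x\<close> and \<open>y\<close>, both ends are leaves of the tree through
  the edge \<open>xy\<close>, which is then the whole tree.\<close>

lemma packs_trees_less_degree:
  assumes p: "packs_trees V adj S m" and S: "x \<in> S" "y \<in> S" "z \<in> S" "z \<noteq> x" "z \<noteq> y" "x \<noteq> y"
    and V: "S \<subseteq> V" and xy: "adj x y"
    and Nx: "finite Nx" "\<And>v. v \<in> V \<Longrightarrow> adj x v \<or> adj v x \<Longrightarrow> v \<in> Nx" "card Nx = d"
    and Ny: "finite Ny" "\<And>v. v \<in> V \<Longrightarrow> adj y v \<or> adj v y \<Longrightarrow> v \<in> Ny" "card Ny = d"
  shows "m < d"
proof (rule ccontr)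
  assume "\<not> m < d"
  moreover have "m \<le> d" using packs_trees_le_degree[OF p, of x z Nx] S Nx by simp
  ultimately have md: "m = d" by simp
  obtain T where T: "\<And>i. i < m \<Longrightarrow> is_tree_in V adj (T i) \<and> S \<subseteq> fst (T i)"
    and dis: "\<And>i j. i < m \<Longrightarrow> j < m \<Longrightarrow> i \<noteq> j \<Longrightarrow> snd (T i) \<inter> snd (T j) = {}"
    by (rule packs_treesE[OF p]) blast
  \<comment> \<open>There are as many trees as neighbours of \<open>u\<close> and each tree has an
    edge at \<open>u\<close>, so each has exactly one, and every neighbour occurs.\<close>
  have leaf: "\<exists>v. (\<forall>i<m. \<forall>w. {u, w} \<in> snd (T i) \<longrightarrow> w = v i) \<and> v ` {..<m} = N"
    if u: "u \<in> S" "z \<noteq> u" and N: "finite N" "\<And>v. v \<in> V \<Longrightarrow> adj u v \<or> adj v u \<Longrightarrow> v \<in> N" "card N = d" for u N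
  proof -
    have "\<exists>v. {u, v} \<in> snd (T i)" if "i < m" for i
    proof -
      have "joined (snd (T i)) u z" using T[OF that] u S(3) is_tree_inD(1)[of V adj "T i"] by blast
      then show ?thesis using u(2) joined_first_edge by metis
    qed
    then obtain v where v: "\<And>i. i < m \<Longrightarrow> {u, v i} \<in> snd (T i)" by metis
    have inj: "inj_on v {..<m}" using v dis by (fastforce intro: inj_onI)
    have inN: "w \<in> N" if i: "i < m" "{u, w} \<in> snd (T i)" for w i
    proof -
      have "{u, w} \<in> graph_edges V adj" using T[OF i(1)] i(2) is_tree_inD(2)[of V adj "T i"] by blast
      then show "w \<in> N" using N(2) unfolding graph_edges_def by (auto simp: doubleton_eq_iff)
    qed
    have img: "v ` {..<m} = N"
      using inj inN v N(1,3) md by (intro card_subset_eq) (auto simp: card_image)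
    have "w = v i" if i: "i < m" "{u, w} \<in> snd (T i)" for w i
    proof -
      obtain j where "j < m" "w = v j" using inN[OF i] img by auto
      then show ?thesis using v[of j] i dis[of i j] by auto
    qed
    then show ?thesis using img by blast
  qed
  obtain f where f: "\<And>i w. i < m \<Longrightarrow> {x, w} \<in> snd (T i) \<Longrightarrow> w = f i" "f ` {..<m} = Nx"
    using leaf[OF S(1,4) Nx] by auto
  obtain g where g: "\<And>i w. i < m \<Longrightarrow> {y, w} \<in> snd (T i) \<Longrightarrow> w = g i"
    using leaf[OF S(2,5) Ny] by auto
  have "y \<in> Nx" using Nx(2) xy S V by blast
  then obtain i where i: "i < m" "f i = y" using f(2) by auto
  have jz: "joined (snd (T i)) x z" using T[OF i(1)] S is_tree_inD(1)[of V adj "T i"] by blast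
  then obtain w where "{x, w} \<in> snd (T i)" using S joined_first_edge by metis
  then have e: "{x, y} \<in> snd (T i)" using f(1) i by blast
  have "g i = x" using g[of i x] e i(1) by (auto simp: insert_commute)
  \<comment> \<open>The set \<open>{x, y}\<close> is closed under the edges of this tree, so
    \<open>z\<close> is out of reach.\<close>
  have "w \<in> {x, y}" if "joined (snd (T i)) x w" for w
    using that unfolding joined_def
    by (induction rule: rtranclp_induct) (use f(1) g i \<open>g i = x\<close> in blast)+
  then show False using jz S by blast
qed

section \<open>Disjoint paths in the hypercube\<close>

text \<open>Cube vertices are subsets of a set \<open>I\<close> of coordinates and
  \<open>dif\<close> is their exclusive or: \<open>dif x y\<close> is the set of coordinates in
  which they differ, and \<open>dif p\<close> is also the translation by \<open>p\<close>.\<close>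

definition dif :: "'i set \<Rightarrow> 'i set \<Rightarrow> 'i set" where
  "dif x y = (x - y) \<union> (y - x)"

definition flip :: "'i \<Rightarrow> 'i set \<Rightarrow> 'i set" where
  "flip i x = dif x {i}"

definition cube_adj :: "'i set \<Rightarrow> 'i set \<Rightarrow> 'i set \<Rightarrow> bool" where
  "cube_adj I x y \<longleftrightarrow> (\<exists>i\<in>I. y = flip i x)"

lemma dif_commute: "dif x y = dif y x"
  by (auto simp: dif_def)

lemma dif_empty_iff [simp]: "dif x y = {} \<longleftrightarrow> x = y"
  by (auto simp: dif_def)

lemma dif_self [simp]: "dif x x = {}"
  by simp

lemma dif_empty [simp]: "dif x {} = x" "dif {} x = x"
  by (auto simp: dif_def)

lemma dif_dif [simp]: "dif x (dif x y) = y"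
  by (auto simp: dif_def)

lemma dif_eq_iff [simp]: "dif x y = dif x z \<longleftrightarrow> y = z"
  by (metis dif_dif)

lemma dif_subset: "x \<subseteq> I \<Longrightarrow> y \<subseteq> I \<Longrightarrow> dif x y \<subseteq> I"
  by (auto simp: dif_def)

lemma mem_dif_trans: "i \<in> dif x z \<longleftrightarrow> (i \<in> dif x y) \<noteq> (i \<in> dif y z)"
  by (auto simp: dif_def)

lemma mem_flip [simp]: "j \<in> flip i x \<longleftrightarrow> (j \<in> x) \<noteq> (j = i)"
  by (auto simp: flip_def dif_def)

lemma flip_flip [simp]: "flip i (flip i x) = x"
  by auto

lemma flip_neq [simp]: "flip i x \<noteq> x" "x \<noteq> flip i x"
  by (metis mem_flip)+

lemma flip_eq_iff [simp]: "flip i x = flip j x \<longleftrightarrow> i = j"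
  by (metis mem_flip)

lemma flip_in_Pow: "i \<in> I \<Longrightarrow> x \<in> Pow I \<Longrightarrow> flip i x \<in> Pow I"
  by auto

lemma flip_eq_iff_dif: "flip i x = y \<longleftrightarrow> dif x y = {i}"
  by (metis dif_dif flip_def)

lemma flip_eq_flip_iff: "flip i x = flip j y \<longleftrightarrow> dif x y = dif {i} {j}"
  by (auto simp: flip_def dif_def set_eq_iff)

text \<open>Distinct vertices have a common neighbour only at distance two and reach it in the two
  different directions. This is the source of the second condition of
  \<open>routing\<close>.\<close>

lemma flip_eq_flipD: "flip i x = flip j y \<Longrightarrow> x \<noteq> y \<Longrightarrow> i \<noteq> j \<and> dif x y = {i, j}"
  unfolding flip_eq_flip_iff by (cases "i = j") (auto simp: dif_def)

lemma dif_flip_right: "dif p (flip i x) = flip i (dif p x)"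
  by (auto simp: dif_def set_eq_iff)

lemma cube_adj_flip: "i \<in> I \<Longrightarrow> cube_adj I x (flip i x)" "i \<in> I \<Longrightarrow> cube_adj I (flip i x) x"
  unfolding cube_adj_def by (auto intro: bexI[of _ i])

lemma piece_edgeI:
  "u \<in> W \<Longrightarrow> v \<in> W \<union> S \<Longrightarrow> adj u v \<Longrightarrow> {u, v} \<in> piece_edges adj S W G"
  unfolding piece_edges_def by blast

lemma joined_flip:
  assumes "u \<in> W" "flip i u \<in> W \<union> S" "i \<in> I"
  shows "joined (piece_edges (cube_adj I) S W G) u (flip i u)"
  using assms by (intro joined_edge piece_edgeI cube_adj_flip)

lemma joined_flip':
  assumes "u \<in> W" "flip i u \<in> W \<union> S" "i \<in> I"
  shows "joined (piece_edges (cube_adj I) S W G) (flip i u) u"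
  using joined_flip[OF assms] by (rule joined_sym)

lemma piece_edges_mono: "W \<subseteq> W' \<Longrightarrow> S \<subseteq> S' \<Longrightarrow> G \<subseteq> G' \<Longrightarrow> piece_edges adj S W G \<subseteq> piece_edges adj S' W' G'"
  unfolding piece_edges_def by blast

section \<open>Disjoint paths from one vertex to the neighbours of another\<close>

lemma joined_subcube:
  assumes "finite D" "D \<subseteq> I" and U: "\<And>A. A \<subseteq> D \<Longrightarrow> dif p A \<in> U" and A: "A \<subseteq> D"
  shows "joined (piece_edges (cube_adj I) S U G) p (dif p A)"
proof -
  have "finite A" using A \<open>finite D\<close> by (rule finite_subset)
  then show ?thesis using A
  proof (induction A rule: finite_induct)
    case (insert a A)
    have e: "dif p (insert a A) = flip a (dif p A)"
      using insert.hyps by (auto simp: dif_def)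
    have "joined (piece_edges (cube_adj I) S U G) (dif p A) (dif p (insert a A))"
      using insert.prems U[of A] U[of "insert a A"] \<open>D \<subseteq> I\<close> unfolding e by (intro joined_flip) auto
    then show ?case using insert by (auto intro: joined_trans)
  qed simp
qed

text \<open>\<open>W i\<close> is a connected set from the singleton \<open>{i}\<close> to the co-singleton \<open>D - {c i}\<close>. For a new
  coordinate \<open>d\<close> one of the old paths ends at the new co-singleton \<open>D\<close>, and the path of \<open>d\<close> inherits its old end.\<close>

lemma antipodal_disjoint_paths:
  assumes "finite D" "card D \<ge> 2"
  shows "\<exists>W c. (\<forall>i\<in>D. {i} \<in> W i \<and> c i \<in> D \<and> D - {c i} \<in> W i \<and> W i \<subseteq> Pow D - {{}, D} \<and>
           (\<forall>A\<in>W i. joined (piece_edges (cube_adj D) {} (W i) {}) {i} A)) \<and>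
         inj_on c D \<and> (\<forall>i\<in>D. \<forall>j\<in>D. i \<noteq> j \<longrightarrow> W i \<inter> W j = {})"
  using assms
proof (induction D rule: finite_induct)
  case (insert d D)
  show ?case
  proof (cases "card D \<ge> 2")
    case False
    then have "card D = 1" using insert by simp
    then obtain a where "D = {a}" by (auto simp: card_1_singleton_iff)
    then show ?thesis using insert.hyps
      by (intro exI[of _ "\<lambda>i. {{i}}"] exI[of _ "\<lambda>i. if i = a then d else a"]) (auto simp: inj_on_def)
  next
    case True
    from insert.IH[OF this] obtain W c where
      W0: "\<forall>i\<in>D. {i} \<in> W i \<and> c i \<in> D \<and> D - {c i} \<in> W i \<and> W i \<subseteq> Pow D - {{}, D} \<and>
           (\<forall>A\<in>W i. joined (piece_edges (cube_adj D) {} (W i) {}) {i} A)"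
      and inj: "inj_on c D" and dis0: "\<forall>i\<in>D. \<forall>j\<in>D. i \<noteq> j \<longrightarrow> W i \<inter> W j = {}"
      by (elim exE conjE)
    have W: "{i} \<in> W i" "c i \<in> D" "D - {c i} \<in> W i" "W i \<subseteq> Pow D - {{}, D}"
        "A \<in> W i \<Longrightarrow> joined (piece_edges (cube_adj D) {} (W i) {}) {i} A" if "i \<in> D" for i A
      using W0 that by blast+
    have dis: "W i \<inter> W j = {}" if "i \<in> D" "j \<in> D" "i \<noteq> j" for i j
      using dis0 that by blast
    obtain k where k: "k \<in> D" using True by fastforce
    \<comment> \<open>The set of the new coordinate \<open>d\<close> is a whole subcube, avoiding
      \<open>c k\<close>. It misses the new ends \<open>insert d (D - {c i})\<close> for
      \<open>i \<noteq> k\<close>, which contain \<open>c k\<close> because \<open>c\<close> is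
      injective.\<close>
    define W' where "W' i = (if i = d then {insert d A | A. A \<subseteq> D - {c k}}
       else if i = k then insert D (W k) else insert (insert d (D - {c i})) (W i))" for i
    define c' where "c' i = (if i = d then c k else if i = k then d else c i)" for i
    have d: "d \<notin> D" by fact
    have ck: "c k \<in> D" using W k by blast
    have nd: "A \<subseteq> D" if "A \<in> W i" "i \<in> D" for A i using W(4) that by blast
    have sub: "W i \<subseteq> W' i" if "i \<in> D" for i using that d by (auto simp: W'_def)
    have "{i} \<in> W' i \<and> c' i \<in> insert d D \<and> insert d D - {c' i} \<in> W' i \<and>
        W' i \<subseteq> Pow (insert d D) - {{}, insert d D} \<and>
        (\<forall>A\<in>W' i. joined (piece_edges (cube_adj (insert d D)) {} (W' i) {}) {i} A)"
      if i: "i \<in> insert d D" for i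
    proof (cases "i = d")
      case True
      have W'd: "W' d = {insert d A | A. A \<subseteq> D - {c k}}" by (simp add: W'_def)
      have "insert d D - {c' d} = insert d (D - {c k})" using d ck by (auto simp: c'_def)
      moreover have "joined (piece_edges (cube_adj (insert d D)) {} (W' d) {}) {d} (insert d A)"
        if "A \<subseteq> D - {c k}" for A
      proof -
        have e: "dif {d} B = insert d B" if "B \<subseteq> D - {c k}" for B using that d by (auto simp: dif_def)
        have "joined (piece_edges (cube_adj (insert d D)) {} (W' d) {}) {d} (dif {d} A)"
          using that insert.hyps(1) e by (intro joined_subcube[of "D - {c k}"]) (auto simp: W'd)
        then show ?thesis using e[OF that] by simp
      qed
      ultimately show ?thesis using True d ck by (auto simp: W'd c'_def)
    next
      case False
      then have iD: "i \<in> D" using i by simp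
      define z where "z = (if i = k then D else insert d (D - {c i}))"
      have W'i: "W' i = insert z (W i)" using False by (auto simp: W'_def z_def)
      have ci: "c i \<in> D" using W iD by blast
      have z1: "z = insert d D - {c' i}" using False d ci by (auto simp: z_def c'_def)
      have c'i: "c' i \<in> insert d D" using False ci by (auto simp: c'_def)
      have z2: "z \<noteq> {}" "z \<noteq> insert d D" "z \<subseteq> insert d D" using k d ci by (auto simp: z_def)
      \<comment> \<open>\<open>l\<close> is the coordinate flipped in the step that lengthens an old
        path: \<open>c k\<close> leads up to \<open>D\<close>, and \<open>d\<close> leads out of the
        old cube.\<close>
      define l where "l = (if i = k then c i else d)"
      have z3: "z = flip l (D - {c i})" using d ci by (auto simp: z_def l_def)
      have l: "l \<in> insert d D" using ci by (auto simp: l_def)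
      have m: "joined (piece_edges (cube_adj (insert d D)) {} (W' i) {}) {i} A" if "A \<in> W i" for A
      proof (rule joined_mono[OF W(5)[OF iD that]])
        show "piece_edges (cube_adj D) {} (W i) {} \<subseteq> piece_edges (cube_adj (insert d D)) {} (W' i) {}"
          using sub[OF iD] unfolding piece_edges_def cube_adj_def by blast
      qed
      moreover have "joined (piece_edges (cube_adj (insert d D)) {} (W' i) {}) {i} z"
      proof (rule joined_trans[OF m[OF W(3)[OF iD]]])
        show "joined (piece_edges (cube_adj (insert d D)) {} (W' i) {}) (D - {c i}) z"
          unfolding z3 using W(3)[OF iD] l by (intro joined_flip) (auto simp: W'i z3)
      qed
      moreover have "W i \<subseteq> Pow (insert d D) - {{}, insert d D}" using W(4)[OF iD] d by blast
      ultimately show ?thesis using W(1)[OF iD] z1 z2 c'i unfolding W'i by auto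
    qed
    moreover have "inj_on c' (insert d D)"
      using inj W(2) k d unfolding c'_def inj_on_def by (auto split: if_splits)
    moreover have "W' i \<inter> W' j = {}" if ij: "i \<in> insert d D" "j \<in> insert d D" "i \<noteq> j" for i j
    proof -
      have cneq: "c a \<noteq> c b" if "a \<in> D" "b \<in> D" "a \<noteq> b" for a b using inj that by (auto dest: inj_onD)
      have mem: "X \<in> W j \<or> j = k \<and> X = D \<or> j \<noteq> k \<and> X = insert d (D - {c j})"
        if "X \<in> W' j" "j \<in> D" for X j
        using that d unfolding W'_def by (auto split: if_splits)
      have Wd: "d \<notin> X" "X \<noteq> D" if "X \<in> W j" "j \<in> D" for X j
        using nd[OF that] W(4)[OF that(2)] that(1) d by blast+
      have 1: "W' d \<inter> W' j = {}" if j: "j \<in> D" for j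
      proof (rule ccontr)
        assume "W' d \<inter> W' j \<noteq> {}"
        then obtain X where X: "X \<in> W' d" "X \<in> W' j" by blast
        then obtain A where A: "X = insert d A" "A \<subseteq> D - {c k}" by (auto simp: W'_def)
        then have "d \<in> X" "c k \<notin> X" using ck d by auto
        then have "j \<noteq> k \<and> X = insert d (D - {c j})" using mem[OF X(2) j] Wd(1)[OF _ j] d by blast
        then show False using cneq[OF j k] ck \<open>c k \<notin> X\<close> by simp
      qed
      have 2: "W' i \<inter> W' j = {}" if ij: "i \<in> D" "j \<in> D" "i \<noteq> j" for i j
      proof (rule ccontr)
        assume "W' i \<inter> W' j \<noteq> {}"
        then obtain X where X: "X \<in> W' i" "X \<in> W' j" by blast
        have "insert d (D - {c i}) \<noteq> insert d (D - {c j})"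
        proof
          assume eq: "insert d (D - {c i}) = insert d (D - {c j})"
          have "c i \<in> insert d (D - {c j})" using W(2)[OF ij(1)] cneq[OF ij] by blast
          then have "c i \<in> insert d (D - {c i})" unfolding eq .
          then show False using W(2)[OF ij(1)] d by blast
        qed
        then show False
          using mem[OF X(1) ij(1)] mem[OF X(2) ij(2)] Wd[of X i] Wd[of X j] ij dis[OF ij] d by auto
      qed
      show ?thesis using ij 1 2 by (metis Int_commute insertE)
    qed
    ultimately show ?thesis by (intro exI[of _ W'] exI[of _ c']) blast
  qed
qed simp

text \<open>Directions in \<open>D\<close> use the antipodal paths of the subcube between
  \<open>p\<close> and \<open>s\<close>. A direction outside \<open>D\<close> uses the translate of
  that whole subcube, from which the same direction leads back to \<open>s\<close>. No
  \<open>W i\<close> contains \<open>p\<close>, which stays free for other purposes.\<close>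

lemma disjoint_cube_paths:
  assumes fin: "finite I" and s: "s \<in> Pow I" and p: "p \<in> Pow I" and ne: "s \<noteq> p"
  obtains W where "\<And>i. i \<in> I \<Longrightarrow> W i \<subseteq> Pow I - {s, p}"
    "\<And>i. i \<in> I \<Longrightarrow> flip i p \<in> insert s (W i)"
    "\<And>i v. i \<in> I \<Longrightarrow> v \<in> W i \<Longrightarrow> joined (piece_edges (cube_adj I) {s} (W i) {}) v s"
    "\<And>i j. i \<in> I \<Longrightarrow> j \<in> I \<Longrightarrow> i \<noteq> j \<Longrightarrow> W i \<inter> W j = {}"
proof -
  define D where "D = dif p s"
  have D: "D \<subseteq> I" "D \<noteq> {}" "finite D" and sD: "s = dif p D"
    using s p ne fin by (auto simp: D_def dif_def intro: finite_subset)
  have pA: "dif p A \<in> Pow I" if "A \<subseteq> I" for A using p that by (auto simp: dif_def)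
  define ok where "ok i X \<longleftrightarrow> X \<subseteq> Pow I - {s, p} \<and> flip i p \<in> insert s X \<and>
      (\<forall>v\<in>X. joined (piece_edges (cube_adj I) {s} X {}) v s)" for i X
  obtain Y where Y: "\<And>i. i \<in> D \<Longrightarrow> ok i (Y i) \<and> Y i \<subseteq> dif p ` Pow D"
    and Ydis: "\<And>i j. i \<in> D \<Longrightarrow> j \<in> D \<Longrightarrow> i \<noteq> j \<Longrightarrow> Y i \<inter> Y j = {}"
  proof (cases "card D \<ge> 2")
    case False
    moreover have "card D \<noteq> 0" using D by simp
    ultimately have "card D = 1" by linarith
    then obtain a where a: "D = {a}" by (auto simp: card_1_singleton_iff)
    show thesis by (rule that[of "\<lambda>_. {}"]) (auto simp: a sD ok_def flip_def)
  next
    case True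
    from antipodal_disjoint_paths[OF D(3) True] obtain W c where
      W0: "\<forall>i\<in>D. {i} \<in> W i \<and> c i \<in> D \<and> D - {c i} \<in> W i \<and> W i \<subseteq> Pow D - {{}, D} \<and>
           (\<forall>A\<in>W i. joined (piece_edges (cube_adj D) {} (W i) {}) {i} A)"
      and dis: "\<forall>i\<in>D. \<forall>j\<in>D. i \<noteq> j \<longrightarrow> W i \<inter> W j = {}" by (elim exE conjE)
    have ok: "ok i (dif p ` W i)" if i: "i \<in> D" for i
    proof -
      have Wi: "{i} \<in> W i" "c i \<in> D" "D - {c i} \<in> W i" "W i \<subseteq> Pow D - {{}, D}"
        and j: "\<And>A. A \<in> W i \<Longrightarrow> joined (piece_edges (cube_adj D) {} (W i) {}) {i} A"
        using W0 i by blast+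
      let ?E = "piece_edges (cube_adj I) {s} (dif p ` W i) {}"
      have im: "(`) (dif p) ` piece_edges (cube_adj D) {} (W i) {} \<subseteq> ?E"
      proof
        fix e assume "e \<in> (`) (dif p) ` piece_edges (cube_adj D) {} (W i) {}"
        then obtain u k where "e = {dif p u, dif p (flip k u)}" "u \<in> W i" "flip k u \<in> W i" "k \<in> D"
          unfolding piece_edges_def cube_adj_def by auto
        moreover from this have "cube_adj I (dif p u) (dif p (flip k u))"
          using D(1) unfolding dif_flip_right by (intro cube_adj_flip) blast
        ultimately show "e \<in> ?E" by (auto intro!: piece_edgeI)
      qed
      have toflip: "joined ?E (dif p {i}) (dif p A)" if "A \<in> W i" for A
        using joined_mono[OF joined_image[OF j[OF that]] im] .
      have fs: "s = flip (c i) (dif p (D - {c i}))" using Wi(2) unfolding sD by (auto simp: dif_def set_eq_iff)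
      have last: "joined ?E (dif p (D - {c i})) s"
      proof -
        have "joined ?E (dif p (D - {c i})) (flip (c i) (dif p (D - {c i})))"
          using Wi D(1) fs by (intro joined_flip) auto
        then show ?thesis using fs by simp
      qed
      have "joined ?E (dif p A) s" if "A \<in> W i" for A
        using joined_trans[OF joined_sym[OF toflip[OF that]] joined_trans[OF toflip[OF Wi(3)] last]] .
      moreover have "dif p ` W i \<subseteq> Pow I - {s, p}"
      proof
        fix v assume "v \<in> dif p ` W i"
        then obtain A where A: "v = dif p A" "A \<subseteq> D" "A \<noteq> {}" "A \<noteq> D" using Wi(4) by blast
        moreover have "dif p A \<noteq> p" using A(3) dif_eq_iff[of p A "{}"] by simp
        moreover have "dif p A \<in> Pow I" using A(2) D(1) by (intro pA) blast
        ultimately show "v \<in> Pow I - {s, p}" using sD by simp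
      qed
      moreover have "flip i p \<in> dif p ` W i" using Wi(1) unfolding flip_def by blast
      ultimately show ?thesis unfolding ok_def by blast
    qed
    have "dif p ` W i \<inter> dif p ` W j = {}" if "i \<in> D" "j \<in> D" "i \<noteq> j" for i j
      using bspec[OF bspec[OF dis that(1)] that(2)] that(3) by auto
    moreover have "dif p ` W i \<subseteq> dif p ` Pow D" if "i \<in> D" for i using W0 that by blast
    ultimately show thesis using ok by (intro that[of "\<lambda>i. dif p ` W i"]) auto
  qed
  define Z where "Z i = dif p ` insert i ` Pow D" for i
  have Zok: "ok i (Z i)" if i: "i \<in> I" "i \<notin> D" for i
  proof -
    let ?E = "piece_edges (cube_adj I) {s} (Z i) {}"
    have e: "dif (flip i p) A = dif p (insert i A)" if "A \<subseteq> D" for A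
      using that i(2) by (auto simp: dif_def set_eq_iff)
    have 1: "joined ?E (flip i p) (dif p (insert i A))" if "A \<subseteq> D" for A
    proof -
      have "joined ?E (flip i p) (dif (flip i p) A)"
        by (rule joined_subcube[OF D(3,1) _ that]) (auto simp: e Z_def)
      then show ?thesis using e that by simp
    qed
    have fs: "s = flip i (dif p (insert i D))" using i unfolding sD by (auto simp: dif_def set_eq_iff)
    have "joined ?E (dif p (insert i D)) (flip i (dif p (insert i D)))"
      using i fs by (intro joined_flip) (auto simp: Z_def)
    then have 2: "joined ?E (dif p (insert i D)) s" using fs by simp
    have "joined ?E (dif p (insert i A)) s" if "A \<subseteq> D" for A
      using joined_trans[OF joined_sym[OF 1[OF that]] joined_trans[OF 1[of D] 2]] by simp
    moreover have "flip i p \<in> Z i" unfolding Z_def flip_def by blast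
    moreover have "Z i \<subseteq> Pow I - {s, p}"
    proof
      fix v assume "v \<in> Z i"
      then obtain A where A: "v = dif p (insert i A)" "A \<subseteq> D" unfolding Z_def by blast
      moreover have "insert i A \<noteq> D" "insert i A \<noteq> {}" using i by blast+
      moreover have "dif p (insert i A) \<noteq> p" using dif_eq_iff[of p "insert i A" "{}"] by simp
      moreover have "dif p (insert i A) \<in> Pow I" using A(2) D(1) i by (intro pA) blast
      ultimately show "v \<in> Pow I - {s, p}" using sD by simp
    qed
    ultimately show ?thesis unfolding ok_def by (auto simp: Z_def)
  qed
  define X where "X i = (if i \<in> D then Y i else Z i)" for i
  have Xok: "ok i (X i)" if "i \<in> I" for i using Y Zok that by (auto simp: X_def)
  have ZY: "Z i \<inter> dif p ` Pow D = {}" if "i \<notin> D" for i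
    using that by (auto simp: Z_def)
  have ZZ: "Z i \<inter> Z j = {}" if "i \<notin> D" "j \<notin> D" "i \<noteq> j" for i j
  proof -
    have "insert i A \<noteq> insert j B" if "A \<subseteq> D" "B \<subseteq> D" for A B
      using that \<open>i \<notin> D\<close> \<open>i \<noteq> j\<close> by blast
    then show ?thesis by (auto simp: Z_def)
  qed
  show ?thesis
  proof (rule that[of X])
    fix i j assume "i \<in> I" "j \<in> I" "i \<noteq> j"
    then show "X i \<inter> X j = {}"
      using Ydis[of i j] ZZ[of i j] ZY[of i] ZY[of j] Y[of i] Y[of j] unfolding X_def
      by (cases "i \<in> D"; cases "j \<in> D") (simp_all, blast+)
  qed (use Xok in \<open>auto simp: ok_def\<close>)
qed

text \<open>\<open>U i\<close> and \<open>G i\<close> are the part of the \<open>i\<close>-th tree inside one cluster \<open>Pow I\<close> whose terminals are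
  \<open>S\<close>; trees are labelled by the directions of the cube. Every component of this part must reach a
  vertex of \<open>K i\<close>, where it leaves the cluster along the cross edge, and \<open>P i\<close> are vertices at which
  other clusters enter it.\<close>

definition hooked ::
  "'i set \<Rightarrow> 'i set set \<Rightarrow> ('i \<Rightarrow> 'i set set) \<Rightarrow> ('i \<Rightarrow> 'i set set) \<Rightarrow> ('i \<Rightarrow> 'i set set) \<Rightarrow>
    ('i \<Rightarrow> 'i set set set) \<Rightarrow> bool" where
  "hooked I S K P U G \<longleftrightarrow>
     (\<forall>i\<in>I. U i \<subseteq> Pow I - S \<and> G i \<subseteq> {{s, t} | s t. s \<in> S \<and> t \<in> S \<and> cube_adj I s t} \<and>
        P i \<subseteq> U i \<union> S \<and>
        (\<forall>v\<in>U i \<union> S. \<exists>c\<in>(U i \<union> S) \<inter> K i. joined (piece_edges (cube_adj I) S (U i) (G i)) v c)) \<and>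
     (\<forall>i\<in>I. \<forall>j\<in>I. i \<noteq> j \<longrightarrow> U i \<inter> U j = {} \<and> G i \<inter> G j = {})"

definition hook :: "'i set \<Rightarrow> 'i set set \<Rightarrow> ('i \<Rightarrow> 'i set set) \<Rightarrow> ('i \<Rightarrow> 'i set set) \<Rightarrow> bool" where
  "hook I S K P \<longleftrightarrow> (\<exists>U G. hooked I S K P U G)"

lemma hook_single:
  assumes fin: "finite I" and s: "s \<in> Pow I" and p: "p \<in> Pow I"
    and K: "\<And>i. i \<in> I \<Longrightarrow> flip i p \<in> K i \<or> i = k \<and> p \<in> K i"
    and P: "\<And>i. i \<in> I \<Longrightarrow> P i \<subseteq> (if i = k then {p} else {})"
  shows "hook I {s} K P"
proof (cases "s = p")
  case True
  let ?U = "\<lambda>i. {flip i s}"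
  have "\<exists>c\<in>(?U i \<union> {s}) \<inter> K i. joined (piece_edges (cube_adj I) {s} (?U i) {}) v c"
    if i: "i \<in> I" and v: "v \<in> ?U i \<union> {s}" for i v
  proof -
    have "joined (piece_edges (cube_adj I) {s} (?U i) {}) (flip i s) (flip i (flip i s))"
      using i by (intro joined_flip) auto
    then have "joined (piece_edges (cube_adj I) {s} (?U i) {}) a b" if "a \<in> {s, flip i s}" "b \<in> {s, flip i s}" for a b
      using that by (auto intro: joined_sym)
    then show ?thesis using v K[OF i] True by blast
  qed
  moreover have "P i \<subseteq> ?U i \<union> {s}" if "i \<in> I" for i using P[OF that] True by (auto split: if_splits)
  moreover have "?U i \<subseteq> Pow I - {s}" if "i \<in> I" for i using flip_in_Pow[OF that s] by simp
  ultimately show ?thesis unfolding hook_def hooked_def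
    by (intro exI[of _ ?U] exI[of _ "\<lambda>_. {}"]) (simp add: Ball_def)
next
  case False
  obtain W where W: "\<And>i. i \<in> I \<Longrightarrow> W i \<subseteq> Pow I - {s, p}"
    "\<And>i. i \<in> I \<Longrightarrow> flip i p \<in> insert s (W i)"
    "\<And>i v. i \<in> I \<Longrightarrow> v \<in> W i \<Longrightarrow> joined (piece_edges (cube_adj I) {s} (W i) {}) v s"
    "\<And>i j. i \<in> I \<Longrightarrow> j \<in> I \<Longrightarrow> i \<noteq> j \<Longrightarrow> W i \<inter> W j = {}"
    using disjoint_cube_paths[OF fin s p False] by blast
  define U where "U i = W i \<union> (if i = k then {p} else {})" for i
  let ?E = "\<lambda>i. piece_edges (cube_adj I) {s} (U i) {}"
  have W': "joined (?E i) v s" if i: "i \<in> I" and v: "v \<in> W i" for i v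
    by (rule joined_mono[OF W(3)[OF i v]], rule piece_edges_mono) (simp_all add: U_def)
  have js: "joined (?E i) v s" if i: "i \<in> I" and v: "v \<in> U i \<union> {s}" for i v
  proof (cases "v \<in> W i")
    case False
    show ?thesis
    proof (cases "v = s")
      case False
      then have vp: "v = p" "p \<in> U i" using v \<open>v \<notin> W i\<close> by (auto simp: U_def split: if_splits)
      have "joined (?E i) p (flip i p)" using vp i W(2)[OF i] by (intro joined_flip) (auto simp: U_def)
      moreover have "joined (?E i) (flip i p) s" using W(2)[OF i] W'[OF i] by auto
      ultimately show ?thesis using vp joined_trans by metis
    qed simp
  qed (use W' i in blast)
  have "\<exists>c\<in>(U i \<union> {s}) \<inter> K i. joined (?E i) v c" if i: "i \<in> I" and v: "v \<in> U i \<union> {s}" for i v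
  proof -
    have "flip i p \<in> U i \<union> {s}" "i = k \<Longrightarrow> p \<in> U i \<union> {s}"
      using W(2)[OF i] by (auto simp: U_def)
    then obtain c where c: "c \<in> U i \<union> {s}" "c \<in> K i" using K[OF i] by metis
    then show ?thesis
      by (intro bexI[of _ c] joined_trans[OF js[OF i v] joined_sym[OF js[OF i c(1)]]]) simp
  qed
  moreover have "U i \<inter> U j = {}" if "i \<in> I" "j \<in> I" "i \<noteq> j" for i j
    using W(1)[OF that(1)] W(1)[OF that(2)] W(4)[OF that] that(3) by (auto simp: U_def)
  moreover have "U i \<subseteq> Pow I - {s}" if "i \<in> I" for i
    using W(1)[OF that] p False by (auto simp: U_def split: if_splits)
  moreover have "P i \<subseteq> U i \<union> {s}" if "i \<in> I" for i using P[OF that] by (auto simp: U_def split: if_splits)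
  ultimately show ?thesis unfolding hook_def hooked_def
    by (intro exI[of _ U] exI[of _ "\<lambda>_. {}"]) (simp add: Ball_def)
qed

text \<open>The paths run from \<open>y\<close> to the neighbours of \<open>x\<close>, and
  \<open>x\<close> joins each by one edge; if the terminals are adjacent, one path is that edge. The
  permutation \<open>\<sigma>\<close> allows the labels at \<open>x\<close> to be matched with those
  of another cluster.\<close>

lemma hook_pair:
  assumes fin: "finite I" and x: "x \<in> Pow I" and y: "y \<in> Pow I" and ne: "x \<noteq> y"
    and \<sigma>: "bij_betw \<sigma> I I" and K: "\<And>i. i \<in> I \<Longrightarrow> flip (\<sigma> i) x \<in> K i \<or> x \<in> K i"
  shows "hook I {x, y} K (\<lambda>_. {})"
proof -
  obtain W where W: "\<And>i. i \<in> I \<Longrightarrow> W i \<subseteq> Pow I - {y, x}"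
    "\<And>i. i \<in> I \<Longrightarrow> flip i x \<in> insert y (W i)"
    "\<And>i v. i \<in> I \<Longrightarrow> v \<in> W i \<Longrightarrow> joined (piece_edges (cube_adj I) {y} (W i) {}) v y"
    "\<And>i j. i \<in> I \<Longrightarrow> j \<in> I \<Longrightarrow> i \<noteq> j \<Longrightarrow> W i \<inter> W j = {}"
    using disjoint_cube_paths[OF fin y x ne[symmetric]] by blast
  have \<sigma>I: "\<sigma> i \<in> I" if "i \<in> I" for i using \<sigma> that by (auto simp: bij_betw_def)
  have \<sigma>inj: "\<sigma> i \<noteq> \<sigma> j" if "i \<in> I" "j \<in> I" "i \<noteq> j" for i j
    using \<sigma> that by (auto simp: bij_betw_def inj_on_def)
  define G where "G i = (if flip (\<sigma> i) x = y then {{x, y}} else {})" for i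
  let ?U = "\<lambda>i. W (\<sigma> i)"
  let ?E = "\<lambda>i. piece_edges (cube_adj I) {x, y} (?U i) (G i)"
  have W': "joined (?E i) v y" if i: "i \<in> I" and v: "v \<in> ?U i" for i v
    by (rule joined_mono[OF W(3)[OF \<sigma>I[OF i] v]], rule piece_edges_mono) simp_all
  have jx: "joined (?E i) x y" if i: "i \<in> I" for i
  proof (cases "flip (\<sigma> i) x = y")
    case True
    then show ?thesis by (intro joined_edge) (simp add: piece_edges_def G_def)
  next
    case False
    then have f: "flip (\<sigma> i) x \<in> ?U i" using W(2)[OF \<sigma>I[OF i]] by simp
    have "joined (?E i) (flip (\<sigma> i) (flip (\<sigma> i) x)) (flip (\<sigma> i) x)"
      using f \<sigma>I[OF i] by (intro joined_flip') auto
    then show ?thesis using joined_trans[OF _ W'[OF i f]] by simp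
  qed
  have jy: "joined (?E i) v y" if i: "i \<in> I" and v: "v \<in> ?U i \<union> {x, y}" for i v
    using W'[OF i] jx[OF i] v by auto
  have "\<exists>c\<in>(?U i \<union> {x, y}) \<inter> K i. joined (?E i) v c" if i: "i \<in> I" and v: "v \<in> ?U i \<union> {x, y}" for i v
  proof -
    have "flip (\<sigma> i) x \<in> ?U i \<union> {x, y}" using W(2)[OF \<sigma>I[OF i]] by blast
    then obtain c where c: "c \<in> ?U i \<union> {x, y}" "c \<in> K i" using K[OF i] by blast
    then show ?thesis
      by (intro bexI[of _ c] joined_trans[OF jy[OF i v] joined_sym[OF jy[OF i c(1)]]]) simp
  qed
  moreover have "G i \<subseteq> {{s, t} | s t. s \<in> {x, y} \<and> t \<in> {x, y} \<and> cube_adj I s t}" if "i \<in> I" for i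
  proof (cases "flip (\<sigma> i) x = y")
    case True
    then have "cube_adj I x y" using \<sigma>I[OF that] cube_adj_flip by metis
    then show ?thesis by (auto simp: G_def)
  qed (simp add: G_def)
  moreover have "?U i \<inter> ?U j = {} \<and> G i \<inter> G j = {}" if "i \<in> I" "j \<in> I" "i \<noteq> j" for i j
    using W(4)[OF \<sigma>I[OF that(1)] \<sigma>I[OF that(2)] \<sigma>inj[OF that]] \<sigma>inj[OF that] by (auto simp: G_def)
  moreover have "?U i \<subseteq> Pow I - {x, y}" if "i \<in> I" for i
    using W(1)[OF \<sigma>I[OF that]] by auto
  ultimately show ?thesis unfolding hook_def hooked_def
    by (intro exI[of _ ?U] exI[of _ G]) (simp add: Ball_def)
qed

section \<open>Routings of terminals inside a cube\<close>

text \<open>In the tree with label \<open>i\<close> the terminal \<open>s\<close> uses the edge in direction \<open>a\<close> if \<open>g s i = Some a\<close> and its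
  own cross edge if \<open>g s i = None\<close>. The second condition says that a common neighbour gets a single label and
  that an edge between terminals is used once. By the third, a terminal that attaches to another terminal
  \<open>t\<close> finds \<open>t\<close> attached outside \<open>S\<close>.\<close>

definition routing :: "'i set \<Rightarrow> 'i set set \<Rightarrow> ('i set \<Rightarrow> 'i \<Rightarrow> 'i option) \<Rightarrow> bool" where
  "routing I S g \<longleftrightarrow>
     (\<forall>s\<in>S. inj_on (g s) I \<and> g s ` I \<subseteq> insert None (Some ` I)) \<and>
     (\<forall>s\<in>S. \<forall>t\<in>S. \<forall>i\<in>I. \<forall>j\<in>I. \<forall>a b.
        s \<noteq> t \<longrightarrow> i \<noteq> j \<longrightarrow> g s i = Some a \<longrightarrow> g t j = Some b \<longrightarrow> dif s t \<noteq> {a, b}) \<and>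
     (\<forall>s\<in>S. \<forall>t\<in>S. \<forall>u\<in>S. \<forall>i\<in>I. \<forall>a b.
        g s i = Some a \<longrightarrow> dif s t = {a} \<longrightarrow> g t i = Some b \<longrightarrow> dif t u \<noteq> {b})"

lemma routingI:
  assumes "\<And>s. s \<in> S \<Longrightarrow> inj_on (g s) I" "\<And>s i. s \<in> S \<Longrightarrow> i \<in> I \<Longrightarrow> g s i \<in> insert None (Some ` I)"
    "\<And>s t i j a b. \<lbrakk>s \<in> S; t \<in> S; i \<in> I; j \<in> I; s \<noteq> t; i \<noteq> j; g s i = Some a; g t j = Some b\<rbrakk> \<Longrightarrow> dif s t \<noteq> {a, b}"
    "\<And>s t u i a b. \<lbrakk>s \<in> S; t \<in> S; u \<in> S; i \<in> I; g s i = Some a; dif s t = {a}; g t i = Some b\<rbrakk> \<Longrightarrow> dif t u \<noteq> {b}"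
  shows "routing I S g"
  unfolding routing_def
proof (intro conjI ballI allI impI)
  fix s assume "s \<in> S"
  then show "inj_on (g s) I" "g s ` I \<subseteq> insert None (Some ` I)"
    by (rule assms(1)) (intro image_subsetI assms(2) \<open>s \<in> S\<close>)
qed (rule assms(3,4); assumption)+

lemma routingD:
  assumes "routing I S g"
  shows "s \<in> S \<Longrightarrow> inj_on (g s) I"
    and "s \<in> S \<Longrightarrow> i \<in> I \<Longrightarrow> g s i \<in> insert None (Some ` I)"
    and "\<lbrakk>s \<in> S; t \<in> S; i \<in> I; j \<in> I; s \<noteq> t; i \<noteq> j; g s i = Some a; g t j = Some b\<rbrakk> \<Longrightarrow> dif s t \<noteq> {a, b}"
    and "\<lbrakk>s \<in> S; t \<in> S; u \<in> S; i \<in> I; g s i = Some a; dif s t = {a}; g t i = Some b\<rbrakk> \<Longrightarrow> dif t u \<noteq> {b}"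
proof -
  have a: "\<forall>s\<in>S. inj_on (g s) I \<and> g s ` I \<subseteq> insert None (Some ` I)"
    "\<forall>s\<in>S. \<forall>t\<in>S. \<forall>i\<in>I. \<forall>j\<in>I. \<forall>a b.
        s \<noteq> t \<longrightarrow> i \<noteq> j \<longrightarrow> g s i = Some a \<longrightarrow> g t j = Some b \<longrightarrow> dif s t \<noteq> {a, b}"
    "\<forall>s\<in>S. \<forall>t\<in>S. \<forall>u\<in>S. \<forall>i\<in>I. \<forall>a b.
        g s i = Some a \<longrightarrow> dif s t = {a} \<longrightarrow> g t i = Some b \<longrightarrow> dif t u \<noteq> {b}"
    using assms unfolding routing_def by simp_all
  show "s \<in> S \<Longrightarrow> inj_on (g s) I" "s \<in> S \<Longrightarrow> i \<in> I \<Longrightarrow> g s i \<in> insert None (Some ` I)"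
    using a(1) by blast+
  show "\<lbrakk>s \<in> S; t \<in> S; i \<in> I; j \<in> I; s \<noteq> t; i \<noteq> j; g s i = Some a; g t j = Some b\<rbrakk> \<Longrightarrow> dif s t \<noteq> {a, b}"
    using a(2) by simp
  show "\<lbrakk>s \<in> S; t \<in> S; u \<in> S; i \<in> I; g s i = Some a; dif s t = {a}; g t i = Some b\<rbrakk> \<Longrightarrow> dif t u \<noteq> {b}"
    using a(3) by simp
qed

definition exits :: "'i set set \<Rightarrow> ('i set \<Rightarrow> 'i \<Rightarrow> 'i option) \<Rightarrow> 'i \<Rightarrow> 'i set set" where
  "exits S g i = {s \<in> S. g s i = None} \<union> {flip a s | s a. s \<in> S \<and> g s i = Some a \<and> flip a s \<notin> S}"

lemma exits_subset:
  assumes "routing I S g" "S \<subseteq> Pow I" "i \<in> I"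
  shows "exits S g i \<subseteq> Pow I"
proof -
  have "flip a s \<in> Pow I" if "s \<in> S" "g s i = Some a" for s a
  proof -
    have "a \<in> I" using routingD(2)[OF assms(1) that(1) assms(3)] that(2) by auto
    then show ?thesis using flip_in_Pow[of a I s] assms(2) that by blast
  qed
  then show ?thesis using assms(2) unfolding exits_def by blast
qed

lemma flip_slots_disjoint:
  assumes "routing I S g" "i \<in> I" "j \<in> I" "i \<noteq> j" "s \<in> S" "t \<in> S" "g s i = Some a" "g t j = Some b"
  shows "flip a s \<noteq> flip b t"
proof
  assume eq: "flip a s = flip b t"
  show False
  proof (cases "s = t")
    case True
    then have "a = b" using eq by simp
    then show False using inj_onD[OF routingD(1)[OF assms(1,5)] _ assms(2,3)] assms True by simp
  next
    case False
    then show False using flip_eq_flipD[OF eq] routingD(3)[OF assms(1,5,6,2,3) _ assms(4,7,8)] by blast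
  qed
qed

lemma exits_disjoint:
  assumes "routing I S g" "i \<in> I" "j \<in> I" "i \<noteq> j"
  shows "exits S g i \<inter> exits S g j = {}"
proof -
  have own: "\<not> (g s i = None \<and> g s j = None)" if "s \<in> S" for s
    using inj_onD[OF routingD(1)[OF assms(1) that] _ assms(2,3)] assms(4) by metis
  have "v \<notin> exits S g j" if "v \<in> exits S g i" for v
  proof
    assume "v \<in> exits S g j"
    then consider "v \<in> S" "g v j = None" | t b where "v = flip b t" "t \<in> S" "g t j = Some b" "v \<notin> S"
      unfolding exits_def by auto
    moreover from that consider "v \<in> S" "g v i = None" | s a where "v = flip a s" "s \<in> S" "g s i = Some a" "v \<notin> S"
      unfolding exits_def by auto
    ultimately show False using own flip_slots_disjoint[OF assms] by metis
  qed
  then show ?thesis by blast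
qed

text \<open>\<open>U i\<close> collects the neighbours used outside \<open>S\<close> and
  \<open>G i\<close> the edges used between terminals. Every terminal reaches an exit in at most two
  steps.\<close>

lemma hook_routing:
  assumes routing: "routing I S g" and S: "S \<subseteq> Pow I"
  shows "hook I S (exits S g) (\<lambda>_. {})"
proof -
  define U where "U i = {flip a s | s a. s \<in> S \<and> g s i = Some a \<and> flip a s \<notin> S}" for i
  define G where "G i = {{s, flip a s} | s a. s \<in> S \<and> g s i = Some a \<and> flip a s \<in> S}" for i
  let ?E = "\<lambda>i. piece_edges (cube_adj I) S (U i) (G i)"
  have aI: "a \<in> I" if "s \<in> S" "g s i = Some a" "i \<in> I" for s a i
    using routingD(2)[OF routing that(1,3)] that(2) by auto
  have 1: "U i \<subseteq> Pow I - S" if "i \<in> I" for i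
    using exits_subset[OF routing S that] unfolding exits_def U_def by blast
  have 2: "G i \<subseteq> {{s, t} | s t. s \<in> S \<and> t \<in> S \<and> cube_adj I s t}" if "i \<in> I" for i
  proof
    fix e assume "e \<in> G i"
    then obtain s a where "e = {s, flip a s}" "s \<in> S" "g s i = Some a" "flip a s \<in> S"
      unfolding G_def by auto
    moreover from this have "cube_adj I s (flip a s)" using aI that by (intro cube_adj_flip)
    ultimately show "e \<in> {{s, t} | s t. s \<in> S \<and> t \<in> S \<and> cube_adj I s t}" by blast
  qed
  have step: "joined (?E i) s (flip a s)" if "i \<in> I" "s \<in> S" "g s i = Some a" for i s a
  proof (cases "flip a s \<in> S")
    case True
    then show ?thesis using that by (intro joined_edge) (auto simp: piece_edges_def G_def)
  next
    case False
    then have "flip a s \<in> U i" using that unfolding U_def by blast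
    then have "joined (?E i) (flip a (flip a s)) (flip a s)"
      using that aI by (intro joined_flip') auto
    then show ?thesis by simp
  qed
  have UE: "U i \<subseteq> exits S g i" for i unfolding U_def exits_def by blast
  have out: "\<exists>c\<in>(U i \<union> S) \<inter> exits S g i. joined (?E i) s c"
    if i: "i \<in> I" and s: "s \<in> S" and n: "\<And>a. g s i = Some a \<Longrightarrow> flip a s \<notin> S" for i s
  proof (cases "g s i")
    case None
    then show ?thesis using s by (intro bexI[of _ s]) (auto simp: exits_def)
  next
    case (Some a)
    then have "flip a s \<in> U i" using n s unfolding U_def by blast
    then show ?thesis using step[OF i s Some] UE by blast
  qed
  have 3: "\<exists>c\<in>(U i \<union> S) \<inter> exits S g i. joined (?E i) v c" if i: "i \<in> I" and v: "v \<in> U i \<union> S" for i v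
  proof (cases "v \<in> U i")
    case True
    then show ?thesis using UE by (intro bexI[of _ v]) auto
  next
    case False
    then have vS: "v \<in> S" using v by simp
    show ?thesis
    proof (cases "\<exists>a. g v i = Some a \<and> flip a v \<in> S")
      case True
      then obtain a where a: "g v i = Some a" "flip a v \<in> S" by blast
      have "flip b (flip a v) \<notin> S" if "g (flip a v) i = Some b" for b
      proof
        assume "flip b (flip a v) \<in> S"
        moreover have "dif v (flip a v) = {a}" "dif (flip a v) (flip b (flip a v)) = {b}"
          by (simp_all flip: flip_eq_iff_dif)
        ultimately show False using routingD(4)[OF routing vS a(2) _ i a(1) _ that] by blast
      qed
      from out[OF i a(2) this] obtain c where "c \<in> (U i \<union> S) \<inter> exits S g i" "joined (?E i) (flip a v) c"
        by blast
      then show ?thesis using joined_trans[OF step[OF i vS a(1)]] by (intro bexI[of _ c])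
    next
      case False
      then show ?thesis using out[OF i vS] by blast
    qed
  qed
  have 4: "U i \<inter> U j = {}" if "i \<in> I" "j \<in> I" "i \<noteq> j" for i j
  proof -
    have "v \<notin> U j" if "v \<in> U i" for v
      using that flip_slots_disjoint[OF routing \<open>i \<in> I\<close> \<open>j \<in> I\<close> \<open>i \<noteq> j\<close>] unfolding U_def mem_Collect_eq by metis
    then show ?thesis by blast
  qed
  have 5: "G i \<inter> G j = {}" if ij: "i \<in> I" "j \<in> I" "i \<noteq> j" for i j
  proof (rule ccontr)
    assume "G i \<inter> G j \<noteq> {}"
    then obtain e where e: "e \<in> G i" "e \<in> G j" by blast
    obtain s a where s: "e = {s, flip a s}" "s \<in> S" "g s i = Some a" using e(1) unfolding G_def by auto
    obtain t b where t: "e = {t, flip b t}" "t \<in> S" "g t j = Some b" using e(2) unfolding G_def by auto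
    have st: "{s, flip a s} = {t, flip b t}" "s \<in> S" "t \<in> S" "g s i = Some a" "g t j = Some b"
      using s t by simp_all
    show False
    proof (cases "s = t")
      case True
      then show False using flip_slots_disjoint[OF routing ij st(2-5)] st(1) by (auto simp: doubleton_eq_iff)
    next
      case False
      then have "t = flip a s" "s = flip b t" using st(1) by (auto simp: doubleton_eq_iff)
      \<comment> \<open>An edge used by both of its ends is also excluded by the second condition:
        \<open>{a, b}\<close> is \<open>{a}\<close> when \<open>a = b\<close>.\<close>
      then have "dif s t = {a}" "b = a" by (metis flip_eq_iff_dif, metis flip_eq_iff flip_flip)
      then show False using routingD(3)[OF routing st(2,3) ij(1,2) False ij(3) st(4,5)] by simp
    qed
  qed
  show ?thesis unfolding hook_def hooked_def
    using 1 2 3 4 5 by (intro exI[of _ U] exI[of _ G]) (simp add: Ball_def)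
qed

text \<open>If \<open>D = {k, l}\<close> is the difference of two vertices, a common neighbour is
  reached by \<open>k\<close> from one and by \<open>l\<close> from the other. Exchanging
  \<open>k\<close> and \<open>l\<close> at one vertex makes the labels agree; for other sets
  \<open>D\<close> the identity serves.\<close>

lemma transposing_perm:
  assumes "\<And>a. D \<noteq> {a}" "D \<subseteq> I"
  obtains \<pi> where "inj \<pi>" "\<And>i. i \<in> I \<Longrightarrow> \<pi> i \<in> I" "\<And>i. i \<notin> D \<Longrightarrow> \<pi> i = i"
    "\<And>i j. i \<noteq> j \<Longrightarrow> D \<noteq> {i, \<pi> j}"
proof (cases "\<exists>k l. D = {k, l}")
  case True
  then obtain k l where D: "D = {k, l}" by blast
  then have "k \<noteq> l" using assms(1) by auto
  define \<pi> where "\<pi> i = (if i = k then l else if i = l then k else i)" for i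
  show ?thesis
    by (rule that[of \<pi>]) (use D \<open>k \<noteq> l\<close> assms(2) in \<open>auto simp: \<pi>_def inj_def doubleton_eq_iff split: if_splits\<close>)
next
  case False
  show ?thesis by (rule that[of id]) (use False in auto)
qed

text \<open>Label \<open>j\<close> is the own cross edge of every terminal, and no terminal moves in
  direction \<open>j\<close>. Terminals separated by \<open>j\<close> thus stay in different half
  cubes and cannot interfere.\<close>

lemma routing_own_label:
  assumes j: "j \<in> I" and h: "\<And>s. s \<in> S \<Longrightarrow> inj (h s) \<and> h s j = j \<and> (\<forall>i\<in>I. h s i \<in> I)"
    and st: "\<And>s t. s \<in> S \<Longrightarrow> t \<in> S \<Longrightarrow> s \<noteq> t \<Longrightarrow>
      j \<in> dif s t \<or> (\<forall>a. dif s t \<noteq> {a}) \<and> (\<forall>i k. i \<noteq> k \<longrightarrow> dif s t \<noteq> {h s i, h t k})"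
  shows "routing I S (\<lambda>s i. if i = j then None else Some (h s i))"
proof -
  have nj: "h s i \<noteq> j" if "s \<in> S" "i \<noteq> j" for s i using h[OF that(1)] that(2) by (metis injD)
  show ?thesis
  proof (rule routingI)
    fix s assume s: "s \<in> S"
    show "inj_on (\<lambda>i. if i = j then None else Some (h s i)) I"
      using h[OF s] by (auto simp: inj_on_def inj_def)
    show "(if i = j then None else Some (h s i)) \<in> insert None (Some ` I)" if "i \<in> I" for i
      using h[OF s] that by auto
  next
    fix s t i k a b assume *: "s \<in> S" "t \<in> S" "s \<noteq> t" "i \<noteq> k"
      "(if i = j then None else Some (h s i)) = Some a" "(if k = j then None else Some (h t k)) = Some b"
    then have "i \<noteq> j" "k \<noteq> j" "a = h s i" "b = h t k" by (auto split: if_splits)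
    then show "dif s t \<noteq> {a, b}" using st[OF *(1-3)] nj[OF *(1) \<open>i \<noteq> j\<close>] nj[OF *(2) \<open>k \<noteq> j\<close>] *(4) by auto
  next
    fix s t u i a b assume *: "s \<in> S" "t \<in> S" "dif s t = {a}"
      "(if i = j then None else Some (h s i)) = Some a"
    have "s \<noteq> t" using *(3) by auto
    moreover have "a \<noteq> j" using *(4) nj[OF *(1)] by (auto split: if_splits)
    ultimately show "dif t u \<noteq> {b}" using st[OF *(1,2)] *(3) by auto
  qed
qed

lemma routing_split:
  assumes j: "j \<in> I" "j \<notin> dif x y" "j \<notin> dif z w" "j \<in> dif x z"
    and sub: "dif x y \<subseteq> I" "dif z w \<subseteq> I" and ns: "\<And>a. dif x y \<noteq> {a}" "\<And>a. dif z w \<noteq> {a}"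
    and ne: "x \<noteq> y"
  obtains g where "routing I {x, y, z, w} g" "g x j = None" "\<And>i. i \<noteq> j \<Longrightarrow> g x i = Some i"
proof -
  obtain \<pi> where \<pi>: "inj \<pi>" "\<And>i. i \<in> I \<Longrightarrow> \<pi> i \<in> I" "\<And>i. i \<notin> dif x y \<Longrightarrow> \<pi> i = i"
    "\<And>i j. i \<noteq> j \<Longrightarrow> dif x y \<noteq> {i, \<pi> j}" using transposing_perm[OF ns(1) sub(1)] by metis
  obtain \<rho> where \<rho>: "inj \<rho>" "\<And>i. i \<in> I \<Longrightarrow> \<rho> i \<in> I" "\<And>i. i \<notin> dif z w \<Longrightarrow> \<rho> i = i"
    "\<And>i j. i \<noteq> j \<Longrightarrow> dif z w \<noteq> {i, \<rho> j}" using transposing_perm[OF ns(2) sub(2)] by metis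
  define h where "h s = (if s = y then \<pi> else if s = x \<or> s = z then id else \<rho>)" for s
  have jj: "j \<in> dif x w" "j \<in> dif y z" "j \<in> dif y w" using j by (auto simp: dif_def)
  have jj': "j \<in> dif w x" "j \<in> dif z y" "j \<in> dif w y" "j \<in> dif z x"
    using jj j(4) by (auto simp: dif_def)
  have ne2: "x \<noteq> z" "x \<noteq> w" "y \<noteq> z" "y \<noteq> w" using j jj by auto
  have hx: "h x = id" "h y = \<pi>" "h z = id" "z \<noteq> w \<Longrightarrow> h w = \<rho>" using ne ne2 by (auto simp: h_def)
  have xy: "dif x y \<noteq> {h x i, h y k}" "dif y x \<noteq> {h y i, h x k}" if "i \<noteq> k" for i k
    using \<pi>(4)[of i k] \<pi>(4)[of k i] that by (auto simp: hx dif_commute[of y x] insert_commute)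
  have zw: "dif z w \<noteq> {h z i, h w k}" "dif w z \<noteq> {h w i, h z k}" if "i \<noteq> k" "z \<noteq> w" for i k
    using \<rho>(4)[of i k] \<rho>(4)[of k i] that by (auto simp: hx dif_commute[of w z] insert_commute)
  have "routing I {x, y, z, w} (\<lambda>s i. if i = j then None else Some (h s i))"
  proof (rule routing_own_label[OF j(1)])
    fix s
    show "inj (h s) \<and> h s j = j \<and> (\<forall>i\<in>I. h s i \<in> I)"
      using \<pi>(1,2) \<pi>(3)[OF j(2)] \<rho>(1,2) \<rho>(3)[OF j(3)] by (auto simp: h_def)
  next
    fix s t assume st: "s \<in> {x, y, z, w}" "t \<in> {x, y, z, w}" "s \<noteq> t"
    have "j \<in> dif s t \<or> s = x \<and> t = y \<or> s = y \<and> t = x \<or> s = z \<and> t = w \<or> s = w \<and> t = z"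
      using st jj jj' j(4) by auto
    then show "j \<in> dif s t \<or> (\<forall>a. dif s t \<noteq> {a}) \<and> (\<forall>i k. i \<noteq> k \<longrightarrow> dif s t \<noteq> {h s i, h t k})"
    proof (elim disjE conjE)
      assume "s = x" "t = y"
      then show ?thesis using xy(1) ns by auto
    next
      assume "s = y" "t = x"
      then show ?thesis using xy(2) ns dif_commute[of y x] by auto
    next
      assume "s = z" "t = w"
      then show ?thesis using zw(1) st(3) ns by auto
    next
      assume "s = w" "t = z"
      then show ?thesis using zw(2) st(3) ns dif_commute[of w z] by auto
    qed simp
  qed
  then show ?thesis by (rule that) (simp_all add: hx)
qed

text \<open>A coordinate that separates a nonadjacent pair from the third terminal reduces to
  \<open>routing_split\<close>; if there is none, the three terminals form a path. The claim on
  \<open>w\<close> and \<open>j\<close> is the hypothesis of \<open>hook_single\<close>, by which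
  single terminals of other clusters reach the same exits.\<close>

lemma routing_triple:
  assumes ne: "x \<noteq> y" "x \<noteq> z" "y \<noteq> z" and sub: "dif x y \<subseteq> I" "dif x z \<subseteq> I" "dif y z \<subseteq> I"
  shows "\<exists>w\<in>{x, y, z}. \<exists>j\<in>I. \<exists>g. routing I {x, y, z} g \<and>
    w \<in> exits {x, y, z} g j \<and> (\<forall>i. i \<noteq> j \<longrightarrow> flip i w \<in> exits {x, y, z} g i)"
proof -
  have good: ?thesis if eq: "{x, y, z} = {a, b, c}" and ab: "a \<noteq> b" and j: "j \<in> dif a c" "j \<in> dif b c"
      and na: "\<And>e. dif a b \<noteq> {e}" and sub: "dif a b \<subseteq> I" "dif a c \<subseteq> I" for a b c j
  proof -
    have j': "j \<in> I" "j \<notin> dif a b" using j sub by (auto simp: dif_def)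
    obtain g where g: "routing I {a, b, c, c} g" "g a j = None" "\<And>i. i \<noteq> j \<Longrightarrow> g a i = Some i"
      by (rule routing_split[of j I a b c c]) (use j j' na sub ab in auto)
    then have routing: "routing I {x, y, z} g" and a: "a \<in> {x, y, z}" unfolding eq by simp_all
    have out: "flip i a \<notin> {x, y, z}" if "i \<noteq> j" for i
      unfolding eq using na j(1) that by (auto simp: flip_eq_iff_dif)
    have "flip i a \<in> exits {x, y, z} g i" if "i \<noteq> j" for i
      using out[OF that] g(3)[OF that] a unfolding exits_def by blast
    moreover have "a \<in> exits {x, y, z} g j" using a g(2) by (simp add: exits_def)
    ultimately show ?thesis using routing a j'(1) by blast
  qed
  have path: ?thesis if eq: "{x, y, z} = {u, v, c}" and u: "dif u c = {a}" and v: "dif v c = {b}" and ab: "a \<noteq> b" "a \<in> I" "b \<in> I"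
    for u v c a b
  proof -
    have uc: "u \<noteq> c" "v \<noteq> c" using u v by auto
    have duv: "dif u v = {a, b}" using u v ab unfolding dif_def set_eq_iff by auto
    then have uv: "u \<noteq> v" by auto
    \<comment> \<open>Label \<open>a\<close> uses the edge from \<open>c\<close> to
      \<open>u\<close>, while \<open>u\<close> and \<open>v\<close> take their cross edges. Label
      \<open>b\<close> takes the cross edge of \<open>c\<close> and lets \<open>u\<close> and
      \<open>v\<close> meet in their second common neighbour
      \<open>flip b u = flip a v\<close>.\<close>
    define g where "g s i = (if s = c then (if i = b then None else Some i)
        else if s = u then (if i = a then None else Some i)
        else (if i = a then None else if i = b then Some a else Some i))" for s i
    have gs: "g c = (\<lambda>i. if i = b then None else Some i)" "g u = (\<lambda>i. if i = a then None else Some i)"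
      "g v = (\<lambda>i. if i = a then None else if i = b then Some a else Some i)"
      using uc uv by (auto simp: g_def fun_eq_iff)
    have ds: "dif c u = {a}" "dif c v = {b}" "dif v u = {a, b}" using u v duv dif_commute by metis+
    have "routing I {u, v, c} g"
    proof (rule routingI)
      fix s assume "s \<in> {u, v, c}"
      then show "inj_on (g s) I" using ab by (auto simp: gs inj_on_def split: if_splits)
      show "g s i \<in> insert None (Some ` I)" if "i \<in> I" for i
        using \<open>s \<in> {u, v, c}\<close> ab that by (auto simp: gs split: if_splits)
    next
      fix s t i j e f
      assume "s \<in> {u, v, c}" "t \<in> {u, v, c}" "i \<in> I" "j \<in> I" "s \<noteq> t" "i \<noteq> j" "g s i = Some e" "g t j = Some f"
      then show "dif s t \<noteq> {e, f}" using ab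
        by (auto simp: gs u v ds duv doubleton_eq_iff split: if_splits)
    next
      fix s t r i e f
      assume "s \<in> {u, v, c}" "t \<in> {u, v, c}" "r \<in> {u, v, c}" "i \<in> I" "g s i = Some e" "dif s t = {e}" "g t i = Some f"
      then show "dif t r \<noteq> {f}" using ab
        by (auto simp: gs u v ds duv doubleton_eq_iff split: if_splits)
    qed
    moreover have "c \<in> exits {u, v, c} g b" by (simp add: exits_def gs)
    moreover have "flip i c \<in> exits {u, v, c} g i" if i: "i \<noteq> b" for i
    proof (cases "flip i c \<in> {u, v, c}")
      case True
      then have "flip i c = u" "i = a" using i ds by (auto simp: flip_eq_iff_dif)
      then show ?thesis by (simp add: exits_def gs)
    next
      case False
      moreover have "g c i = Some i" using i by (simp add: gs)
      ultimately show ?thesis unfolding exits_def by blast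
    qed
    ultimately show ?thesis unfolding eq using ab(3)
      by (intro bexI[of _ c] bexI[of _ b] exI[of _ g]) simp_all
  qed
  have nonadj: ?thesis if eq: "{x, y, z} = {a, b, c}" and d: "a \<noteq> b" "a \<noteq> c" "b \<noteq> c" and na: "\<And>e. dif a b \<noteq> {e}"
    and s: "dif a b \<subseteq> I" "dif a c \<subseteq> I" "dif b c \<subseteq> I" for a b c
  proof (cases "dif a c \<inter> dif b c = {}")
    case False
    then show ?thesis using good[OF eq d(1) _ _ na s(1,2)] by blast
  next
    case True
    \<comment> \<open>Here \<open>c\<close> lies on a shortest path between \<open>a\<close> and
      \<open>b\<close>, so each coordinate of \<open>dif a c\<close> separates \<open>a\<close> from
      the other two, and symmetrically for \<open>b\<close>.\<close>
    then have ab: "dif a b = dif a c \<union> dif b c" by (auto simp: dif_def)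
    obtain p q where pq: "p \<in> dif a c" "q \<in> dif b c" using d by (metis dif_empty_iff ex_in_conv)
    show ?thesis
    proof (cases "\<exists>e. dif b c = {e}")
      case False
      have "{x, y, z} = {b, c, a}" using eq by auto
      then show ?thesis by (rule good[of b c a p])
          (use False pq ab d s in \<open>simp_all add: dif_commute[of b a] dif_commute[of c a]\<close>)
    next
      case bc: True
      show ?thesis
      proof (cases "\<exists>e. dif a c = {e}")
        case False
        have "{x, y, z} = {a, c, b}" using eq by auto
        then show ?thesis by (rule good[of a c b q])
            (use False pq ab d s in \<open>simp_all add: dif_commute[of c b]\<close>)
      next
        case ac: True
        then have "dif a c = {p}" "dif b c = {q}" using bc pq by auto
        then show ?thesis by (intro path[OF eq, of p q]) (use s True in auto)
      qed
    qed
  qed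
  show ?thesis
  proof (cases "\<exists>e. dif x y = {e}")
    case False
    then show ?thesis by (intro nonadj[of x y z]) (use ne sub in auto)
  next
    case xy: True
    then obtain e where e: "dif x y = {e}" by blast
    show ?thesis
    proof (cases "\<exists>f. dif x z = {f}")
      case False
      then show ?thesis by (intro nonadj[of x z y]) (use ne sub in \<open>auto simp: dif_commute[of z y]\<close>)
    next
      case True
      then obtain f where f: "dif x z = {f}" by blast
      have "e \<noteq> f" using e f ne by (metis dif_dif)
      have "{x, y, z} = {y, z, x}" by auto
      then show ?thesis by (rule path[of y z x e f])
          (use e f \<open>e \<noteq> f\<close> sub in \<open>simp_all add: dif_commute[of y x] dif_commute[of z x]\<close>)
    qed
  qed
qed

section \<open>Routings of four terminals\<close>

definition slot :: "'i set \<Rightarrow> ('i \<Rightarrow> 'i option) \<Rightarrow> bool" where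
  "slot I h \<longleftrightarrow> inj_on h I \<and> (\<forall>i\<in>I. h i \<in> insert None (Some ` I))"

text \<open>The terminals in \<open>T\<close> use direction \<open>j\<close> for the new label \<open>j\<close>, which leads into the half cube of \<open>z\<close>.\<close>

lemma routing_isolate_aux:
  assumes routing: "routing (I - {j}) T g" and j: "j \<in> I" and z: "\<And>s. s \<in> T \<Longrightarrow> j \<in> dif s z"
    and h: "slot I h" "\<And>i. i \<in> I \<Longrightarrow> h i \<noteq> Some j"
    and hs: "\<And>s i b. s \<in> T \<Longrightarrow> i \<in> I \<Longrightarrow> i \<noteq> j \<Longrightarrow> h i = Some b \<Longrightarrow> dif s z \<noteq> {j, b}"
  shows "\<exists>g. routing I (insert z T) g"
proof -
  define g' where "g' s i = (if s = z then h i else if i = j then Some j else g s i)" for s i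
  have zT: "z \<notin> T" using z by force
  have jT: "j \<notin> dif s t" if "s \<in> T" "t \<in> T" for s t using z[OF that(1)] z[OF that(2)] by (auto simp: dif_def)
  have z': "j \<in> dif z s" if "s \<in> T" for s using z[OF that] by (simp add: dif_commute)
  have gz: "g' z = h" by (auto simp: g'_def)
  have gT: "g' s = (\<lambda>i. if i = j then Some j else g s i)" if "s \<in> T" for s
    using that zT by (auto simp: g'_def)
  have gj: "g s i \<in> insert None (Some ` (I - {j}))" if "s \<in> T" "i \<in> I" "i \<noteq> j" for s i
    using routingD(2)[OF routing that(1), of i] that(2,3) by simp
  have gj': "a \<noteq> j" if "g s i = Some a" "s \<in> T" "i \<in> I" "i \<noteq> j" for s i a
    using gj[OF that(2-4)] that(1) by auto
  have "routing I (insert z T) g'"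
  proof (rule routingI)
    fix s assume s: "s \<in> insert z T"
    show "inj_on (g' s) I"
    proof (cases "s = z")
      case True
      then show ?thesis using h(1) gz unfolding slot_def by simp
    next
      case False
      then have sT: "s \<in> T" using s by simp
      show ?thesis unfolding gT[OF sT]
      proof (rule inj_onI)
        fix i k assume ik: "i \<in> I" "k \<in> I" "(if i = j then Some j else g s i) = (if k = j then Some j else g s k)"
        show "i = k"
        proof (cases "i = j \<or> k = j")
          case True
          then show ?thesis using ik gj'[OF _ sT, of k j] gj'[OF _ sT, of i j] by (auto split: if_splits)
        next
          case False
          then show ?thesis using ik inj_onD[OF routingD(1)[OF routing sT], of i k] by simp
        qed
      qed
    qed
    show "g' s i \<in> insert None (Some ` I)" if "i \<in> I" for i
    proof (cases "s = z")
      case True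
      then show ?thesis using h(1) that gz unfolding slot_def by simp
    next
      case False
      then have sT: "s \<in> T" using s by simp
      then show ?thesis using gj[OF sT that] j gT[OF sT] by auto
    qed
  next
    fix s t i k a b
    assume *: "s \<in> insert z T" "t \<in> insert z T" "i \<in> I" "k \<in> I" "s \<noteq> t" "i \<noteq> k" "g' s i = Some a" "g' t k = Some b"
    have mixed: "dif s z \<noteq> {a, b}" if s: "s \<in> T" "g' s i = Some a" "i \<in> I" and k: "h k = Some b" "k \<in> I" "i \<noteq> k"
      for s i k a b
    proof (cases "i = j")
      case True
      then have "a = j" using s gT[OF s(1)] by simp
      then show ?thesis using hs[OF s(1) k(2) _ k(1)] True k(3) by simp
    next
      case False
      then have "a \<noteq> j" using s gT[OF s(1)] gj' by simp
      moreover have "b \<noteq> j" using h(2)[OF k(2)] k(1) by auto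
      ultimately show ?thesis using z[OF s(1)] by auto
    qed
    consider "s = z" "t \<in> T" | "t = z" "s \<in> T" | "s \<in> T" "t \<in> T" using * by blast
    then show "dif s t \<noteq> {a, b}"
    proof cases
      case 1
      then show ?thesis using mixed[OF 1(2) *(8,4), of i a] * gz by (simp add: dif_commute[of z t] insert_commute)
    next
      case 2
      then show ?thesis using mixed[OF 2(2) *(7,3), of k b] * gz by simp
    next
      case 3
      show ?thesis
      proof (cases "i = j \<or> k = j")
        case True
        then have "j \<in> {a, b}" using *(7,8) gT[OF 3(1)] gT[OF 3(2)] by auto
        then show ?thesis using jT[OF 3] by metis
      next
        case False
        then have "g s i = Some a" "g t k = Some b" using *(7,8) gT[OF 3(1)] gT[OF 3(2)] by auto
        then show ?thesis using routingD(3)[OF routing 3, of i k a b] * False by simp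
      qed
    qed
  next
    fix s t u i a b
    assume *: "s \<in> insert z T" "t \<in> insert z T" "u \<in> insert z T" "i \<in> I"
      "g' s i = Some a" "dif s t = {a}" "g' t i = Some b"
    have "s \<noteq> t" using *(6) by auto
    show "dif t u \<noteq> {b}"
    proof (cases "s = z")
      case True
      then have "t \<in> T" using * \<open>s \<noteq> t\<close> by blast
      then have "a = j" using z'[of t] *(6) True by auto
      then show ?thesis using h(2)[OF *(4)] *(5) True gz by simp
    next
      case False
      then have sT: "s \<in> T" using *(1) by simp
      show ?thesis
      proof (cases "t = z")
        case True
        then have hb: "h i = Some b" using *(7) gz by simp
        then have "b \<noteq> j" using h(2)[OF *(4)] by auto
        then show ?thesis using z'[of u] True *(3) by auto
      next
        case False
        then have tT: "t \<in> T" using *(2) by simp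
        have "a \<noteq> j" using jT[OF sT tT] *(6) by auto
        then have ij: "i \<noteq> j" using *(5) gT[OF sT] by auto
        then have g: "g s i = Some a" "g t i = Some b" using *(5,7) gT[OF sT] gT[OF tT] by auto
        show ?thesis
        proof (cases "u = z")
          case True
          then show ?thesis using z[OF tT] gj'[OF g(2) tT *(4) ij] by auto
        next
          case False
          then show ?thesis using routingD(4)[OF routing sT tT, of u i a b] * g ij by simp
        qed
      qed
    qed
  qed
  then show ?thesis by blast
qed

text \<open>In label \<open>j\<close> a terminal \<open>s\<close> of the other half moves to
  \<open>flip j s\<close>. This is a neighbour of \<open>z\<close> in a direction
  \<open>k \<noteq> j\<close> exactly when \<open>dif s z = {j, k}\<close>, and then
  \<open>z\<close> must use \<open>k\<close> for label \<open>j\<close>. By \<open>two\<close> at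
  most one such demand is made.\<close>

lemma routing_isolate:
  assumes ne: "x \<noteq> y" "x \<noteq> w" "y \<noteq> w" and j: "j \<in> dif x z" "j \<in> dif y z" "j \<in> dif w z"
    and sub: "dif x z \<subseteq> I" "dif y z \<subseteq> I" "dif w z \<subseteq> I"
    and two: "\<And>s t. s \<in> {x, y, w} \<Longrightarrow> t \<in> {x, y, w} \<Longrightarrow> card (dif s z) = 2 \<Longrightarrow> card (dif t z) = 2 \<Longrightarrow> s = t"
  shows "\<exists>g. routing I {z, x, y, w} g"
proof -
  let ?T = "{x, y, w}"
  have jI: "j \<in> I" using j sub by blast
  have jz: "j \<in> dif s z" if "s \<in> ?T" for s using that j by auto
  have sz: "dif s z \<subseteq> I" if "s \<in> ?T" for s using that sub by auto
  have "dif x y \<subseteq> I - {j}" "dif x w \<subseteq> I - {j}" "dif y w \<subseteq> I - {j}"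
    using j sub unfolding dif_def by blast+
  then obtain g where g: "routing (I - {j}) ?T g" using routing_triple[OF ne, of "I - {j}"] by blast
  show ?thesis
  proof (cases "\<exists>s\<in>?T. \<exists>k. k \<noteq> j \<and> dif s z = {j, k}")
    case True
    then obtain s k where s: "s \<in> ?T" "k \<noteq> j" "dif s z = {j, k}" by blast
    have kI: "k \<in> I" using sz[OF s(1)] s(3) by simp
    define h where "h i = (if i = j then Some k else if i = k then None else Some i)" for i
    have "slot I h" unfolding slot_def inj_on_def h_def using s(2) kI by (auto split: if_splits)
    moreover have "h i \<noteq> Some j" for i using s(2) by (auto simp: h_def)
    moreover have "dif t z \<noteq> {j, b}" if "t \<in> ?T" "i \<noteq> j" "h i = Some b" for t i b
    proof
      assume d: "dif t z = {j, b}"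
      have b: "b \<noteq> j" "b \<noteq> k" using that(2,3) s(2) by (auto simp: h_def split: if_splits)
      then have "card (dif t z) = 2" "card (dif s z) = 2" using d s by simp_all
      then have "t = s" using two that(1) s(1) by blast
      then show False using d s(3) b by auto
    qed
    ultimately show ?thesis using routing_isolate_aux[OF g jI jz, of h] by blast
  next
    case False
    define h where "h i = (if i = j then None else Some i)" for i
    have "slot I h" unfolding slot_def inj_on_def h_def by (auto split: if_splits)
    moreover have "h i \<noteq> Some j" for i by (auto simp: h_def)
    moreover have "dif t z \<noteq> {j, b}" if "t \<in> ?T" "i \<noteq> j" "h i = Some b" for t i b
      using that False by (auto simp: h_def)
    ultimately show ?thesis using routing_isolate_aux[OF g jI jz, of h] by blast
  qed
qed

text \<open>The last two conditions of \<open>routing\<close> for a pair with difference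
  \<open>D\<close>. The third is strengthened, a terminal to which another one attaches must use its
  cross edge, and so concerns two terminals instead of three.\<close>

definition slots_compat :: "'i set \<Rightarrow> 'i set \<Rightarrow> ('i \<Rightarrow> 'i option) \<Rightarrow> ('i \<Rightarrow> 'i option) \<Rightarrow> bool" where
  "slots_compat I D h h' \<longleftrightarrow>
     (\<forall>i\<in>I. \<forall>j\<in>I. \<forall>a b. i \<noteq> j \<longrightarrow> h i = Some a \<longrightarrow> h' j = Some b \<longrightarrow> D \<noteq> {a, b}) \<and>
     (\<forall>i\<in>I. \<forall>a. D = {a} \<longrightarrow> (h i = Some a \<longrightarrow> h' i = None) \<and> (h' i = Some a \<longrightarrow> h i = None))"

lemma slots_compatD:
  assumes "slots_compat I D h h'" "i \<in> I" "j \<in> I"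
  shows "i \<noteq> j \<Longrightarrow> h i = Some a \<Longrightarrow> h' j = Some b \<Longrightarrow> D \<noteq> {a, b}"
    and "D = {a} \<Longrightarrow> h i = Some a \<Longrightarrow> h' i = None"
  using assms unfolding slots_compat_def by simp_all

lemma slots_compat_sym:
  assumes "slots_compat I D h h'"
  shows "slots_compat I D h' h"
  unfolding slots_compat_def
proof (intro conjI ballI allI impI)
  fix i j a b assume "i \<in> I" "j \<in> I" "i \<noteq> j" "h' i = Some a" "h j = Some b"
  then show "D \<noteq> {a, b}" using slots_compatD(1)[OF assms, of j i b a] by (simp add: insert_commute)
qed (use assms in \<open>simp_all add: slots_compat_def\<close>)

lemma routing_four:
  assumes d: "distinct [w, x, y, z]"
    and sl: "slot I gw" "slot I gx" "slot I gy" "slot I gz"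
    and c: "slots_compat I (dif w x) gw gx" "slots_compat I (dif w y) gw gy" "slots_compat I (dif w z) gw gz"
      "slots_compat I (dif x y) gx gy" "slots_compat I (dif x z) gx gz" "slots_compat I (dif y z) gy gz"
  shows "\<exists>g. routing I {w, x, y, z} g"
proof -
  define g where "g s = (if s = w then gw else if s = x then gx else if s = y then gy else gz)" for s
  have g: "g w = gw" "g x = gx" "g y = gy" "g z = gz" using d by (auto simp: g_def)
  have c': "slots_compat I (dif s t) (g s) (g t)" if "s \<in> {w, x, y, z}" "t \<in> {w, x, y, z}" "s \<noteq> t" for s t
    using that c c[THEN slots_compat_sym]
    by (elim insertE emptyE) (simp_all add: g dif_commute[of x w] dif_commute[of y w] dif_commute[of z w]
        dif_commute[of y x] dif_commute[of z x] dif_commute[of z y])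
  have s': "slot I (g s)" if "s \<in> {w, x, y, z}" for s using that sl by (auto simp: g)
  have "routing I {w, x, y, z} g"
  proof (rule routingI)
    fix s t i j a b
    assume "s \<in> {w, x, y, z}" "t \<in> {w, x, y, z}" "i \<in> I" "j \<in> I" "s \<noteq> t" "i \<noteq> j" "g s i = Some a" "g t j = Some b"
    then show "dif s t \<noteq> {a, b}" using slots_compatD(1)[OF c'] by simp
  next
    fix s t u i a b
    assume *: "s \<in> {w, x, y, z}" "t \<in> {w, x, y, z}" "i \<in> I" "g s i = Some a" "dif s t = {a}" "g t i = Some b"
    then have "s \<noteq> t" by auto
    then show "dif t u \<noteq> {b}" using * slots_compatD(2)[OF c'[OF *(1,2)] *(3,3,5,4)] by simp
  qed (use s' in \<open>simp_all add: slot_def\<close>)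
  then show ?thesis by blast
qed

text \<open>The labelling is the Cayley table of the Klein four-group.\<close>

lemma routing_claw_without_center:
  assumes d: "distinct [a, b, c, e]" and I: "a \<in> I" "b \<in> I" "c \<in> I" "e \<in> I"
    and w: "dif w x = {a, b}" "dif w y = {a, c}" "dif w z = {a, e}"
      "dif x y = {b, c}" "dif x z = {b, e}" "dif y z = {c, e}"
  shows "\<exists>g. routing I {w, x, y, z} g"
proof -
  define gx where "gx i = (if i = a then Some b else if i = b then Some a else if i = c then Some e else if i = e then Some c else Some i)" for i
  define gy where "gy i = (if i = a then Some c else if i = b then Some e else if i = c then Some a else if i = e then Some b else Some i)" for i
  define gz where "gz i = (if i = a then Some e else if i = b then Some c else if i = c then Some b else if i = e then Some a else Some i)" for i
  have "slot I Some" "slot I gx" "slot I gy" "slot I gz"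
    unfolding slot_def inj_on_def gx_def gy_def gz_def using d I by (auto split: if_splits)
  moreover have "slots_compat I {a, b} Some gx" "slots_compat I {a, c} Some gy" "slots_compat I {a, e} Some gz"
    "slots_compat I {b, c} gx gy" "slots_compat I {b, e} gx gz" "slots_compat I {c, e} gy gz"
    unfolding slots_compat_def gx_def gy_def gz_def using d I by (auto simp: doubleton_eq_iff split: if_splits)
  moreover have "distinct [w, x, y, z]" using w by auto
  ultimately show ?thesis using routing_four[of w x y z I Some gx gy gz] w by simp
qed

text \<open>In label \<open>a\<close> the centre attaches to \<open>x\<close>, which uses its cross
  edge; likewise for \<open>b\<close> and \<open>c\<close>. The second common neighbour of two
  leaves gets the label of the third.\<close>

lemma routing_claw:
  assumes d: "distinct [a, b, c]" and I: "a \<in> I" "b \<in> I" "c \<in> I"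
    and w: "dif w x = {a}" "dif w y = {b}" "dif w z = {c}"
  shows "\<exists>g. routing I {w, x, y, z} g"
proof -
  have w': "dif x y = {a, b}" "dif x z = {a, c}" "dif y z = {b, c}"
    using w d unfolding dif_def set_eq_iff by auto
  define gx where "gx i = (if i = a then None else if i = b then Some c else if i = c then Some b else Some i)" for i
  define gy where "gy i = (if i = b then None else if i = a then Some c else if i = c then Some a else Some i)" for i
  define gz where "gz i = (if i = c then None else if i = a then Some b else if i = b then Some a else Some i)" for i
  have "slot I Some" "slot I gx" "slot I gy" "slot I gz"
    unfolding slot_def inj_on_def gx_def gy_def gz_def using d I by (auto split: if_splits)
  moreover have "slots_compat I {a} Some gx" "slots_compat I {b} Some gy" "slots_compat I {c} Some gz"
    "slots_compat I {a, b} gx gy" "slots_compat I {a, c} gx gz" "slots_compat I {b, c} gy gz"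
    unfolding slots_compat_def gx_def gy_def gz_def using d I by (auto simp: doubleton_eq_iff split: if_splits)
  moreover have "distinct [w, x, y, z]" using w w' by auto
  ultimately show ?thesis using routing_four[of w x y z I Some gx gy gz] w w' by simp
qed

text \<open>Labels \<open>q\<close> and \<open>j\<close> each use the two parallel edges of their
  own direction: in label \<open>q\<close> the corners \<open>w\<close> and \<open>z\<close> take
  their cross edges and receive \<open>x\<close> and \<open>y\<close>, in label \<open>j\<close> the
  roles are exchanged.\<close>

lemma routing_square:
  assumes d: "q \<noteq> j" and I: "q \<in> I" "j \<in> I"
    and w: "dif w x = {q}" "dif w y = {j}" "dif w z = {q, j}"
  shows "\<exists>g. routing I {w, x, y, z} g"
proof -
  have w': "dif x y = {q, j}" "dif x z = {j}" "dif y z = {q}"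
    using w d unfolding dif_def set_eq_iff by auto
  define gw where "gw i = (if i = q then None else Some i)" for i
  define gx where "gx i = (if i = j then None else Some i)" for i
  have "slot I gw" "slot I gx"
    unfolding slot_def inj_on_def gw_def gx_def using d I by (auto split: if_splits)
  moreover have "slots_compat I {q} gw gx" "slots_compat I {j} gw gx" "slots_compat I {q, j} gw gw"
    "slots_compat I {q, j} gx gx" "slots_compat I {j} gx gw" "slots_compat I {q} gx gw"
    unfolding slots_compat_def gw_def gx_def using d I by (auto simp: doubleton_eq_iff split: if_splits)
  moreover have "distinct [w, x, y, z]" using w w' by auto
  ultimately show ?thesis using routing_four[of w x y z I gw gx gx gw] w w' by simp
qed

text \<open>Within the 3-cube of \<open>q\<close>, \<open>j\<close>, \<open>r\<close> the vertex
  \<open>z\<close> is opposite to \<open>w\<close>. Label \<open>r\<close> lets \<open>x\<close>,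
  \<open>y\<close>, \<open>z\<close> meet in \<open>dif w {q, j}\<close>; labels \<open>q\<close>
  and \<open>j\<close> use the edges from \<open>w\<close> to \<open>x\<close> and to
  \<open>y\<close>.\<close>

lemma routing_path_and_antipode:
  assumes d: "distinct [q, j, r]" and I: "q \<in> I" "j \<in> I" "r \<in> I"
    and w: "dif w x = {q}" "dif w y = {j}" "dif w z = {q, j, r}"
  shows "\<exists>g. routing I {w, x, y, z} g"
proof -
  have w': "dif x y = {q, j}" "dif x z = {j, r}" "dif y z = {q, r}"
    using w d unfolding dif_def set_eq_iff by auto
  define gx where "gx i = (if i = q then None else if i = j then Some r else if i = r then Some j else Some i)" for i
  define gy where "gy i = (if i = j then None else if i = q then Some r else if i = r then Some q else Some i)" for i
  have "slot I Some" "slot I gx" "slot I gy"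
    unfolding slot_def inj_on_def gx_def gy_def using d I by (auto split: if_splits)
  moreover have "{q, j, r} \<noteq> {a, b}" for a b
  proof
    assume "{q, j, r} = {a, b}"
    moreover have "card {q, j, r} = 3" using d by simp
    moreover have "card {a, b} \<le> 2" by (simp add: card_insert_if)
    ultimately show False by simp
  qed
  from this this[of a a for a] have "{q, j, r} \<noteq> {a, b}" "{q, j, r} \<noteq> {a}" for a b by simp_all
  then have "slots_compat I {q, j, r} Some Some" unfolding slots_compat_def by blast
  moreover have "slots_compat I {q} Some gx" "slots_compat I {j} Some gy"
    "slots_compat I {q, j} gx gy" "slots_compat I {j, r} gx Some" "slots_compat I {q, r} gy Some"
    unfolding slots_compat_def gx_def gy_def using d I by (auto simp: doubleton_eq_iff split: if_splits)
  moreover have "distinct [w, x, y, z]" using w w' by auto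
  ultimately show ?thesis using routing_four[of w x y z I Some gx gy Some] w w' by simp
qed

lemma not_mem_dif: "i \<in> dif w x \<Longrightarrow> i \<in> dif w y \<Longrightarrow> i \<notin> dif x y"
  using mem_dif_trans[of i x y w] by (simp add: dif_commute[of x w])

lemma dif_Un_disjoint: "dif w x \<inter> dif w y = {} \<Longrightarrow> dif y x = dif w x \<union> dif w y"
proof (rule set_eqI)
  fix i assume "dif w x \<inter> dif w y = {}"
  then show "i \<in> dif y x \<longleftrightarrow> i \<in> dif w x \<union> dif w y"
    unfolding mem_dif_trans[of i y x w] dif_commute[of y w] by blast
qed

lemma dif_adjacent:
  assumes "dif w x = {q}"
  shows "dif x z = flip q (dif w z)"
proof -
  have "x = flip q w" using assms by (simp add: flip_eq_iff_dif[symmetric])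
  then show ?thesis by (auto simp: dif_def)
qed

lemma mem_dif_adjacent:
  assumes "dif w x = {q}"
  shows "i \<in> dif x z \<longleftrightarrow> (i \<in> dif w z) \<noteq> (i = q)"
  by (simp add: dif_adjacent[OF assms])

text \<open>\<open>A\<close> is what remains of \<open>dif w z\<close> beyond the corner. With two
  or more coordinates left, one of them isolates \<open>z\<close>, which is at distance at least
  three from the others; the two smaller cases are labelled by hand.\<close>

lemma routing_corner:
  assumes fin: "finite I" and P: "w \<in> Pow I" "x \<in> Pow I" "y \<in> Pow I" "z \<in> Pow I"
    and w: "dif w x = {q}" "dif w y = {j}" "q \<noteq> j" "q \<in> dif w z" "j \<in> dif w z"
  shows "\<exists>g. routing I {w, x, y, z} g"
proof -
  have I: "q \<in> I" "j \<in> I" "dif w z \<subseteq> I" "dif x z \<subseteq> I" "dif y z \<subseteq> I"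
    using P w dif_subset[of w I x] dif_subset[of w I y] by (simp_all add: dif_subset)
  have xz: "dif x z = dif w z - {q}" and yz: "dif y z = dif w z - {j}"
    using w(4,5) by (auto simp: mem_dif_adjacent[OF w(1)] mem_dif_adjacent[OF w(2)])
  define A where "A = dif w z - {q, j}"
  have wz: "dif w z = insert q (insert j A)" using w by (auto simp: A_def)
  have fA: "finite A" using fin I by (auto simp: A_def intro: finite_subset)
  consider "A = {}" | r where "A = {r}" | r where "r \<in> A" "card A \<ge> 2"
  proof -
    assume a: "A = {} \<Longrightarrow> thesis" "\<And>r. A = {r} \<Longrightarrow> thesis" "\<And>r. r \<in> A \<Longrightarrow> 2 \<le> card A \<Longrightarrow> thesis"
    have "card A = 0 \<or> card A = 1 \<or> card A \<ge> 2" by linarith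
    then show thesis using a fA by (auto simp: card_1_singleton_iff)
  qed
  then show ?thesis
  proof cases
    case 1
    then show ?thesis using routing_square[of q j I w x y z] w I wz by simp
  next
    case 2
    then have "r \<in> I" "r \<noteq> q" "r \<noteq> j" using I(3) by (auto simp: A_def)
    then show ?thesis using routing_path_and_antipode[of q j r I w x y z] w I wz 2 by auto
  next
    case 3
    have c: "card (dif w z) = card A + 2" using fA w(3) unfolding wz by (auto simp: A_def)
    have "card (dif x z) = card A + 1" "card (dif y z) = card A + 1"
      using c w(4,5) unfolding xz yz by simp_all
    then have n2: "card (dif s z) \<noteq> 2" if "s \<in> {w, x, y}" for s using that c 3(2) by auto
    have r: "r \<in> dif w z" "r \<in> dif x z" "r \<in> dif y z" using 3(1) unfolding xz yz by (auto simp: A_def)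
    have ne: "w \<noteq> x" "w \<noteq> y" "x \<noteq> y" using w by auto
    have "\<exists>g. routing I {z, w, x, y} g" by (rule routing_isolate[OF ne r I(3-5)]) (use n2 in blast)
    moreover have "{z, w, x, y} = {w, x, y, z}" by auto
    ultimately show ?thesis by simp
  qed
qed

text \<open>Coordinate \<open>q\<close> isolates \<open>w\<close>. A terminal at distance two from
  \<open>w\<close> is not \<open>x\<close>, so it differs from \<open>w\<close> exactly in
  \<open>{q, j}\<close>, and there is at most one.\<close>

lemma routing_pendant_edge:
  assumes fin: "finite I" and P: "w \<in> Pow I" "x \<in> Pow I" "y \<in> Pow I" "z \<in> Pow I"
    and d: "distinct [w, x, y, z]" and w: "dif w x = {q}" "q \<in> dif w y" "q \<in> dif w z"
    and j: "j \<noteq> q" "j \<in> dif w y" "j \<in> dif w z"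
  shows "\<exists>g. routing I {w, x, y, z} g"
proof (rule routing_isolate)
  show "x \<noteq> y" "x \<noteq> z" "y \<noteq> z" using d by auto
  show "q \<in> dif x w" "q \<in> dif y w" "q \<in> dif z w" using w by (simp_all add: dif_commute[of _ w])
  show "dif x w \<subseteq> I" "dif y w \<subseteq> I" "dif z w \<subseteq> I" using P by (simp_all add: dif_subset)
  fix s t assume st: "s \<in> {x, y, z}" "t \<in> {x, y, z}" "card (dif s w) = 2" "card (dif t w) = 2"
  have "dif w s = {q, j}" if "s \<in> {x, y, z}" "card (dif s w) = 2" for s
  proof -
    have s: "s \<in> {y, z}" "card (dif w s) = 2" using that w by (auto simp: dif_commute[of _ w])
    then have "{q, j} \<subseteq> dif w s" using w j by auto
    moreover have "finite (dif w s)" using s(2) card_ge_0_finite[of "dif w s"] by simp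
    ultimately show ?thesis using card_subset_eq[of "dif w s" "{q, j}"] s(2) j(1) by simp
  qed
  then have "dif w s = dif w t" using st by metis
  then show "s = t" by simp
qed

text \<open>If \<open>y\<close> and \<open>z\<close> lie on the same side of \<open>q\<close>, the
  end of the edge on the other side is isolated. Otherwise \<open>q\<close> itself splits two
  against two, and \<open>routing_split\<close> applies unless one of these pairs is adjacent, which
  gives a corner.\<close>

lemma routing_edge_split:
  assumes fin: "finite I" and P: "w \<in> Pow I" "x \<in> Pow I" "y \<in> Pow I" "z \<in> Pow I"
    and d: "distinct [w, x, y, z]" and w: "dif w x = {q}"
    and j: "j \<noteq> q" "j \<in> dif w y" "j \<in> dif w z"
  shows "\<exists>g. routing I {w, x, y, z} g"
proof -
  have jx: "j \<in> dif x y" "j \<in> dif x z" using j by (simp_all add: mem_dif_adjacent[OF w])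
  have xw: "dif x w = {q}" using w by (simp add: dif_commute)
  have qI: "q \<in> I" using w P dif_subset[of w I x] by auto
  have straight: "\<exists>g. routing I {w, x, y, z} g" if d: "distinct [w, x, y, z]" and P: "w \<in> Pow I" "x \<in> Pow I" "y \<in> Pow I" "z \<in> Pow I"
    and w: "dif w x = {q}" and q: "q \<notin> dif w y" "q \<in> dif w z" and j: "j \<in> dif w y" "j \<in> dif w z" "j \<noteq> q" for w x y z
  proof -
    have qx: "q \<notin> dif x z" "q \<in> dif x y" using q by (simp_all add: mem_dif_adjacent[OF w])
    have jx: "j \<in> dif x y" "j \<in> dif x z" using j by (simp_all add: mem_dif_adjacent[OF w])
    have ?thesis if k: "dif w y = {k}" for k
    proof -
      have kj: "j = k" using k j(1) by simp
      have qj: "q \<noteq> j" using j(3) by simp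
      show ?thesis by (rule routing_corner[OF fin P w k[folded kj] qj q(2) j(2)])
    qed
    moreover have ?thesis if k: "dif x z = {k}" for k
    proof -
      have kj: "j = k" using k jx(2) by simp
      have qj: "q \<noteq> j" using j(3) by simp
      have xw: "dif x w = {q}" using w by (simp add: dif_commute)
      have "\<exists>g. routing I {x, w, z, y} g"
        by (rule routing_corner[OF fin P(2,1,4,3) xw k[folded kj] qj qx(2) jx(1)])
      moreover have "{x, w, z, y} = {w, x, y, z}" by auto
      ultimately show ?thesis by simp
    qed
    moreover have ?thesis if c: "\<And>k. dif w y \<noteq> {k}" "\<And>k. dif x z \<noteq> {k}"
    proof -
      have ne: "w \<noteq> y" using d by auto
      have s: "dif w y \<subseteq> I" "dif x z \<subseteq> I" using P by (simp_all add: dif_subset)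
      have qwx: "q \<in> dif w x" using w by simp
      obtain g where g: "routing I {w, y, x, z} g"
        by (rule routing_split[OF qI q(1) qx(1) qwx s c ne])
      have "{w, y, x, z} = {w, x, y, z}" by auto
      then show ?thesis using g by auto
    qed
    ultimately show ?thesis by metis
  qed
  have qxy: "q \<in> dif x y \<longleftrightarrow> q \<notin> dif w y" "q \<in> dif x z \<longleftrightarrow> q \<notin> dif w z"
    by (simp_all add: mem_dif_adjacent[OF w])
  consider "q \<in> dif w y" "q \<in> dif w z" | "q \<notin> dif w y" "q \<notin> dif w z"
    | "q \<notin> dif w y" "q \<in> dif w z" | "q \<in> dif w y" "q \<notin> dif w z" by blast
  then show ?thesis
  proof cases
    case 1
    then show ?thesis using routing_pendant_edge[OF fin P d w _ _ j] by simp
  next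
    case 2
    have "distinct [x, w, y, z]" using d by auto
    then have "\<exists>g. routing I {x, w, y, z} g"
      using routing_pendant_edge[OF fin P(2,1,3,4) _ xw _ _ j(1) jx] qxy 2 by simp
    moreover have "{x, w, y, z} = {w, x, y, z}" by auto
    ultimately show ?thesis by simp
  next
    case 3
    then show ?thesis using straight[OF d P w _ _ j(2,3,1)] by simp
  next
    case 4
    have "distinct [w, x, z, y]" using d by auto
    then have "\<exists>g. routing I {w, x, z, y} g" using straight[OF _ P(1,2,4,3) w _ _ j(3,2,1)] 4 by simp
    moreover have "{w, x, z, y} = {w, x, y, z}" by auto
    ultimately show ?thesis by simp
  qed
qed

lemma routing_split22:
  assumes fin: "finite I" and P: "w \<in> Pow I" "x \<in> Pow I" "y \<in> Pow I" "z \<in> Pow I"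
    and d: "distinct [w, x, y, z]" and j: "j \<in> dif w y" "j \<in> dif w z" "j \<notin> dif w x"
  shows "\<exists>g. routing I {w, x, y, z} g"
proof -
  have ?thesis if a: "dif w x = {q}" for q
    using routing_edge_split[OF fin P d a _ j(1,2)] j(3) a by simp
  moreover have ?thesis if b: "dif y z = {q}" for q
  proof -
    have "j \<noteq> q" "j \<in> dif y w" "j \<in> dif y x"
      using b j mem_dif_trans[of j y z w] mem_dif_trans[of j y x w] by (auto simp: dif_commute[of y w])
    moreover have "distinct [y, z, w, x]" using d by auto
    ultimately have "\<exists>g. routing I {y, z, w, x} g" using routing_edge_split[OF fin P(3,4,1,2) _ b] by simp
    moreover have "{y, z, w, x} = {w, x, y, z}" by auto
    ultimately show ?thesis by simp
  qed
  moreover have ?thesis if c: "\<And>k. dif w x \<noteq> {k}" "\<And>k. dif y z \<noteq> {k}"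
  proof -
    have jyz: "j \<notin> dif y z" using not_mem_dif[OF j(1,2)] .
    have jI: "j \<in> I" using j(1) dif_subset[of w I y] P by blast
    have s: "dif w x \<subseteq> I" "dif y z \<subseteq> I" using P by (simp_all add: dif_subset)
    have ne: "w \<noteq> x" using d by simp
    obtain g where "routing I {w, x, y, z} g" by (rule routing_split[OF jI j(3) jyz j(1) s c ne])
    then show ?thesis by blast
  qed
  ultimately show ?thesis by metis
qed

text \<open>\<open>w\<close> lies between \<open>x\<close> and each of \<open>y\<close>,
  \<open>z\<close>. A coordinate of \<open>dif w x\<close> isolates \<open>x\<close>, and
  \<open>y\<close> and \<open>z\<close> are at distance at least three from \<open>x\<close>, so
  only \<open>w\<close> can be at distance two.\<close>

lemma routing_center_far:
  assumes fin: "finite I" and P: "w \<in> Pow I" "x \<in> Pow I" "y \<in> Pow I" "z \<in> Pow I"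
    and d: "distinct [w, x, y, z]"
    and dis: "dif w x \<inter> dif w y = {}" "dif w x \<inter> dif w z = {}" and far: "card (dif w x) \<noteq> 1"
  shows "\<exists>g. routing I {w, x, y, z} g"
proof -
  have fin': "finite (dif a b)" if "a \<in> Pow I" "b \<in> Pow I" for a b
    using that fin by (auto simp: dif_def intro: finite_subset)
  have "dif w x \<noteq> {}" using d by simp
  then obtain p where p: "p \<in> dif w x" by blast
  have "card (dif w x) \<noteq> 0" using fin'[OF P(1,2)] \<open>dif w x \<noteq> {}\<close> by simp
  then have two: "card (dif w x) \<ge> 2" using far by linarith
  have far3: "card (dif v x) \<noteq> 2" if "v \<in> Pow I" "v \<noteq> w" "dif w x \<inter> dif w v = {}" for v
  proof -
    have e: "dif v x = dif w x \<union> dif w v" using that(3) by (rule dif_Un_disjoint)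
    have "card (dif w v) \<noteq> 0" using fin'[OF P(1) that(1)] that(2) by simp
    then show ?thesis unfolding e
      using card_Un_disjoint[OF fin'[OF P(1,2)] fin'[OF P(1) that(1)] that(3)] two by simp
  qed
  have "\<exists>g. routing I {x, w, y, z} g"
  proof (rule routing_isolate)
    show "w \<noteq> y" "w \<noteq> z" "y \<noteq> z" using d by auto
    show "p \<in> dif w x" by fact
    show "p \<in> dif y x" "p \<in> dif z x"
      unfolding dif_Un_disjoint[OF dis(1)] dif_Un_disjoint[OF dis(2)] using p by simp_all
    show "dif w x \<subseteq> I" "dif y x \<subseteq> I" "dif z x \<subseteq> I" using P by (simp_all add: dif_subset)
    fix s t assume "s \<in> {w, y, z}" "t \<in> {w, y, z}" "card (dif s x) = 2" "card (dif t x) = 2"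
    moreover have "card (dif y x) \<noteq> 2" "card (dif z x) \<noteq> 2" using far3 P d dis by auto
    ultimately show "s = t" by auto
  qed
  moreover have "{x, w, y, z} = {w, x, y, z}" by auto
  ultimately show ?thesis by simp
qed

lemma routing_center:
  assumes fin: "finite I" and P: "w \<in> Pow I" "x \<in> Pow I" "y \<in> Pow I" "z \<in> Pow I"
    and d: "distinct [w, x, y, z]"
    and dis: "dif w x \<inter> dif w y = {}" "dif w x \<inter> dif w z = {}" "dif w y \<inter> dif w z = {}"
  shows "\<exists>g. routing I {w, x, y, z} g"
proof -
  consider "card (dif w x) \<noteq> 1" | "card (dif w y) \<noteq> 1" | "card (dif w z) \<noteq> 1"
    | "card (dif w x) = 1" "card (dif w y) = 1" "card (dif w z) = 1" by blast
  then show ?thesis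
  proof cases
    case 1
    then show ?thesis using routing_center_far[OF fin P d dis(1,2)] by simp
  next
    case 2
    have "distinct [w, y, x, z]" using d by auto
    then have "\<exists>g. routing I {w, y, x, z} g" using routing_center_far[OF fin P(1,3,2,4)] 2 dis by (simp add: Int_commute)
    moreover have "{w, y, x, z} = {w, x, y, z}" by auto
    ultimately show ?thesis by simp
  next
    case 3
    have "distinct [w, z, x, y]" using d by auto
    then have "\<exists>g. routing I {w, z, x, y} g" using routing_center_far[OF fin P(1,4,2,3)] 3 dis by (simp add: Int_commute)
    moreover have "{w, z, x, y} = {w, x, y, z}" by auto
    ultimately show ?thesis by simp
  next
    case 4
    then obtain a b c where abc: "dif w x = {a}" "dif w y = {b}" "dif w z = {c}"
      by (auto simp: card_1_singleton_iff)
    then have "distinct [a, b, c]" using dis by auto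
    moreover have "a \<in> I" "b \<in> I" "c \<in> I"
      using abc dif_subset[of w I x] dif_subset[of w I y] dif_subset[of w I z] P by auto
    ultimately show ?thesis using routing_claw abc by metis
  qed
qed

text \<open>If \<open>routing_isolate\<close> fails for \<open>w\<close>, some terminal differs from
  \<open>w\<close> in exactly \<open>{p, r}\<close>, and by \<open>q\<close> another one does not
  differ from \<open>w\<close> in \<open>r\<close>. So \<open>p\<close> alone isolates
  \<open>w\<close>.\<close>

lemma routing_isolated_vertex:
  assumes P: "w \<in> Pow I" "x \<in> Pow I" "y \<in> Pow I" "z \<in> Pow I" and d: "distinct [w, x, y, z]"
    and p: "p \<in> dif w x" "p \<in> dif w y" "p \<in> dif w z"
    and q: "\<And>v. v \<in> {x, y, z} \<Longrightarrow> \<exists>u\<in>{x, y, z}. \<not> dif w v \<subseteq> dif w u"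
  shows "(\<exists>g. routing I {w, x, y, z} g) \<or> dif w x \<inter> dif w y \<inter> dif w z = {p}"
proof (cases "\<forall>s\<in>{x, y, z}. \<forall>t\<in>{x, y, z}. card (dif s w) = 2 \<longrightarrow> card (dif t w) = 2 \<longrightarrow> s = t")
  case True
  have "\<exists>g. routing I {w, x, y, z} g"
  proof (rule routing_isolate)
    show "x \<noteq> y" "x \<noteq> z" "y \<noteq> z" using d by auto
    show "p \<in> dif x w" "p \<in> dif y w" "p \<in> dif z w" using p by (simp_all add: dif_commute[of _ w])
    show "dif x w \<subseteq> I" "dif y w \<subseteq> I" "dif z w \<subseteq> I" using P by (simp_all add: dif_subset)
  qed (use True in blast)
  then show ?thesis by blast
next
  case False
  then obtain s where s: "s \<in> {x, y, z}" "card (dif s w) = 2" by blast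
  obtain u where u: "u \<in> {x, y, z}" "\<not> dif w s \<subseteq> dif w u" using q[OF s(1)] by (elim bexE)
  then obtain r where r: "r \<in> dif w s" "r \<notin> dif w u" by blast
  have ps: "p \<in> dif w s" "p \<in> dif w u" using p s(1) u(1) by auto
  then have "p \<noteq> r" using r by auto
  moreover have "card (dif w s) = 2" using s by (simp add: dif_commute)
  moreover from this have "finite (dif w s)" by (intro card_ge_0_finite) simp
  ultimately have "{p, r} = dif w s" using ps(1) r(1) by (intro card_subset_eq) auto
  then have "dif w s \<inter> dif w u \<subseteq> {p}" using r(2) by auto
  moreover have "dif w x \<inter> dif w y \<inter> dif w z \<subseteq> dif w s \<inter> dif w u" using s(1) u(1) by auto
  ultimately show ?thesis using p by blast
qed

text \<open>In a counterexample no coordinate splits two against two, so each one isolates a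
  terminal or separates none. A terminal isolated by no coordinate would lie between any two others,
  as in \<open>routing_center\<close>; hence each is isolated, and by exactly one coordinate. The
  terminals are then four neighbours of a common vertex.\<close>

lemma routing_quad:
  assumes fin: "finite I" and P: "w \<in> Pow I" "x \<in> Pow I" "y \<in> Pow I" "z \<in> Pow I"
    and d: "distinct [w, x, y, z]"
  shows "\<exists>g. routing I {w, x, y, z} g"
proof (rule ccontr)
  assume n: "\<not> ?thesis"
  have perm: "\<nexists>g. routing I {a, b, c, e} g" if "{a, b, c, e} = {w, x, y, z}" for a b c e
    using n unfolding that .
  have A: "dif w y \<inter> dif w z \<subseteq> dif w x"
    using n routing_split22[OF fin P d] by blast
  have B: "dif w x \<inter> dif w z \<subseteq> dif w y"
  proof -
    have "distinct [w, y, x, z]" using d by auto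
    moreover have "\<nexists>g. routing I {w, y, x, z} g" by (rule perm) auto
    ultimately show ?thesis using routing_split22[OF fin P(1,3,2,4)] by blast
  qed
  have C: "dif w x \<inter> dif w y \<subseteq> dif w z"
  proof -
    have "distinct [w, z, x, y]" using d by auto
    moreover have "\<nexists>g. routing I {w, z, x, y} g" by (rule perm) auto
    ultimately show ?thesis using routing_split22[OF fin P(1,4,2,3)] by blast
  qed
  have sym: "dif x w = dif w x" "dif y w = dif w y" "dif z w = dif w z"
    "dif y x = dif x y" "dif z x = dif x z" "dif z y = dif y z"
    by (rule dif_commute)+
  have M: "i \<in> dif x y \<longleftrightarrow> (i \<in> dif w x) \<noteq> (i \<in> dif w y)" "i \<in> dif x z \<longleftrightarrow> (i \<in> dif w x) \<noteq> (i \<in> dif w z)"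
    "i \<in> dif y z \<longleftrightarrow> (i \<in> dif w y) \<noteq> (i \<in> dif w z)" for i
    using mem_dif_trans[of i x y w] mem_dif_trans[of i x z w] mem_dif_trans[of i y z w] unfolding sym by simp_all
  have "\<exists>p. p \<in> dif w x \<and> p \<in> dif w y \<and> p \<in> dif w z"
    using n routing_center[OF fin P d] A B C by blast
  then obtain a where a: "a \<in> dif w x" "a \<in> dif w y" "a \<in> dif w z" by blast
  have "\<exists>p. p \<in> dif x w \<and> p \<in> dif x y \<and> p \<in> dif x z"
  proof (rule ccontr)
    assume no: "\<nexists>p. p \<in> dif x w \<and> p \<in> dif x y \<and> p \<in> dif x z"
    have "dif x w \<inter> dif x y = {}" "dif x w \<inter> dif x z = {}" "dif x y \<inter> dif x z = {}"
      using no A B C unfolding sym M disjoint_iff by blast+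
    moreover have "distinct [x, w, y, z]" using d by auto
    moreover have "\<nexists>g. routing I {x, w, y, z} g" by (rule perm) auto
    ultimately show False using routing_center[OF fin P(2,1,3,4)] by blast
  qed
  then obtain b where b: "b \<in> dif x w" "b \<in> dif x y" "b \<in> dif x z" by blast
  have "\<exists>p. p \<in> dif y w \<and> p \<in> dif y x \<and> p \<in> dif y z"
  proof (rule ccontr)
    assume no: "\<nexists>p. p \<in> dif y w \<and> p \<in> dif y x \<and> p \<in> dif y z"
    have "dif y w \<inter> dif y x = {}" "dif y w \<inter> dif y z = {}" "dif y x \<inter> dif y z = {}"
      using no A B C unfolding sym M disjoint_iff by blast+
    moreover have "distinct [y, w, x, z]" using d by auto
    moreover have "\<nexists>g. routing I {y, w, x, z} g" by (rule perm) auto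
    ultimately show False using routing_center[OF fin P(3,1,2,4)] by blast
  qed
  then obtain c where c: "c \<in> dif y w" "c \<in> dif y x" "c \<in> dif y z" by blast
  have "\<exists>p. p \<in> dif z w \<and> p \<in> dif z x \<and> p \<in> dif z y"
  proof (rule ccontr)
    assume no: "\<nexists>p. p \<in> dif z w \<and> p \<in> dif z x \<and> p \<in> dif z y"
    have "dif z w \<inter> dif z x = {}" "dif z w \<inter> dif z y = {}" "dif z x \<inter> dif z y = {}"
      using no A B C unfolding sym M disjoint_iff by blast+
    moreover have "distinct [z, w, x, y]" using d by auto
    moreover have "\<nexists>g. routing I {z, w, x, y} g" by (rule perm) auto
    ultimately show False using routing_center[OF fin P(4,1,2,3)] by blast
  qed
  then obtain e where e: "e \<in> dif z w" "e \<in> dif z x" "e \<in> dif z y" by blast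
  have bce: "b \<notin> dif w y" "b \<notin> dif w z" "b \<notin> dif y z" "c \<notin> dif w x" "c \<notin> dif w z" "c \<notin> dif x z"
    "e \<notin> dif w x" "e \<notin> dif w y" "e \<notin> dif x y" "a \<notin> dif x y" "a \<notin> dif x z" "a \<notin> dif y z"
    using not_mem_dif[OF b(1,2)] not_mem_dif[OF b(1,3)] not_mem_dif[OF b(2,3)]
      not_mem_dif[OF c(1,2)] not_mem_dif[OF c(1,3)] not_mem_dif[OF c(2,3)]
      not_mem_dif[OF e(1,2)] not_mem_dif[OF e(1,3)] not_mem_dif[OF e(2,3)]
      not_mem_dif[OF a(1,2)] not_mem_dif[OF a(1,3)] not_mem_dif[OF a(2,3)] by simp_all
  have w': "dif w x \<inter> dif w y \<inter> dif w z = {a}"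
  proof -
    have "\<exists>u\<in>{x, y, z}. \<not> dif w v \<subseteq> dif w u" if "v \<in> {x, y, z}" for v
      using that b c e bce by (elim insertE emptyE) (simp_all add: sym, blast+)
    then show ?thesis using routing_isolated_vertex[OF P d a] n by blast
  qed
  have x': "dif x w \<inter> dif x y \<inter> dif x z = {b}"
  proof -
    have "\<exists>u\<in>{w, y, z}. \<not> dif x v \<subseteq> dif x u" if "v \<in> {w, y, z}" for v
      using that a c e bce by (elim insertE emptyE) (simp_all add: sym, blast+)
    moreover have "distinct [x, w, y, z]" using d by auto
    moreover have "\<nexists>g. routing I {x, w, y, z} g" by (rule perm) auto
    ultimately show ?thesis using routing_isolated_vertex[OF P(2,1,3,4) _ b] by blast
  qed
  have y': "dif y w \<inter> dif y x \<inter> dif y z = {c}"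
  proof -
    have "\<exists>u\<in>{w, x, z}. \<not> dif y v \<subseteq> dif y u" if "v \<in> {w, x, z}" for v
      using that a b e bce by (elim insertE emptyE) (simp_all add: sym, blast+)
    moreover have "distinct [y, w, x, z]" using d by auto
    moreover have "\<nexists>g. routing I {y, w, x, z} g" by (rule perm) auto
    ultimately show ?thesis using routing_isolated_vertex[OF P(3,1,2,4) _ c] by blast
  qed
  have z': "dif z w \<inter> dif z x \<inter> dif z y = {e}"
  proof -
    have "\<exists>u\<in>{w, x, y}. \<not> dif z v \<subseteq> dif z u" if "v \<in> {w, x, y}" for v
      using that a b c bce by (elim insertE emptyE) (simp_all add: sym, blast+)
    moreover have "distinct [z, w, x, y]" using d by auto
    moreover have "\<nexists>g. routing I {z, w, x, y} g" by (rule perm) auto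
    ultimately show ?thesis using routing_isolated_vertex[OF P(4,1,2,3) _ e] by blast
  qed
  \<comment> \<open>Every coordinate in which two terminals differ isolates one of them.\<close>
  have split: "dif w x = dif w x \<inter> dif w y \<inter> dif w z \<union> dif x w \<inter> dif x y \<inter> dif x z"
    "dif w y = dif w x \<inter> dif w y \<inter> dif w z \<union> dif y w \<inter> dif y x \<inter> dif y z"
    "dif w z = dif w x \<inter> dif w y \<inter> dif w z \<union> dif z w \<inter> dif z x \<inter> dif z y"
    "dif x y = dif x w \<inter> dif x y \<inter> dif x z \<union> dif y w \<inter> dif y x \<inter> dif y z"
    "dif x z = dif x w \<inter> dif x y \<inter> dif x z \<union> dif z w \<inter> dif z x \<inter> dif z y"
    "dif y z = dif y w \<inter> dif y x \<inter> dif y z \<union> dif z w \<inter> dif z x \<inter> dif z y"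
    using A B C unfolding sym set_eq_iff Int_iff Un_iff M by blast+
  have ds: "dif w x = {a, b}" "dif w y = {a, c}" "dif w z = {a, e}"
      "dif x y = {b, c}" "dif x z = {b, e}" "dif y z = {c, e}"
    using split unfolding w' x' y' z' by auto
  have "distinct [a, b, c, e]" using a b c e bce unfolding sym by auto
  moreover have "a \<in> I" "b \<in> I" "c \<in> I" "e \<in> I"
    using ds dif_subset[of w I x] dif_subset[of y I z] P by auto
  ultimately show False using routing_claw_without_center[OF _ _ _ _ _ ds] n by blast
qed

section \<open>Gluing the clusters of the dual cube\<close>

type_synonym 'i dual_vertex = "'i set \<times> 'i set \<times> bool"

definition dual_V :: "'i set \<Rightarrow> 'i dual_vertex set" where
  "dual_V I = Pow I \<times> Pow I \<times> UNIV"

definition dual_adj :: "'i set \<Rightarrow> 'i dual_vertex \<Rightarrow> 'i dual_vertex \<Rightarrow> bool" where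
  "dual_adj I = (\<lambda>(A, B, c) (A', B', c').
     if c = c' then (if c then A = A' \<and> cube_adj I B B' else B = B' \<and> cube_adj I A A')
     else A = A' \<and> B = B')"

lemma dual_adj_simps [simp]:
  "dual_adj I (A, B, False) (A', B', False) \<longleftrightarrow> B = B' \<and> cube_adj I A A'"
  "dual_adj I (A, B, True) (A', B', True) \<longleftrightarrow> A = A' \<and> cube_adj I B B'"
  "dual_adj I (A, B, False) (A', B', True) \<longleftrightarrow> A = A' \<and> B = B'"
  "dual_adj I (A, B, True) (A', B', False) \<longleftrightarrow> A = A' \<and> B = B'"
  by (simp_all add: dual_adj_def)

definition row :: "'i dual_vertex set \<Rightarrow> 'i set \<Rightarrow> 'i set set" where
  "row S b = {A. (A, b, False) \<in> S}"

definition col :: "'i dual_vertex set \<Rightarrow> 'i set \<Rightarrow> 'i set set" where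
  "col S a = {B. (a, B, True) \<in> S}"

definition rows :: "'i dual_vertex set \<Rightarrow> 'i set set" where
  "rows S = {b. row S b \<noteq> {}}"

definition cols :: "'i dual_vertex set \<Rightarrow> 'i set set" where
  "cols S = {a. col S a \<noteq> {}}"

lemma cube_connected:
  assumes "finite I" "x \<in> Pow I" "y \<in> Pow I"
  shows "joined (piece_edges (cube_adj I) {} (Pow I) {}) x y"
proof -
  have "joined (piece_edges (cube_adj I) {} (Pow I) {}) x (dif x (dif x y))"
    using assms by (intro joined_subcube[of I]) (auto simp: dif_subset)
  then show ?thesis by simp
qed

lemma hookedD:
  assumes "hooked I S K P U G"
  shows "\<forall>i\<in>I. U i \<subseteq> Pow I - S"
    "\<forall>i\<in>I. G i \<subseteq> {{s, t} | s t. s \<in> S \<and> t \<in> S \<and> cube_adj I s t}"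
    "\<forall>i\<in>I. P i \<subseteq> U i \<union> S"
    "\<forall>i\<in>I. \<forall>v\<in>U i \<union> S. \<exists>c\<in>(U i \<union> S) \<inter> K i. joined (piece_edges (cube_adj I) S (U i) (G i)) v c"
    "\<forall>i\<in>I. \<forall>j\<in>I. i \<noteq> j \<longrightarrow> U i \<inter> U j = {} \<and> G i \<inter> G j = {}"
  using assms unfolding hooked_def by simp_all

lemma joined_embed:
  assumes j: "joined (piece_edges adj S W G) u v"
    and W: "f ` W \<subseteq> W'" and S: "f ` S \<subseteq> W' \<union> S'" and G: "(`) f ` G \<subseteq> G'"
    and adj: "\<And>x y. adj x y \<Longrightarrow> adj' (f x) (f y)"
  shows "joined (piece_edges adj' S' W' G') (f u) (f v)"
proof (rule joined_mono[OF joined_image[OF j]])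
  show "(`) f ` piece_edges adj S W G \<subseteq> piece_edges adj' S' W' G'"
  proof
    fix e assume "e \<in> (`) f ` piece_edges adj S W G"
    then obtain e' where e': "e = f ` e'" "e' \<in> piece_edges adj S W G" by blast
    show "e \<in> piece_edges adj' S' W' G'"
    proof (cases "e' \<in> G")
      case True
      then show ?thesis using e' G unfolding piece_edges_def by blast
    next
      case False
      then obtain x y where xy: "e' = {x, y}" "x \<in> W" "y \<in> W \<union> S" "adj x y"
        using e'(2) unfolding piece_edges_def by auto
      have "{f x, f y} \<in> piece_edges adj' S' W' G'"
        using xy(2,3) W S by (intro piece_edgeI adj[OF xy(4)]) auto
      then show ?thesis using e'(1) xy(1) by simp
    qed
  qed
qed

text \<open>The columns in \<open>K i\<close> and the rows in \<open>L i\<close> that avoid \<open>S\<close> are the hub of the \<open>i\<close>-th tree. A column of \<open>K i\<close>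
  that meets \<open>S\<close> is allowed if its own part of the \<open>i\<close>-th tree contains the entry points of all rows.\<close>

lemma has_pieces_glue:
  fixes S :: "'i dual_vertex set"
  assumes fin: "finite I" and SV: "S \<subseteq> dual_V I"
    and K: "\<And>i. i \<in> I \<Longrightarrow> K i \<subseteq> Pow I" "\<And>i j. i \<in> I \<Longrightarrow> j \<in> I \<Longrightarrow> i \<noteq> j \<Longrightarrow> K i \<inter> K j = {}"
    and L: "\<And>i. i \<in> I \<Longrightarrow> L i \<subseteq> Pow I - rows S" "\<And>i j. i \<in> I \<Longrightarrow> j \<in> I \<Longrightarrow> i \<noteq> j \<Longrightarrow> L i \<inter> L j = {}"
      "\<And>i. i \<in> I \<Longrightarrow> L i \<noteq> {}"
    and KL: "\<And>i. i \<in> I \<Longrightarrow> K i \<subseteq> cols S \<Longrightarrow> \<exists>d. L i = {d}"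
    and r: "\<And>b. b \<in> rows S \<Longrightarrow> hook I (row S b) K (\<lambda>_. {})"
    and c: "\<And>a. a \<in> cols S \<Longrightarrow> hook I (col S a) L (\<lambda>i. if a \<in> K i then rows S else {})"
  shows "has_pieces (dual_V I) (dual_adj I) S I"
proof -
  obtain UR GR where HR: "\<And>b. b \<in> rows S \<Longrightarrow> hooked I (row S b) K (\<lambda>_. {}) (UR b) (GR b)"
    using r unfolding hook_def by metis
  note UR = hookedD(1)[OF HR] and GR = hookedD(2)[OF HR] and JR = hookedD(4)[OF HR] and DR = hookedD(5)[OF HR]
  obtain UC GC where HC: "\<And>a. a \<in> cols S \<Longrightarrow>
      hooked I (col S a) L (\<lambda>i. if a \<in> K i then rows S else {}) (UC a) (GC a)"
    using c unfolding hook_def by metis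
  note UC = hookedD(1)[OF HC] and GC = hookedD(2)[OF HC] and PC = hookedD(3)[OF HC]
    and JC = hookedD(4)[OF HC] and DC = hookedD(5)[OF HC]
  have rI: "b \<in> Pow I" if "b \<in> rows S" for b using that SV unfolding rows_def row_def dual_V_def by blast
  have cI: "a \<in> Pow I" if "a \<in> cols S" for a using that SV unfolding cols_def col_def dual_V_def by blast
  define ra where "ra b A = (A, b, False)" for b A :: "'i set"
  define ca where "ca a B = (a, B, True)" for a B :: "'i set"
  define W where "W i = (\<Union>b\<in>rows S. ra b ` UR b i) \<union> (\<Union>b\<in>L i. ra b ` Pow I) \<union>
      (\<Union>a\<in>cols S. ca a ` UC a i) \<union> (\<Union>a\<in>K i - cols S. ca a ` Pow I)" for i
  \<comment> \<open>A cross edge between two terminals goes to the label that owns its column; this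
    arises when \<open>K i\<close> contains columns that meet \<open>S\<close>.\<close>
  define GX where "GX i = {{(a, b, False), (a, b, True)} | a b. (a, b, False) \<in> S \<and> (a, b, True) \<in> S \<and> a \<in> K i}" for i
  define G where "G i = (\<Union>b\<in>rows S. (`) (ra b) ` GR b i) \<union> (\<Union>a\<in>cols S. (`) (ca a) ` GC a i) \<union> GX i" for i
  let ?E = "\<lambda>i. piece_edges (dual_adj I) S (W i) (G i)"
  have Wr: "(A, b, False) \<in> W i \<longleftrightarrow> b \<in> rows S \<and> A \<in> UR b i \<or> b \<in> L i \<and> A \<in> Pow I" for A b i
    unfolding W_def ra_def ca_def by auto
  have Wc: "(a, B, True) \<in> W i \<longleftrightarrow> a \<in> cols S \<and> B \<in> UC a i \<or> a \<in> K i \<and> a \<notin> cols S \<and> B \<in> Pow I" for a B i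
    unfolding W_def ra_def ca_def by auto
  have Sr: "(A, b, False) \<in> S \<longleftrightarrow> A \<in> row S b" "(A, b, False) \<in> S \<Longrightarrow> b \<in> rows S" for A b
    by (auto simp: row_def rows_def)
  have Sc: "(a, B, True) \<in> S \<longleftrightarrow> B \<in> col S a" "(a, B, True) \<in> S \<Longrightarrow> a \<in> cols S" for a B
    by (auto simp: col_def cols_def)
  have WV: "W i \<subseteq> dual_V I - S" if i: "i \<in> I" for i
  proof (intro subsetI)
    fix v assume v: "v \<in> W i"
    obtain A B c where vABc: "v = (A, B, c)" by (cases v)
    show "v \<in> dual_V I - S"
    proof (cases c)
      case True
      then show ?thesis using v vABc Wc[of A B i] Sc UC[of A] K(1)[OF i] cI[of A] i
        by (auto simp: dual_V_def)
    next
      case False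
      then show ?thesis using v vABc Wr[of A B i] Sr UR[of B] L(1)[OF i] rI[of B] i
        by (auto simp: dual_V_def)
    qed
  qed
  have GS: "G i \<subseteq> {{s, t} | s t. s \<in> S \<and> t \<in> S \<and> dual_adj I s t}" if i: "i \<in> I" for i
  proof
    fix e assume "e \<in> G i"
    then consider (1) b e' where "b \<in> rows S" "e' \<in> GR b i" "e = ra b ` e'"
      | (2) a e' where "a \<in> cols S" "e' \<in> GC a i" "e = ca a ` e'" | (3) "e \<in> GX i"
      unfolding G_def by blast
    then show "e \<in> {{s, t} | s t. s \<in> S \<and> t \<in> S \<and> dual_adj I s t}"
    proof cases
      case 1
      from subsetD[OF bspec[OF GR[OF 1(1)] i] 1(2)]
      obtain s t where "e' = {s, t}" "s \<in> row S b" "t \<in> row S b" "cube_adj I s t" by (elim CollectE exE conjE)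
      then have "e = {ra b s, ra b t}" "ra b s \<in> S" "ra b t \<in> S" "dual_adj I (ra b s) (ra b t)"
        using 1(3) by (auto simp: ra_def row_def)
      then show ?thesis by blast
    next
      case 2
      from subsetD[OF bspec[OF GC[OF 2(1)] i] 2(2)]
      obtain s t where "e' = {s, t}" "s \<in> col S a" "t \<in> col S a" "cube_adj I s t" by (elim CollectE exE conjE)
      then have "e = {ca a s, ca a t}" "ca a s \<in> S" "ca a t \<in> S" "dual_adj I (ca a s) (ca a t)"
        using 2(3) by (auto simp: ca_def col_def)
      then show ?thesis by blast
    next
      case 3
      then obtain a b where "e = {(a, b, False), (a, b, True)}" "(a, b, False) \<in> S" "(a, b, True) \<in> S"
        unfolding GX_def by blast
      moreover have "dual_adj I (a, b, False) (a, b, True)" by simp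
      ultimately show ?thesis by blast
    qed
  qed
  have Wdis: "W i \<inter> W j = {}" if ij: "i \<in> I" "j \<in> I" "i \<noteq> j" for i j
  proof -
    have "v \<notin> W j" if v: "v \<in> W i" for v
    proof -
      obtain A B c where vABc: "v = (A, B, c)" by (cases v)
      show ?thesis
      proof (cases c)
        case True
        have "UC A i \<inter> UC A j = {}" if "A \<in> cols S"
          using bspec[OF bspec[OF DC[OF that] ij(1)] ij(2)] ij(3) by simp
        then show ?thesis using v K(2)[OF ij] unfolding vABc True[THEN eqTrueI] Wc by blast
      next
        case False
        then have c: "c = False" by simp
        have "UR B i \<inter> UR B j = {}" if "B \<in> rows S"
          using bspec[OF bspec[OF DR[OF that] ij(1)] ij(2)] ij(3) by simp
        then show ?thesis using v L(2)[OF ij] L(1)[OF ij(1)] L(1)[OF ij(2)] unfolding vABc c Wr by blast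
      qed
    qed
    then show ?thesis by blast
  qed
  have injra: "ra b ` e = ra b' ` e' \<Longrightarrow> e \<noteq> {} \<Longrightarrow> b = b' \<and> e = e'" for b b' e e'
  proof -
    assume eq: "ra b ` e = ra b' ` e'" and ne: "e \<noteq> {}"
    have "fst ` ra b ` e = e" "fst ` ra b' ` e' = e'" by (auto simp: ra_def image_image)
    moreover have "fst ` snd ` ra b ` e = {b}" using ne by (auto simp: ra_def image_image)
    moreover have "fst ` snd ` ra b' ` e' \<subseteq> {b'}" by (auto simp: ra_def image_image)
    ultimately show "b = b' \<and> e = e'" using eq by auto
  qed
  have injca: "ca b ` e = ca b' ` e' \<Longrightarrow> e \<noteq> {} \<Longrightarrow> b = b' \<and> e = e'" for b b' e e'
  proof -
    assume eq: "ca b ` e = ca b' ` e'" and ne: "e \<noteq> {}"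
    have "fst ` snd ` ca b ` e = e" "fst ` snd ` ca b' ` e' = e'" by (auto simp: ca_def image_image)
    moreover have "fst ` ca b ` e = {b}" using ne by (auto simp: ca_def image_image)
    moreover have "fst ` ca b' ` e' \<subseteq> {b'}" by (auto simp: ca_def image_image)
    ultimately show "b = b' \<and> e = e'" using eq by auto
  qed
  have Gdis: "G i \<inter> G j = {}" if ij: "i \<in> I" "j \<in> I" "i \<noteq> j" for i j
  proof -
    have kind: "(\<exists>b e'. b \<in> rows S \<and> e' \<in> GR b i \<and> e = ra b ` e' \<and> e' \<noteq> {} \<and> snd ` snd ` e = {False}) \<or>
      (\<exists>a e'. a \<in> cols S \<and> e' \<in> GC a i \<and> e = ca a ` e' \<and> e' \<noteq> {} \<and> snd ` snd ` e = {True}) \<or>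
      (\<exists>a b. e = {(a, b, False), (a, b, True)} \<and> a \<in> K i \<and> snd ` snd ` e = {False, True})"
      if e: "e \<in> G i" and i: "i \<in> I" for e i
    proof -
      consider (1) b e' where "b \<in> rows S" "e' \<in> GR b i" "e = ra b ` e'"
        | (2) a e' where "a \<in> cols S" "e' \<in> GC a i" "e = ca a ` e'"
        | (3) a b where "e = {(a, b, False), (a, b, True)}" "a \<in> K i"
        using e unfolding G_def GX_def by blast
      then show ?thesis
      proof cases
        case 1
        have "e' \<noteq> {}" using subsetD[OF bspec[OF GR[OF 1(1)] i] 1(2)] by auto
        moreover from this have "snd ` snd ` e = {False}" using 1(3) by (auto simp: ra_def image_image)
        ultimately show ?thesis using 1 by blast
      next
        case 2
        have "e' \<noteq> {}" using subsetD[OF bspec[OF GC[OF 2(1)] i] 2(2)] by auto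
        moreover from this have "snd ` snd ` e = {True}" using 2(3) by (auto simp: ca_def image_image)
        ultimately show ?thesis using 2 by blast
      next
        case 3
        then have "snd ` snd ` e = {False, True}" by simp
        then show ?thesis using 3 by blast
      qed
    qed
    have sets: "{False} \<noteq> {True}" "{False} \<noteq> {False, True}" "{True} \<noteq> {False, True}" by auto
    have "False" if e: "e \<in> G i" "e \<in> G j" for e
      using kind[OF e(1) ij(1)]
    proof (elim disjE exE conjE)
      fix b e' assume 1: "b \<in> rows S" "e' \<in> GR b i" "e = ra b ` e'" "e' \<noteq> {}" "snd ` snd ` e = {False}"
      then obtain b2 e2 where 2: "b2 \<in> rows S" "e2 \<in> GR b2 j" "e = ra b2 ` e2"
        using kind[OF e(2) ij(2)] sets by auto
      then have "b = b2 \<and> e' = e2" using injra[of b e' b2 e2] 1 by simp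
      then show False using bspec[OF bspec[OF DR[OF 1(1)] ij(1)] ij(2)] 1(2) 2(2) ij(3) by auto
    next
      fix b e' assume 1: "b \<in> cols S" "e' \<in> GC b i" "e = ca b ` e'" "e' \<noteq> {}" "snd ` snd ` e = {True}"
      then obtain b2 e2 where 2: "b2 \<in> cols S" "e2 \<in> GC b2 j" "e = ca b2 ` e2"
        using kind[OF e(2) ij(2)] sets by auto
      then have "b = b2 \<and> e' = e2" using injca[of b e' b2 e2] 1 by simp
      then show False using bspec[OF bspec[OF DC[OF 1(1)] ij(1)] ij(2)] 1(2) 2(2) ij(3) by auto
    next
      fix a b assume 1: "e = {(a, b, False), (a, b, True)}" "a \<in> K i" "snd ` snd ` e = {False, True}"
      then obtain a2 b2 where 2: "e = {(a2, b2, False), (a2, b2, True)}" "a2 \<in> K j"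
        using kind[OF e(2) ij(2)] sets by auto
      then have "a = a2" using 1(1) by (auto simp: doubleton_eq_iff)
      then show False using 1(2) 2(2) K(2)[OF ij] by blast
    qed
    then show ?thesis by blast
  qed
  have J: "joined (?E i) u v" if i: "i \<in> I" and uv: "u \<in> W i \<union> S" "v \<in> W i \<union> S" for i u v
  proof -
    have cross: "joined (?E i) (A, B, False) (A, B, True)"
      if "(A, B, False) \<in> W i \<and> (A, B, True) \<in> W i \<union> S \<or> (A, B, True) \<in> W i \<and> (A, B, False) \<in> W i \<union> S" for A B
      using that
    proof (elim disjE conjE)
      assume "(A, B, True) \<in> W i" "(A, B, False) \<in> W i \<union> S"
      then have "joined (?E i) (A, B, True) (A, B, False)" by (intro joined_edge piece_edgeI) simp_all
      then show ?thesis by (rule joined_sym)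
    qed (intro joined_edge piece_edgeI; simp)
    have rowj: "joined (?E i) (A, d, False) (A', d, False)" if "d \<in> L i" "A \<in> Pow I" "A' \<in> Pow I" for d A A'
    proof -
      have "joined (?E i) (ra d A) (ra d A')"
        by (rule joined_embed[OF cube_connected[OF fin that(2,3)]])
          (use that(1) in \<open>auto simp: W_def, auto simp: ra_def\<close>)
      then show ?thesis by (simp add: ra_def)
    qed
    have colj: "joined (?E i) (a, B, True) (a, B', True)" if "a \<in> K i" "a \<notin> cols S" "B \<in> Pow I" "B' \<in> Pow I" for a B B'
    proof -
      have "joined (?E i) (ca a B) (ca a B')"
        by (rule joined_embed[OF cube_connected[OF fin that(3,4)]])
          (use that(1,2) in \<open>auto simp: W_def, auto simp: ca_def\<close>)
      then show ?thesis by (simp add: ca_def)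
    qed
    obtain d where d: "d \<in> L i" using L(3)[OF i] by blast
    have dI: "d \<in> Pow I" using L(1)[OF i] d by blast
    \<comment> \<open>An arbitrary vertex of a hub row, to which the whole piece and all terminals
      will be joined.\<close>
    define rt where "rt = ({} :: 'i set, d, False)"
    have h0: "joined (?E i) (A, d, False) rt" if "A \<in> Pow I" for A
      unfolding rt_def using rowj[OF d that, of "{}"] by simp
    have h2: "joined (?E i) (a, B, True) rt" if a: "a \<in> K i" "a \<notin> cols S" and B: "B \<in> Pow I" for a B
    proof -
      have aI: "a \<in> Pow I" using K(1)[OF i] a(1) by blast
      have "joined (?E i) (a, d, False) (a, d, True)" using a aI dI d by (intro cross) (simp add: Wr Wc)
      from joined_sym[OF this] show ?thesis
        using joined_trans[OF colj[OF a B dI]] joined_trans[OF _ h0[OF aI]] by blast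
    qed
    have h1: "joined (?E i) (A, d', False) rt" if d': "d' \<in> L i" and A: "A \<in> Pow I" for A d'
    proof (cases "d' = d")
      case True
      then show ?thesis using h0[OF A] by simp
    next
      case False
      \<comment> \<open>Two hub rows are joined through a hub column that avoids \<open>S\<close>;
        where there is no such column, \<open>KL\<close> leaves a single hub row.\<close>
      then have "\<not> K i \<subseteq> cols S" using KL[OF i] d d' by (metis singletonD)
      then obtain a where a: "a \<in> K i" "a \<notin> cols S" by blast
      have aI: "a \<in> Pow I" using K(1)[OF i] a(1) by blast
      have dI': "d' \<in> Pow I" using L(1)[OF i] d' by blast
      have "joined (?E i) (a, d', False) (a, d', True)" using a aI dI' d' by (intro cross) (simp add: Wr Wc)
      then show ?thesis using joined_trans[OF rowj[OF d' A aI]] joined_trans[OF _ h2[OF a dI']] by blast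
    qed
    have h3: "joined (?E i) (a, B, True) rt" if a: "a \<in> cols S" and B: "B \<in> UC a i \<union> col S a" for a B
    proof -
      obtain b where b: "b \<in> UC a i \<union> col S a" "b \<in> L i"
        and j: "joined (piece_edges (cube_adj I) (col S a) (UC a i) (GC a i)) B b"
        using bspec[OF bspec[OF JC[OF a] i] B] by blast
      have "joined (?E i) (ca a B) (ca a b)"
      proof (rule joined_embed[OF j])
        show "ca a ` UC a i \<subseteq> W i" using a unfolding W_def by blast
        show "ca a ` col S a \<subseteq> W i \<union> S" by (auto simp: ca_def col_def)
        show "(`) (ca a) ` GC a i \<subseteq> G i" using a unfolding G_def by blast
      qed (simp add: ca_def)
      moreover have "joined (?E i) (a, b, False) (a, b, True)"
        using b a cI[OF a] by (intro cross) (auto simp: Wr Wc Sc(1))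
      ultimately show ?thesis using h1[OF b(2) cI[OF a]] joined_sym joined_trans unfolding ca_def by metis
    qed
    have h4: "joined (?E i) (A, b, False) rt" if b: "b \<in> rows S" and A: "A \<in> UR b i \<union> row S b" for A b
    proof -
      obtain a where a: "a \<in> UR b i \<union> row S b" "a \<in> K i"
        and j: "joined (piece_edges (cube_adj I) (row S b) (UR b i) (GR b i)) A a"
        using bspec[OF bspec[OF JR[OF b] i] A] by blast
      have 1: "joined (?E i) (ra b A) (ra b a)"
      proof (rule joined_embed[OF j])
        show "ra b ` UR b i \<subseteq> W i" using b unfolding W_def by blast
        show "ra b ` row S b \<subseteq> W i \<union> S" by (auto simp: ra_def row_def)
        show "(`) (ra b) ` GR b i \<subseteq> G i" using b unfolding G_def by blast
      qed (simp add: ra_def)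
      have aW: "(a, b, False) \<in> W i \<union> S" using a(1) b by (auto simp: Wr Sr(1))
      have "joined (?E i) (a, b, False) (a, b, True) \<and> joined (?E i) (a, b, True) rt"
      proof (cases "a \<in> cols S")
        case False
        have "(a, b, True) \<in> W i" using a(2) False rI[OF b] by (simp add: Wc)
        then show ?thesis using cross[of a b] aW h2[OF a(2) False rI[OF b]] by blast
      next
        case True
        \<comment> \<open>A column that meets \<open>S\<close> need not belong to the piece as a
          whole, but its prescribed entry points include \<open>b\<close>, where the cross edge
          arrives.\<close>
        then have bU: "b \<in> UC a i \<union> col S a" using bspec[OF PC[OF True] i] a(2) b by auto
        then have bW: "(a, b, True) \<in> W i \<union> S" using True by (auto simp: Wc Sc(1))
        have "joined (?E i) (a, b, False) (a, b, True)"
        proof (cases "(a, b, False) \<in> S \<and> (a, b, True) \<in> S")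
          case True
          then have "{(a, b, False), (a, b, True)} \<in> GX i" using a(2) unfolding GX_def by blast
          then show ?thesis by (intro joined_edge) (simp add: piece_edges_def G_def)
        next
          case False
          then show ?thesis using aW bW by (intro cross) blast
        qed
        then show ?thesis using h3[OF True bU] by blast
      qed
      then show ?thesis
        using joined_trans[OF 1[unfolded ra_def] joined_trans[of _ _ "(a, b, True)"]] by simp
    qed
    have root: "joined (?E i) v rt" if "v \<in> W i \<union> S" for v
    proof -
      obtain A B c where v: "v = (A, B, c)" by (cases v)
      show ?thesis
      proof (cases c)
        case True
        then have "(A, B, True) \<in> W i \<union> S" using v that by simp
        then have "A \<in> cols S \<and> B \<in> UC A i \<union> col S A \<or> A \<in> K i \<and> A \<notin> cols S \<and> B \<in> Pow I"
          using Sc[of A B] by (auto simp: Wc)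
        then show ?thesis using h2 h3 v True by auto
      next
        case False
        then have "(A, B, False) \<in> W i \<union> S" using v that by simp
        then have "B \<in> rows S \<and> A \<in> UR B i \<union> row S B \<or> B \<in> L i \<and> A \<in> Pow I"
          using Sr[of A B] by (auto simp: Wr)
        then show ?thesis using h1 h4 v False by auto
      qed
    qed
    show ?thesis using joined_trans[OF root[OF uv(1)] joined_sym[OF root[OF uv(2)]]] .
  qed
  show ?thesis unfolding has_pieces_def
    using WV GS J Wdis Gdis by (intro exI[of _ W] exI[of _ G]) simp
qed

section \<open>Four terminals in the dual cube\<close>

text \<open>The contribution of one class when its exits avoid \<open>C\<close>, the clusters of the
  other class that meet \<open>S\<close>. The sets \<open>K i\<close> must be nonempty as they also
  index hubs. \<open>R\<close> and \<open>T\<close> are abstract so that rows and columns share the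
  lemmas.\<close>

definition side :: "'i set \<Rightarrow> 'b set \<Rightarrow> ('b \<Rightarrow> 'i set set) \<Rightarrow> 'i set set \<Rightarrow> bool" where
  "side I R T C \<longleftrightarrow> (\<exists>K. (\<forall>i\<in>I. K i \<subseteq> Pow I - C \<and> K i \<noteq> {}) \<and>
     (\<forall>i\<in>I. \<forall>j\<in>I. i \<noteq> j \<longrightarrow> K i \<inter> K j = {}) \<and> (\<forall>b\<in>R. hook I (T b) K (\<lambda>_. {})))"

lemma sideI:
  assumes "\<And>i. i \<in> I \<Longrightarrow> K i \<subseteq> Pow I - C" "\<And>i. i \<in> I \<Longrightarrow> K i \<noteq> {}"
    "\<And>i j. i \<in> I \<Longrightarrow> j \<in> I \<Longrightarrow> i \<noteq> j \<Longrightarrow> K i \<inter> K j = {}"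
    "\<And>b. b \<in> R \<Longrightarrow> hook I (T b) K (\<lambda>_. {})"
  shows "side I R T C"
  unfolding side_def by (intro exI[of _ K]) (simp add: assms)

text \<open>The last conclusion is the hypothesis of \<open>hook_single\<close>, so every cluster
  with one terminal can use the exits chosen for \<open>T\<close>. Four terminals in one cluster do
  without it, as no other cluster has to agree.\<close>

lemma hook_transversal:
  assumes fin: "finite I" and I: "I \<noteq> {}" and T: "T \<subseteq> Pow I" "T \<noteq> {}" "card T \<le> 3" "finite T"
  obtains K p k where "p \<in> Pow I" "\<And>i. i \<in> I \<Longrightarrow> K i \<subseteq> Pow I"
    "\<And>i j. i \<in> I \<Longrightarrow> j \<in> I \<Longrightarrow> i \<noteq> j \<Longrightarrow> K i \<inter> K j = {}" "hook I T K (\<lambda>_. {})"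
    "\<And>i. i \<in> I \<Longrightarrow> flip i p \<in> K i \<or> i = k \<and> p \<in> K i"
proof -
  have flips: "{flip i x} \<subseteq> Pow I" if "i \<in> I" "x \<in> Pow I" for i x using flip_in_Pow[OF that] by simp
  have "card T \<noteq> 0" using T by simp
  then consider "card T = 1" | "card T = 2" | "card T = 3" using T(3) by linarith
  then show thesis
  proof cases
    case 1
    then obtain s where s: "T = {s}" by (auto simp: card_1_singleton_iff)
    have sI: "s \<in> Pow I" using T(1) s by blast
    show thesis
    proof (rule that[of s "\<lambda>i. {flip i s}"])
      show "hook I T (\<lambda>i. {flip i s}) (\<lambda>_. {})" unfolding s by (rule hook_single[OF fin sI sI]) simp_all
    qed (use flips sI in auto)
  next
    case 2
    then obtain x y where xy: "T = {x, y}" "x \<noteq> y" by (auto simp: card_2_iff)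
    have P: "x \<in> Pow I" "y \<in> Pow I" using T(1) xy by blast+
    show thesis
    proof (rule that[of x "\<lambda>i. {flip i x}"])
      show "hook I T (\<lambda>i. {flip i x}) (\<lambda>_. {})" unfolding xy(1)
        by (rule hook_pair[OF fin P xy(2), of id]) simp_all
    qed (use flips P in auto)
  next
    case 3
    then obtain x y z where xyz: "T = {x, y, z}" "x \<noteq> y" "x \<noteq> z" "y \<noteq> z" by (auto simp: card_3_iff)
    have "dif x y \<subseteq> I" "dif x z \<subseteq> I" "dif y z \<subseteq> I" using T(1) xyz(1) by (simp_all add: dif_subset)
    from routing_triple[OF xyz(2-4) this] obtain w j g where wjg: "w \<in> T" "routing I T g" "w \<in> exits T g j"
        "\<forall>i. i \<noteq> j \<longrightarrow> flip i w \<in> exits T g i" unfolding xyz(1)[symmetric] by (elim bexE exE conjE)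
    show thesis
    proof (rule that[of w "exits T g" j])
      show "w \<in> Pow I" using T(1) wjg(1) by blast
      show "flip i w \<in> exits T g i \<or> i = j \<and> w \<in> exits T g i" for i using wjg(3,4) by (cases "i = j") simp_all
      show "exits T g i \<subseteq> Pow I" if "i \<in> I" for i by (rule exits_subset[OF wjg(2) T(1) that])
      show "exits T g i \<inter> exits T g j = {}" if "i \<in> I" "j \<in> I" "i \<noteq> j" for i j
        by (rule exits_disjoint[OF wjg(2) that])
      show "hook I T (exits T g) (\<lambda>_. {})" by (rule hook_routing[OF wjg(2) T(1)])
    qed
  qed
qed

lemma hook_le_4:
  assumes fin: "finite I" and I: "I \<noteq> {}" and T: "T \<subseteq> Pow I" "T \<noteq> {}" "card T \<le> 4" "finite T"
  obtains K where "\<And>i. i \<in> I \<Longrightarrow> K i \<subseteq> Pow I"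
    "\<And>i j. i \<in> I \<Longrightarrow> j \<in> I \<Longrightarrow> i \<noteq> j \<Longrightarrow> K i \<inter> K j = {}" "hook I T K (\<lambda>_. {})"
proof (cases "card T \<le> 3")
  case True
  show ?thesis by (rule hook_transversal[OF fin I T(1,2) True T(4)]) (rule that)
next
  case False
  then have "card T = Suc 3" using T(3) by simp
  then obtain w T' where w: "T = insert w T'" "w \<notin> T'" "card T' = 3" by (metis card_Suc_eq)
  then obtain x y z where xyz: "T' = {x, y, z}" "x \<noteq> y" "x \<noteq> z" "y \<noteq> z" by (auto simp: card_3_iff)
  have Tw: "T = {w, x, y, z}" "distinct [w, x, y, z]" using w xyz by auto
  have P: "w \<in> Pow I" "x \<in> Pow I" "y \<in> Pow I" "z \<in> Pow I" using T(1) Tw(1) by blast+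
  obtain g where g: "routing I T g" using routing_quad[OF fin P Tw(2)] unfolding Tw(1)[symmetric] by (elim exE)
  show ?thesis
    by (rule that[of "exits T g", OF exits_subset[OF g T(1)] exits_disjoint[OF g] hook_routing[OF g T(1)]])
qed

text \<open>Without terminals on this side it suffices to find \<open>card I\<close> hubs outside
  \<open>C\<close>, and \<open>m + 4 \<le> 2 ^ m\<close> from \<open>m = 3\<close> on.\<close>

lemma side_empty:
  assumes "finite I" "card I \<ge> 3" "C \<subseteq> Pow I" "card C \<le> 4"
  shows "side I {} T C"
proof -
  have "m + 4 \<le> 2 ^ m" if "3 \<le> m" for m :: nat using that
    by (induction m rule: nat_induct_at_least) simp_all
  then have "card I + 4 \<le> 2 ^ card I" using assms by simp
  moreover have "card (Pow I - C) = 2 ^ card I - card C"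
    using assms by (simp add: card_Diff_subset finite_subset card_Pow)
  ultimately have "card I \<le> card (Pow I - C)" using assms(4) by simp
  then obtain h where h: "inj_on h I" "h ` I \<subseteq> Pow I - C"
    using card_le_inj[of I "Pow I - C"] assms(1) by auto
  show ?thesis
    by (rule sideI[of I "\<lambda>i. {h i}"]) (use h in \<open>auto dest: inj_onD\<close>)
qed

text \<open>All terminals aim at the neighbours of one vertex \<open>p\<close>. At most
  \<open>2 * card I\<close> vertices have a neighbour in \<open>C\<close>, fewer than there are
  vertices.\<close>

lemma side_singles:
  assumes fin: "finite I" and I: "card I \<ge> 3" and C: "C \<subseteq> Pow I" "card C \<le> 2"
    and T: "\<And>b. b \<in> R \<Longrightarrow> T b \<subseteq> Pow I" "\<And>b. b \<in> R \<Longrightarrow> card (T b) = 1"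
  shows "side I R T C"
proof -
  define N where "N = (\<Union>a\<in>C. (\<lambda>i. flip i a) ` I)"
  have fC: "finite C" using C fin by (auto intro: finite_subset)
  have "card N \<le> (\<Sum>a\<in>C. card ((\<lambda>i. flip i a) ` I))" unfolding N_def by (rule card_UN_le[OF fC])
  also have "\<dots> \<le> (\<Sum>a\<in>C. card I)" by (intro sum_mono card_image_le fin)
  also have "\<dots> \<le> 2 * card I" using C(2) by simp
  also have "2 * m < 2 ^ m" if "3 \<le> m" for m :: nat using that
    by (induction m rule: nat_induct_at_least) simp_all
  then have "2 * card I < 2 ^ card I" using I by simp
  also have "2 ^ card I = card (Pow I)" using fin by (simp add: card_Pow)
  finally have "\<not> Pow I \<subseteq> N" using fin fC
    by (metis card_mono finite_UN_I finite_imageI leD N_def)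
  then obtain p where p: "p \<in> Pow I" "p \<notin> N" by blast
  have "flip i p \<notin> C" if "i \<in> I" for i
  proof
    assume "flip i p \<in> C"
    then have "flip i (flip i p) \<in> N" using that unfolding N_def by blast
    then show False using p by simp
  qed
  moreover have "hook I (T b) (\<lambda>i. {flip i p}) (\<lambda>_. {})" if b: "b \<in> R" for b
  proof -
    obtain s where s: "T b = {s}" using T(2)[OF b] by (auto simp: card_1_singleton_iff)
    have sI: "s \<in> Pow I" using T(1)[OF b] s by blast
    show ?thesis unfolding s by (rule hook_single[OF fin sI p(1)]) simp_all
  qed
  ultimately show ?thesis
    using flip_in_Pow[OF _ p(1)] by (intro sideI[of I "\<lambda>i. {flip i p}"]) auto
qed

text \<open>The exits are the neighbours of \<open>x\<close>, with \<open>x\<close> itself in place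
  of the forbidden \<open>a\<close>. At most one label is affected, the exceptional label of
  \<open>hook_single\<close>.\<close>

lemma side_one_pair:
  assumes fin: "finite I" and b: "b \<in> R" "card (T b) = 2"
    and T: "\<And>b. b \<in> R \<Longrightarrow> T b \<subseteq> Pow I" "\<And>b'. b' \<in> R \<Longrightarrow> b' \<noteq> b \<Longrightarrow> card (T b') = 1"
  shows "side I R T {a}"
proof -
  obtain x y where xy: "T b = {x, y}" "x \<noteq> y" using b(2) by (auto simp: card_2_iff)
  have P: "x \<in> Pow I" "y \<in> Pow I" using T(1)[OF b(1)] xy by blast+
  define K where "K i = {if flip i x = a then x else flip i x}" for i
  have K: "flip i x \<in> K i \<or> x \<in> K i" for i by (simp add: K_def)
  show ?thesis
  proof (rule sideI[of I K])
    show "K i \<subseteq> Pow I - {a}" if "i \<in> I" for i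
      using flip_in_Pow[OF that P(1)] P(1) flip_neq(1)[of i x] unfolding K_def by (auto split: if_splits)
    show "K i \<noteq> {}" for i by (simp add: K_def)
    show "K i \<inter> K j = {}" if "i \<noteq> j" for i j
    proof (cases "flip i x = a")
      case True
      then have "flip j x \<noteq> a" using that flip_eq_iff[of i x j] by metis
      then show ?thesis using True by (simp add: K_def)
    next
      case False
      then show ?thesis using that by (simp add: K_def)
    qed
    fix b' assume b': "b' \<in> R"
    show "hook I (T b') K (\<lambda>_. {})"
    proof (cases "b' = b")
      case True
      have "hook I {x, y} K (\<lambda>_. {})" by (rule hook_pair[OF fin P xy(2), of id]) (use K in simp_all)
      then show ?thesis using True xy(1) by simp
    next
      case False
      then obtain s where s: "T b' = {s}" using T(2)[OF b'] by (auto simp: card_1_singleton_iff)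
      have sI: "s \<in> Pow I" using T(1)[OF b'] s by blast
      obtain k where k: "\<And>i. flip i x = a \<Longrightarrow> i = k" by (metis flip_eq_iff)
      show ?thesis unfolding s
      proof (rule hook_single[OF fin sI P(1)])
        show "flip i x \<in> K i \<or> i = k \<and> x \<in> K i" for i using k[of i] by (simp add: K_def)
      qed simp
    qed
  qed
qed

lemma side_one_big:
  assumes fin: "finite I" and I: "I \<noteq> {}" and b: "b \<in> R" "card (T b) \<le> 3" "T b \<noteq> {}"
    and T: "\<And>b. b \<in> R \<Longrightarrow> T b \<subseteq> Pow I" "\<And>b'. b' \<in> R \<Longrightarrow> b' \<noteq> b \<Longrightarrow> card (T b') = 1"
  shows "side I R T {}"
proof -
  have "finite (T b)" using T(1)[OF b(1)] fin by (auto intro: finite_subset)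
  then obtain K p k where K: "p \<in> Pow I" "\<And>i. i \<in> I \<Longrightarrow> K i \<subseteq> Pow I"
    "\<And>i j. i \<in> I \<Longrightarrow> j \<in> I \<Longrightarrow> i \<noteq> j \<Longrightarrow> K i \<inter> K j = {}" "hook I (T b) K (\<lambda>_. {})"
    "\<And>i. i \<in> I \<Longrightarrow> flip i p \<in> K i \<or> i = k \<and> p \<in> K i"
    using hook_transversal[OF fin I T(1)[OF b(1)] b(3,2)] by metis
  show ?thesis
  proof (rule sideI[of I K])
    show "K i \<subseteq> Pow I - {}" if "i \<in> I" for i using K(2)[OF that] by simp
    show "K i \<noteq> {}" if "i \<in> I" for i using K(5)[OF that] by auto
    show "K i \<inter> K j = {}" if "i \<in> I" "j \<in> I" "i \<noteq> j" for i j by (rule K(3)[OF that])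
    fix b' assume b': "b' \<in> R"
    show "hook I (T b') K (\<lambda>_. {})"
    proof (cases "b' = b")
      case True
      then show ?thesis using K(4) by simp
    next
      case False
      then obtain s where s: "T b' = {s}" using T(2)[OF b'] by (auto simp: card_1_singleton_iff)
      have sI: "s \<in> Pow I" using T(1)[OF b'] s by blast
      show ?thesis unfolding s by (rule hook_single[OF fin sI K(1) K(5)]) simp_all
    qed
  qed
qed

text \<open>Needed when two rows contain a pair each: a column reached from both must carry one
  label. Adjacent vertices have no common neighbour, so the case excluded in
  \<open>transposing_perm\<close> is harmless.\<close>

lemma neighbours_matching:
  assumes fin: "finite I" and P: "x \<in> Pow I" "x' \<in> Pow I"
  obtains \<sigma> where "bij_betw \<sigma> I I" "\<And>i j. i \<noteq> j \<Longrightarrow> flip i x \<noteq> flip (\<sigma> j) x'"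
proof (cases "\<exists>a. dif x x' = {a}")
  case True
  then obtain a where a: "dif x x' = {a}" by (elim exE)
  show thesis
  proof (rule that[of id])
    show "flip i x \<noteq> flip (id j) x'" if "i \<noteq> j" for i j
    proof
      assume "flip i x = flip (id j) x'"
      moreover have "x \<noteq> x'" using a by auto
      ultimately have "{a} = {i, j}" using flip_eq_flipD[of i x j x'] a by simp
      then show False using that by auto
    qed
  qed simp
next
  case False
  have D: "dif x x' \<subseteq> I" using P by (simp add: dif_subset)
  obtain \<pi> where \<pi>: "inj \<pi>" "\<And>i. i \<in> I \<Longrightarrow> \<pi> i \<in> I" "\<And>i. i \<notin> dif x x' \<Longrightarrow> \<pi> i = i"
    "\<And>i j. i \<noteq> j \<Longrightarrow> dif x x' \<noteq> {i, \<pi> j}"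
    using transposing_perm[OF _ D] False by metis
  show thesis
  proof (rule that[of \<pi>])
    have "inj_on \<pi> I" "\<pi> ` I \<subseteq> I" using \<pi>(1,2) by (auto intro: inj_on_subset)
    then show "bij_betw \<pi> I I" using fin by (simp add: bij_betw_def endo_inj_surj)
    show "flip i x \<noteq> flip (\<pi> j) x'" if "i \<noteq> j" for i j
    proof
      assume eq: "flip i x = flip (\<pi> j) x'"
      show False
      proof (cases "x = x'")
        case True
        then have "\<pi> j = j" using \<pi>(3)[of j] by simp
        then show False using eq True that by simp
      next
        case False
        then show False using flip_eq_flipD[OF eq] \<pi>(4)[OF that] by simp
      qed
    qed
  qed
qed

lemma side_two_pairs:
  assumes fin: "finite I" and R: "R = {b, b'}" and c: "card (T b) = 2" "card (T b') = 2"
    and T: "\<And>b. b \<in> R \<Longrightarrow> T b \<subseteq> Pow I"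
  shows "side I R T {}"
proof -
  obtain x y where xy: "T b = {x, y}" "x \<noteq> y" using c(1) by (auto simp: card_2_iff)
  obtain x' y' where xy': "T b' = {x', y'}" "x' \<noteq> y'" using c(2) by (auto simp: card_2_iff)
  have P: "x \<in> Pow I" "y \<in> Pow I" "x' \<in> Pow I" "y' \<in> Pow I" using T[of b] T[of b'] xy xy' R by blast+
  obtain \<sigma> where \<sigma>: "bij_betw \<sigma> I I" "\<And>i j. i \<noteq> j \<Longrightarrow> flip i x \<noteq> flip (\<sigma> j) x'"
    using neighbours_matching[OF fin P(1,3)] by metis
  define K where "K i = {flip i x, flip (\<sigma> i) x'}" for i
  show ?thesis
  proof (rule sideI[of I K])
    show "K i \<subseteq> Pow I - {}" if "i \<in> I" for i
      using flip_in_Pow[OF that P(1)] flip_in_Pow[OF _ P(3), of "\<sigma> i"] bij_betwE[OF \<sigma>(1)] that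
      by (simp add: K_def)
    show "K i \<noteq> {}" for i by (simp add: K_def)
    show "K i \<inter> K j = {}" if "i \<in> I" "j \<in> I" "i \<noteq> j" for i j
    proof -
      have "\<sigma> i \<noteq> \<sigma> j" using \<sigma>(1) that by (auto simp: bij_betw_def inj_on_def)
      then show ?thesis using that(3) \<sigma>(2)[of i j] \<sigma>(2)[of j i] by (auto simp del: mem_flip simp: K_def)
    qed
    have 1: "hook I {x, y} K (\<lambda>_. {})" by (rule hook_pair[OF fin P(1,2) xy(2), of id]) (simp_all add: K_def)
    have 2: "hook I {x', y'} K (\<lambda>_. {})" by (rule hook_pair[OF fin P(3,4) xy'(2) \<sigma>(1)]) (simp_all add: K_def)
    fix d assume "d \<in> R"
    then show "hook I (T d) K (\<lambda>_. {})" using 1 2 R xy(1) xy'(1) by auto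
  qed
qed

section \<open>Combining both classes, and the case of a single row\<close>

lemma row_subset: "S \<subseteq> dual_V I \<Longrightarrow> row S b \<subseteq> Pow I"
  unfolding row_def dual_V_def by blast

lemma col_subset: "S \<subseteq> dual_V I \<Longrightarrow> col S a \<subseteq> Pow I"
  unfolding col_def dual_V_def by blast

lemma rows_subset: "S \<subseteq> dual_V I \<Longrightarrow> rows S \<subseteq> Pow I"
  unfolding rows_def row_def dual_V_def by blast

lemma cols_subset: "S \<subseteq> dual_V I \<Longrightarrow> cols S \<subseteq> Pow I"
  unfolding cols_def col_def dual_V_def by blast

text \<open>Nonempty exits that avoid \<open>cols S\<close> make \<open>KL\<close> and the entry
  points of \<open>has_pieces_glue\<close> vacuous.\<close>

lemma has_pieces_sides:
  assumes fin: "finite I" and SV: "S \<subseteq> dual_V I"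
    and r: "side I (rows S) (row S) (cols S)" and c: "side I (cols S) (col S) (rows S)"
  shows "has_pieces (dual_V I) (dual_adj I) S I"
proof -
  obtain K where K: "\<forall>i\<in>I. K i \<subseteq> Pow I - cols S \<and> K i \<noteq> {}" "\<forall>i\<in>I. \<forall>j\<in>I. i \<noteq> j \<longrightarrow> K i \<inter> K j = {}"
    "\<forall>b\<in>rows S. hook I (row S b) K (\<lambda>_. {})" using r unfolding side_def by (elim exE conjE)
  obtain L where L: "\<forall>i\<in>I. L i \<subseteq> Pow I - rows S \<and> L i \<noteq> {}" "\<forall>i\<in>I. \<forall>j\<in>I. i \<noteq> j \<longrightarrow> L i \<inter> L j = {}"
    "\<forall>b\<in>cols S. hook I (col S b) L (\<lambda>_. {})" using c unfolding side_def by (elim exE conjE)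
  have KI: "K i \<subseteq> Pow I" "K i \<inter> cols S = {}" "K i \<noteq> {}" if "i \<in> I" for i using K(1) that by blast+
  show ?thesis
  proof (rule has_pieces_glue[OF fin SV])
    show "K i \<subseteq> Pow I" if "i \<in> I" for i by (rule KI(1)[OF that])
    show "K i \<inter> K j = {}" "L i \<inter> L j = {}" if "i \<in> I" "j \<in> I" "i \<noteq> j" for i j
      using K(2) L(2) that by simp_all
    show "L i \<subseteq> Pow I - rows S" "L i \<noteq> {}" if "i \<in> I" for i using L(1) that by simp_all
    show "\<exists>d. L i = {d}" if "i \<in> I" "K i \<subseteq> cols S" for i using KI(2,3)[OF that(1)] that(2) by (simp add: Int_absorb2)
    show "hook I (row S b) K (\<lambda>_. {})" if "b \<in> rows S" for b using K(3) that by simp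
    show "hook I (col S a) L (\<lambda>i. if a \<in> K i then rows S else {})" if a: "a \<in> cols S" for a
    proof -
      have *: "(if a \<in> K i then rows S else {}) = {}" if "i \<in> I" for i using KI(2)[OF that] a by auto
      have "hook I (col S a) L (\<lambda>_. {})" using L(3) a by simp
      then show ?thesis unfolding hook_def hooked_def by (simp add: * cong: ball_cong)
    qed
  qed
qed

text \<open>The exits \<open>K\<close> of the row may hit columns that meet \<open>S\<close>. The
  hubs are the rows next to \<open>b\<close>, so a column terminal aims at the neighbours of
  \<open>b\<close> and can give \<open>b\<close> to one label: the label whose exits contain this
  column, unique since the \<open>K i\<close> are disjoint.\<close>

lemma has_pieces_single_row:
  assumes fin: "finite I" and I: "I \<noteq> {}" and SV: "S \<subseteq> dual_V I"
    and b: "rows S = {b}" "card (row S b) \<le> 4"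
    and c: "\<And>a. a \<in> cols S \<Longrightarrow> card (col S a) = 1"
  shows "has_pieces (dual_V I) (dual_adj I) S I"
proof -
  have bR: "b \<in> rows S" using b(1) by simp
  have T: "row S b \<subseteq> Pow I" "row S b \<noteq> {}" "b \<in> Pow I"
    using row_subset[OF SV] rows_subset[OF SV] bR by (auto simp: rows_def)
  have fT: "finite (row S b)" using T(1) fin by (auto intro: finite_subset)
  obtain K where K: "\<And>i. i \<in> I \<Longrightarrow> K i \<subseteq> Pow I"
    "\<And>i j. i \<in> I \<Longrightarrow> j \<in> I \<Longrightarrow> i \<noteq> j \<Longrightarrow> K i \<inter> K j = {}" "hook I (row S b) K (\<lambda>_. {})"
    using hook_le_4[OF fin I T(1,2) b(2) fT] by metis
  show ?thesis
  proof (rule has_pieces_glue[OF fin SV, of K "\<lambda>i. {flip i b}"])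
    show "K i \<subseteq> Pow I" if "i \<in> I" for i by (rule K(1)[OF that])
    show "K i \<inter> K j = {}" if "i \<in> I" "j \<in> I" "i \<noteq> j" for i j by (rule K(2)[OF that])
    show "{flip i b} \<inter> {flip j b} = {}" if "i \<noteq> j" for i j using that by simp
    show "{flip i b} \<subseteq> Pow I - rows S" if "i \<in> I" for i using flip_in_Pow[OF that T(3)] b(1) by simp
    show "hook I (row S b') K (\<lambda>_. {})" if "b' \<in> rows S" for b' using that b(1) K(3) by simp
    fix a assume a: "a \<in> cols S"
    obtain s where s: "col S a = {s}" using c[OF a] by (auto simp: card_1_singleton_iff)
    have "(a, s, True) \<in> S" using s by (auto simp: col_def)
    then have sI: "s \<in> Pow I" using SV by (auto simp: dual_V_def)
    obtain k where k: "\<And>i. i \<in> I \<Longrightarrow> a \<in> K i \<Longrightarrow> i = k" using K(2) by (metis IntI empty_iff)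
    show "hook I (col S a) (\<lambda>i. {flip i b}) (\<lambda>i. if a \<in> K i then rows S else {})" unfolding s
    proof (rule hook_single[OF fin sI T(3)])
      show "(if a \<in> K i then rows S else {}) \<subseteq> (if i = k then {b} else {})" if "i \<in> I" for i
        using k[OF that] b(1) by simp
    qed simp
  qed simp_all
qed

definition swap_class :: "'i dual_vertex \<Rightarrow> 'i dual_vertex" where
  "swap_class = (\<lambda>(A, B, c). (B, A, \<not> c))"

lemma swap_class_simps [simp]: "swap_class (A, B, c) = (B, A, \<not> c)"
  by (simp add: swap_class_def)

lemma swap_class_swap [simp]: "swap_class (swap_class v) = v"
  by (cases v) simp

lemma mem_swap_image: "v \<in> swap_class ` S \<longleftrightarrow> swap_class v \<in> S"
  by (metis image_iff swap_class_swap)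

lemma rows_swap: "row (swap_class ` S) = col S" "col (swap_class ` S) = row S"
    "rows (swap_class ` S) = cols S" "cols (swap_class ` S) = rows S"
  by (simp_all add: row_def col_def rows_def cols_def mem_swap_image fun_eq_iff)

lemma swap_class_V: "S \<subseteq> dual_V I \<Longrightarrow> swap_class ` S \<subseteq> dual_V I"
  by (auto simp: dual_V_def swap_class_def)

lemma swap_class_adj: "dual_adj I u v \<Longrightarrow> dual_adj I (swap_class u) (swap_class v)"
  by (cases u; cases v) (auto simp: dual_adj_def)

lemma has_pieces_swap:
  assumes "has_pieces (dual_V I) (dual_adj I) (swap_class ` S) I" "S \<subseteq> dual_V I"
  shows "has_pieces (dual_V I) (dual_adj I) S I"
proof -
  have "has_pieces (dual_V I) (dual_adj I) (swap_class ` swap_class ` S) I"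
  proof (rule has_pieces_image[OF assms(1)])
    show "inj_on swap_class (dual_V I)" by (rule inj_on_inverseI[of _ swap_class]) simp
    show "swap_class ` S \<subseteq> dual_V I" "swap_class ` dual_V I \<subseteq> dual_V I"
      using swap_class_V[of _ I] assms(2) by blast+
  qed (rule swap_class_adj)
  then show ?thesis by (simp add: image_image)
qed

section \<open>Distributions of four terminals over the clusters\<close>

lemma card_by_clusters:
  assumes fin: "finite I" and SV: "S \<subseteq> dual_V I"
  shows "card S = (\<Sum>b\<in>rows S. card (row S b)) + (\<Sum>a\<in>cols S. card (col S a))"
proof -
  have fR: "finite (rows S)" "finite (cols S)" and fr: "finite (row S b)" "finite (col S b)" for b
    using rows_subset[OF SV] cols_subset[OF SV] row_subset[OF SV] col_subset[OF SV] fin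
    by (meson finite_Pow_iff finite_subset)+
  let ?f = "\<lambda>(b, A). (A, b, False)" and ?g = "\<lambda>(a, B). (a, B, True)"
  have S: "S = ?f ` Sigma (rows S) (row S) \<union> ?g ` Sigma (cols S) (col S)"
  proof (intro equalityI subsetI)
    fix v assume v: "v \<in> S"
    obtain A B c where "v = (A, B, c)" by (cases v)
    then show "v \<in> ?f ` Sigma (rows S) (row S) \<union> ?g ` Sigma (cols S) (col S)"
      using v by (cases c) (force simp: row_def col_def rows_def cols_def)+
  qed (auto simp: row_def col_def)
  have "card S = card (?f ` Sigma (rows S) (row S)) + card (?g ` Sigma (cols S) (col S))"
    by (subst S, rule card_Un_disjoint) (auto intro!: finite_imageI finite_SigmaI simp: fR fr)
  also have "card (?f ` Sigma (rows S) (row S)) = card (Sigma (rows S) (row S))"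
    by (rule card_image) (auto simp: inj_on_def)
  also have "card (?g ` Sigma (cols S) (col S)) = card (Sigma (cols S) (col S))"
    by (rule card_image) (auto simp: inj_on_def)
  finally show ?thesis using fR fr by simp
qed

lemma card_le_sum_pos:
  fixes f :: "'b \<Rightarrow> nat"
  assumes "finite R" "\<And>b. b \<in> R \<Longrightarrow> 1 \<le> f b"
  shows "card R \<le> sum f R"
  using sum_mono[of R "\<lambda>_. 1" f] assms by simp

lemma card_le_sum_pos1:
  fixes f :: "'b \<Rightarrow> nat"
  assumes "finite R" "\<And>b. b \<in> R \<Longrightarrow> 1 \<le> f b" "b \<in> R"
  shows "f b + card R \<le> sum f R + 1"
proof -
  have "card (R - {b}) \<le> sum f (R - {b})" using assms by (intro card_le_sum_pos) auto
  then show ?thesis using assms(1,3) by (simp add: sum.remove[of R b f] card_Diff_singleton)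
qed

lemma card_le_sum_pos2:
  fixes f :: "'b \<Rightarrow> nat"
  assumes "finite R" "\<And>b. b \<in> R \<Longrightarrow> 1 \<le> f b" "b \<in> R" "b' \<in> R" "b' \<noteq> b"
  shows "f b + f b' + card R \<le> sum f R + 2"
proof -
  have "f b' + card (R - {b}) \<le> sum f (R - {b}) + 1" using assms by (intro card_le_sum_pos1) auto
  then show ?thesis using assms(1,3) by (simp add: sum.remove[of R b f] card_Diff_singleton)
qed

text \<open>\<open>n1\<close> and \<open>n2\<close> exclude the configurations of
  \<open>has_pieces_single_row\<close>. What remains: all clusters of this class are single and
  \<open>C\<close> has two elements, or \<open>C\<close> has one element and this class has one pair
  and otherwise single clusters.\<close>

lemma side_mixed:
  assumes fin: "finite I" and I: "card I \<ge> 3"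
    and R: "finite R" "R \<noteq> {}" "C \<subseteq> Pow I" "C \<noteq> {}"
    and T: "\<And>b. b \<in> R \<Longrightarrow> T b \<subseteq> Pow I" "\<And>b. b \<in> R \<Longrightarrow> 1 \<le> card (T b)"
    and U: "\<And>a. a \<in> C \<Longrightarrow> 1 \<le> card (U a)"
    and sum: "(\<Sum>b\<in>R. card (T b)) + (\<Sum>a\<in>C. card (U a)) = 4"
    and n1: "\<not> (card R = 1 \<and> (\<forall>a\<in>C. card (U a) = 1))"
    and n2: "\<not> (card C = 1 \<and> (\<forall>b\<in>R. card (T b) = 1))"
  shows "side I R T C"
proof -
  have fC: "finite C" using R(3) fin by (auto intro: finite_subset)
  have c0: "card R \<noteq> 0" "card C \<noteq> 0" using R fC by auto
  have s0: "card R \<le> (\<Sum>b\<in>R. card (T b))" "card C \<le> (\<Sum>a\<in>C. card (U a))"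
    by (rule card_le_sum_pos[OF R(1) T(2)], simp, rule card_le_sum_pos[OF fC U], simp)
  have s1: "card (T b) + card R \<le> (\<Sum>b\<in>R. card (T b)) + 1" if "b \<in> R" for b
    by (rule card_le_sum_pos1[OF R(1) T(2) that])
  have u1: "card (U a) + card C \<le> (\<Sum>a\<in>C. card (U a)) + 1" if "a \<in> C" for a
    by (rule card_le_sum_pos1[OF fC U that])
  show ?thesis
  proof (cases "\<forall>b\<in>R. card (T b) = 1")
    case True
    then have C1: "card C \<noteq> 1" using n2 by blast
    have "card C \<le> 2"
    proof (rule ccontr)
      assume "\<not> card C \<le> 2"
      then have "card R = 1" "(\<Sum>a\<in>C. card (U a)) = card C" using s0 c0 sum by linarith+
      moreover from this have "card (U a) = 1" if "a \<in> C" for a using u1[OF that] U[OF that] by linarith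
      ultimately show False using n1 by blast
    qed
    then show ?thesis using True by (intro side_singles[OF fin I R(3)] T(1)) auto
  next
    case False
    then obtain b where b: "b \<in> R" "card (T b) \<noteq> 1" by blast
    then have b2: "2 \<le> card (T b)" using T(2)[OF b(1)] by linarith
    have C1: "card C = 1"
    proof (rule ccontr)
      assume "card C \<noteq> 1"
      then have "card R = 1" "(\<Sum>a\<in>C. card (U a)) = card C"
        using s0 c0 sum s1[OF b(1)] b2 by linarith+
      moreover from this have "card (U a) = 1" if "a \<in> C" for a using u1[OF that] U[OF that] by linarith
      ultimately show False using n1 by blast
    qed
    then obtain a where a: "C = {a}" by (auto simp: card_1_singleton_iff)
    have bT: "card (T b) = 2"
    proof (rule ccontr)
      assume "card (T b) \<noteq> 2"
      then have "card R = 1" "(\<Sum>a\<in>C. card (U a)) = card C"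
        using s0 c0 sum s1[OF b(1)] b2 by linarith+
      moreover from this have "card (U a) = 1" if "a \<in> C" for a using u1[OF that] U[OF that] by linarith
      ultimately show False using n1 by blast
    qed
    have "card (T b') = 1" if b': "b' \<in> R" "b' \<noteq> b" for b'
    proof -
      have "card {b, b'} \<le> card R" using b(1) b' R(1) by (intro card_mono) auto
      then have "2 \<le> card R" using b'(2) by simp
      moreover have "card (T b) + card (T b') + card R \<le> (\<Sum>b\<in>R. card (T b)) + 2"
        by (rule card_le_sum_pos2[OF R(1) T(2) b(1) b'])
      ultimately show ?thesis using s0 c0 sum bT T(2)[OF b'(1)] by linarith
    qed
    then show ?thesis unfolding a using b(1) bT by (intro side_one_pair[OF fin] T(1))
  qed
qed

text \<open>Four terminals in at least two clusters are distributed as 3+1, 2+1+1, 1+1+1+1 or 2+2;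
  all but the last have at most one cluster that is not single.\<close>

lemma side_unmixed:
  assumes fin: "finite I" and I: "I \<noteq> {}" and R: "finite R" "card R \<noteq> 1"
    and T: "\<And>b. b \<in> R \<Longrightarrow> T b \<subseteq> Pow I" "\<And>b. b \<in> R \<Longrightarrow> 1 \<le> card (T b)"
    and sum: "(\<Sum>b\<in>R. card (T b)) = 4"
  shows "side I R T {}"
proof -
  have "R \<noteq> {}" using sum by auto
  then have c0: "card R \<noteq> 0" using R by auto
  have s1: "card (T b) + card R \<le> 5" if "b \<in> R" for b
    using card_le_sum_pos1[of R "\<lambda>b. card (T b)" b] R(1) T(2) that sum by simp
  have "Max ((\<lambda>b. card (T b)) ` R) \<in> (\<lambda>b. card (T b)) ` R" using R(1) \<open>R \<noteq> {}\<close> by (intro Max_in) auto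
  then obtain b where b: "b \<in> R" "card (T b) = Max ((\<lambda>b. card (T b)) ` R)" by auto
  have max: "card (T b') \<le> card (T b)" if "b' \<in> R" for b' unfolding b(2) using that R(1) by simp
  show ?thesis
  proof (cases "\<forall>b'\<in>R. b' \<noteq> b \<longrightarrow> card (T b') = 1")
    case True
    show ?thesis
    proof (rule side_one_big[OF fin I b(1)])
      show "card (T b) \<le> 3" using s1[OF b(1)] c0 R(2) by linarith
      show "T b \<noteq> {}" using T(2)[OF b(1)] by auto
    qed (use T(1) True in auto)
  next
    case False
    then obtain b' where b': "b' \<in> R" "b' \<noteq> b" "card (T b') \<noteq> 1" by blast
    have sub: "{b, b'} \<subseteq> R" "card {b, b'} = 2" using b b' by auto
    then have "2 \<le> card R" using card_mono[OF R(1) sub(1)] by simp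
    moreover have "card (T b) + card (T b') + card R \<le> 6"
      using card_le_sum_pos2[of R "\<lambda>b. card (T b)" b b'] R(1) T(2) b(1) b'(1,2) sum by simp
    ultimately have "card R = 2" "card (T b) = 2" "card (T b') = 2"
      using T(2)[OF b'(1)] b'(3) max[OF b'(1)] by linarith+
    moreover from this have "R = {b, b'}" using card_subset_eq[OF R(1) sub(1)] sub(2) by simp
    ultimately show ?thesis using T(1) by (intro side_two_pairs[OF fin])
  qed
qed

lemma has_pieces_four:
  assumes fin: "finite I" and I: "card I \<ge> 3" and SV: "S \<subseteq> dual_V I" and S: "card S = 4"
  shows "has_pieces (dual_V I) (dual_adj I) S I"
proof -
  have Ine: "I \<noteq> {}" using I by auto
  have fR: "finite (rows S)" "finite (cols S)" and fr: "finite (row S b)" "finite (col S b)" for b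
    using rows_subset[OF SV] cols_subset[OF SV] row_subset[OF SV] col_subset[OF SV] fin
    by (meson finite_Pow_iff finite_subset)+
  have sum: "(\<Sum>b\<in>rows S. card (row S b)) + (\<Sum>a\<in>cols S. card (col S a)) = 4"
    using card_by_clusters[OF fin SV] S by simp
  have pos: "b \<in> rows S \<Longrightarrow> 1 \<le> card (row S b)" "a \<in> cols S \<Longrightarrow> 1 \<le> card (col S a)" for a b
    using fr by (simp_all add: rows_def cols_def Suc_le_eq card_gt_0_iff)
  have small: "card (rows S) \<le> 4" "card (cols S) \<le> 4"
    using card_le_sum_pos[of "rows S" "\<lambda>b. card (row S b)"] card_le_sum_pos[of "cols S" "\<lambda>a. card (col S a)"]
      fR pos sum by fastforce+
  have big: "card (row S b) \<le> 4" "card (col S b) \<le> 4" for b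
  proof -
    have "finite S" using S by (simp add: card_ge_0_finite)
    moreover have "(\<lambda>A. (A, b, False)) ` row S b \<subseteq> S" "(\<lambda>B. (b, B, True)) ` col S b \<subseteq> S"
      by (auto simp: row_def col_def)
    ultimately have "card ((\<lambda>A. (A, b, False)) ` row S b) \<le> 4" "card ((\<lambda>B. (b, B, True)) ` col S b) \<le> 4"
      using S card_mono by metis+
    then show "card (row S b) \<le> 4" "card (col S b) \<le> 4" by (simp_all add: card_image inj_on_def)
  qed
  show ?thesis
  proof (cases "card (rows S) = 1 \<and> (\<forall>a\<in>cols S. card (col S a) = 1)")
    case True
    then obtain b where "rows S = {b}" by (auto simp: card_1_singleton_iff)
    then show ?thesis using True big by (intro has_pieces_single_row[OF fin Ine SV]) auto
  next
    case n1: False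
    show ?thesis
    proof (cases "card (cols S) = 1 \<and> (\<forall>a\<in>rows S. card (row S a) = 1)")
      case True
      then obtain b where "cols S = {b}" by (auto simp: card_1_singleton_iff)
      then have "has_pieces (dual_V I) (dual_adj I) (swap_class ` S) I" using True big
        by (intro has_pieces_single_row[OF fin Ine swap_class_V[OF SV]]) (auto simp: rows_swap)
      then show ?thesis using SV by (rule has_pieces_swap)
    next
      case n2: False
      show ?thesis
      proof (rule has_pieces_sides[OF fin SV])
        show "side I (rows S) (row S) (cols S)"
        proof (cases "cols S = {}")
          case True
          then show ?thesis using n1 sum side_unmixed[OF fin Ine fR(1) _ row_subset[OF SV] pos(1)] by simp
        next
          case c: False
          show ?thesis
          proof (cases "rows S = {}")
            case True
            then show ?thesis using side_empty[OF fin I cols_subset[OF SV] small(2)] by simp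
          next
            case False
            then show ?thesis
              by (intro side_mixed[OF fin I fR(1) _ cols_subset[OF SV] c row_subset[OF SV] pos sum n1 n2])
          qed
        qed
        show "side I (cols S) (col S) (rows S)"
        proof (cases "rows S = {}")
          case True
          then show ?thesis using n2 sum side_unmixed[OF fin Ine fR(2) _ col_subset[OF SV] pos(2)] by simp
        next
          case r: False
          show ?thesis
          proof (cases "cols S = {}")
            case True
            then show ?thesis using side_empty[OF fin I rows_subset[OF SV] small(1)] by simp
          next
            case False
            have "(\<Sum>a\<in>cols S. card (col S a)) + (\<Sum>b\<in>rows S. card (row S b)) = 4" using sum by simp
            then show ?thesis using False
              by (intro side_mixed[OF fin I fR(2) _ rows_subset[OF SV] r col_subset[OF SV] pos(2,1) _ n2 n1])
          qed
        qed
      qed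
    qed
  qed
qed

section \<open>Transfer to bit strings\<close>

text \<open>With \<open>m = n - 1\<close>, block \<open>A\<close> holds the positions that may
  change when the last bit is 0, and \<open>B\<close> those that may change when it is 1.\<close>

definition encode :: "nat \<Rightarrow> nat dual_vertex \<Rightarrow> bool list" where
  "encode m = (\<lambda>(A, B, c). map (\<lambda>k. if k < m then k \<in> A else if k < 2 * m then k - m \<in> B else c) [0..<2 * m + 1])"

definition decode :: "nat \<Rightarrow> bool list \<Rightarrow> nat dual_vertex" where
  "decode m u = ({k. k < m \<and> u ! k}, {k. k < m \<and> u ! (m + k)}, u ! (2 * m))"

lemma length_encode [simp]: "length (encode m v) = 2 * m + 1"
  by (cases v) (simp add: encode_def)

lemma nth_encode:
  "k < 2 * m + 1 \<Longrightarrow> encode m (A, B, c) ! k = (if k < m then k \<in> A else if k < 2 * m then k - m \<in> B else c)"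
  unfolding encode_def prod.case by (subst nth_map) (auto simp del: upt_Suc)

lemma encode_decode:
  assumes "length u = 2 * m + 1"
  shows "encode m (decode m u) = u"
proof (rule nth_equalityI)
  fix k assume k: "k < length (encode m (decode m u))"
  then have "k < 2 * m + 1" by simp
  then show "encode m (decode m u) ! k = u ! k"
    unfolding decode_def by (subst nth_encode) (auto simp: less_Suc_eq)
qed (simp add: assms)

lemma decode_in_dual_V: "decode m u \<in> dual_V {..<m}"
  by (auto simp: decode_def dual_V_def)

lemma inj_on_encode: "inj_on (encode m) (dual_V {..<m})"
proof (rule inj_on_inverseI[of _ "decode m"])
  fix v assume v: "v \<in> dual_V {..<m}"
  obtain A B c where v': "v = (A, B, c)" by (cases v)
  have "A \<subseteq> {..<m}" "B \<subseteq> {..<m}" using v v' by (auto simp: dual_V_def)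
  then show "decode m (encode m v) = v" unfolding v' decode_def by (auto simp: nth_encode)
qed

text \<open>The position \<open>k\<close> counts from zero, hence the shift against the index in
  \<open>dual_cube_adj\<close>.\<close>

lemma dual_cube_adjI:
  assumes "length u = 2 * n - 1" "length v = 2 * n - 1" "k < 2 * n - 1" "u ! k \<noteq> v ! k"
    "\<And>j. j < 2 * n - 1 \<Longrightarrow> j \<noteq> k \<Longrightarrow> u ! j = v ! j"
    "k < n - 1 \<Longrightarrow> \<not> u ! (2 * n - 2) \<and> \<not> v ! (2 * n - 2)"
    "n - 1 \<le> k \<Longrightarrow> k < 2 * n - 2 \<Longrightarrow> u ! (2 * n - 2) \<and> v ! (2 * n - 2)"
  shows "dual_cube_adj n u v"
  unfolding dual_cube_adj_def
proof (intro conjI exI[of _ "Suc k"] allI impI)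
  fix j assume "1 \<le> j \<and> j \<le> 2 * n - 1 \<and> j \<noteq> Suc k"
  then show "u ! (j - 1) = v ! (j - 1)" by (intro assms(5)) auto
next
  assume "n \<le> Suc k \<and> Suc k \<le> 2 * n - 2"
  then have "n - 1 \<le> k" "k < 2 * n - 2" by auto
  then show "u ! (2 * n - 2)" "v ! (2 * n - 2)" using assms(7) by simp_all
next
  assume "1 \<le> Suc k \<and> Suc k \<le> n - 1"
  then have "k < n - 1" by auto
  then show "\<not> u ! (2 * n - 2)" "\<not> v ! (2 * n - 2)" using assms(6) by simp_all
qed (use assms(1-4) in auto)

lemma encode_adj:
  assumes m: "n = Suc m" and uv: "u \<in> dual_V {..<m}" "v \<in> dual_V {..<m}" "dual_adj {..<m} u v"
  shows "dual_cube_adj n (encode m u) (encode m v)"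
proof -
  obtain A B c where u: "u = (A, B, c)" by (cases u)
  obtain A' B' c' where v: "v = (A', B', c')" by (cases v)
  have len: "length (encode m u) = 2 * n - 1" "length (encode m v) = 2 * n - 1" using m by simp_all
  have "(\<not> c \<and> \<not> c' \<and> B = B' \<and> (\<exists>i<m. A' = flip i A)) \<or> (c \<and> c' \<and> A = A' \<and> (\<exists>i<m. B' = flip i B))
      \<or> (A = A' \<and> B = B' \<and> c \<noteq> c')"
    using uv(3) unfolding u v dual_adj_def cube_adj_def by (auto split: if_splits)
  then show ?thesis
  proof (elim disjE conjE exE)
    fix i assume *: "\<not> c" "\<not> c'" "B = B'" "i < m" "A' = flip i A"
    show ?thesis
      by (rule dual_cube_adjI[OF len, of i]) (use * in \<open>auto simp: m u v nth_encode\<close>)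
  next
    fix i assume *: "c" "c'" "A = A'" "i < m" "B' = flip i B"
    show ?thesis
      by (rule dual_cube_adjI[OF len, of "m + i"]) (use * in \<open>auto simp: m u v nth_encode\<close>)
  next
    assume *: "A = A'" "B = B'" "c \<noteq> c'"
    show ?thesis
      by (rule dual_cube_adjI[OF len, of "2 * m"]) (use * in \<open>auto simp: m u v nth_encode\<close>)
  qed
qed

lemma dual_cube_packs_trees:
  assumes n: "n \<ge> 4" and S: "S \<subseteq> dual_cube_V n" "card S = 4"
  shows "packs_trees (dual_cube_V n) (dual_cube_adj n) S (n - 1)"
proof -
  define m where "m = n - 1"
  have m: "n = Suc m" "m \<ge> 3" using n by (auto simp: m_def)
  have V: "dual_cube_V n = {u. length u = 2 * m + 1}" using m by (simp add: dual_cube_V_def)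
  have fin: "finite (dual_cube_V n)" unfolding V using finite_lists_length_eq[of "UNIV :: bool set"] by simp
  define S' where "S' = decode m ` S"
  have SS: "encode m ` S' = S"
  proof -
    have "encode m (decode m u) = u" if "u \<in> S" for u using that S(1) V by (intro encode_decode) auto
    then show ?thesis unfolding S'_def image_image by simp
  qed
  have S'V: "S' \<subseteq> dual_V {..<m}" using decode_in_dual_V by (auto simp: S'_def)
  have "card S' = 4"
    using S(2) card_image[OF inj_on_subset[OF inj_on_encode S'V]] unfolding SS by simp
  then have "has_pieces (dual_V {..<m}) (dual_adj {..<m}) S' {..<m}"
    using m S'V by (intro has_pieces_four) auto
  then have "has_pieces (dual_cube_V n) (dual_cube_adj n) (encode m ` S') {..<m}"
    by (rule has_pieces_image[OF _ inj_on_encode S'V]) (auto simp: V intro: encode_adj[OF m(1)])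
  then show ?thesis unfolding SS m_def[symmetric]
    using fin S by (intro packs_trees_if_pieces) auto
qed

section \<open>Neighbourhoods in the dual cube and the value of the connectivity\<close>

definition dual_cube_nbrs :: "nat \<Rightarrow> bool list \<Rightarrow> bool list set" where
  "dual_cube_nbrs n u = (\<lambda>k. u[k := \<not> u ! k]) `
     insert (2 * n - 2) (if u ! (2 * n - 2) then {n - 1..<2 * n - 2} else {..<n - 1})"

lemma card_dual_cube_nbrs:
  assumes "n \<ge> 1" "length u = 2 * n - 1"
  shows "card (dual_cube_nbrs n u) = n" "finite (dual_cube_nbrs n u)"
proof -
  let ?D = "insert (2 * n - 2) (if u ! (2 * n - 2) then {n - 1..<2 * n - 2} else {..<n - 1})"
  have inj: "inj_on (\<lambda>k. u[k := \<not> u ! k]) ?D"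
  proof (rule inj_onI)
    fix k l assume "k \<in> ?D" "l \<in> ?D" and eq: "u[k := \<not> u ! k] = u[l := \<not> u ! l]"
    then have "k < length u" using assms by (auto split: if_splits)
    then have "u[l := \<not> u ! l] ! k = (\<not> u ! k)" unfolding eq[symmetric] by simp
    then show "k = l" by (cases "k = l") simp_all
  qed
  have "card ?D = n" using assms by auto
  then show "card (dual_cube_nbrs n u) = n"
    unfolding dual_cube_nbrs_def card_image[OF inj] .
  show "finite (dual_cube_nbrs n u)" unfolding dual_cube_nbrs_def by simp
qed

lemma dual_cube_adj_sym: "dual_cube_adj n u v \<Longrightarrow> dual_cube_adj n v u"
  unfolding dual_cube_adj_def by (elim conjE exE) (intro conjI exI, auto)

lemma dual_cube_adj_nbrs:
  assumes "dual_cube_adj n u v"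
  shows "v \<in> dual_cube_nbrs n u"
proof -
  obtain i where i: "1 \<le> i" "i \<le> 2 * n - 1" "u ! (i - 1) \<noteq> v ! (i - 1)"
      "\<forall>j. 1 \<le> j \<and> j \<le> 2 * n - 1 \<and> j \<noteq> i \<longrightarrow> u ! (j - 1) = v ! (j - 1)"
      "1 \<le> i \<and> i \<le> n - 1 \<longrightarrow> \<not> u ! (2 * n - 2) \<and> \<not> v ! (2 * n - 2)"
      "n \<le> i \<and> i \<le> 2 * n - 2 \<longrightarrow> u ! (2 * n - 2) \<and> v ! (2 * n - 2)"
    and len: "length u = 2 * n - 1" "length v = 2 * n - 1"
    using assms unfolding dual_cube_adj_def by (elim conjE exE)
  have "v = u[i - 1 := \<not> u ! (i - 1)]"
  proof (rule nth_equalityI)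
    fix k assume "k < length v"
    then show "v ! k = u[i - 1 := \<not> u ! (i - 1)] ! k"
      using i(1-3) i(4)[rule_format, of "Suc k"] len by (cases "k = i - 1") auto
  qed (simp add: len)
  moreover have "i - 1 \<in> insert (2 * n - 2) (if u ! (2 * n - 2) then {n - 1..<2 * n - 2} else {..<n - 1})"
    using i(1,2,5,6) by auto
  ultimately show ?thesis unfolding dual_cube_nbrs_def by blast
qed

lemma kappa_set_eq_Greatest: "kappa_set V adj S = (GREATEST m. packs_trees V adj S m)"
  unfolding kappa_set_def packs_trees_def by (rule refl)

theorem mainTheorem6:
  fixes n :: nat
  assumes "n \<ge> 4"
  shows "gen_connectivity (dual_cube_V n) (dual_cube_adj n) 4 = n - 1"
proof -
  let ?V = "dual_cube_V n" and ?adj = "dual_cube_adj n"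
  have fin: "finite ?V"
    unfolding dual_cube_V_def using finite_lists_length_eq[of "UNIV :: bool set"] by simp
  have nb: "card (dual_cube_nbrs n u) = n" "finite (dual_cube_nbrs n u)" if "u \<in> ?V" for u
    using card_dual_cube_nbrs[of n u] assms that by (simp_all add: dual_cube_V_def)
  have nb': "v \<in> dual_cube_nbrs n u" if "?adj u v \<or> ?adj v u" for u v
    using that dual_cube_adj_nbrs dual_cube_adj_sym by blast
  \<comment> \<open>A bound is needed for \<open>GREATEST\<close> on naturals to denote an actual
    maximum.\<close>
  have bound: "m \<le> n" if "packs_trees ?V ?adj S m" "S \<subseteq> ?V" "card S = 4" for S m
  proof -
    have "card S \<noteq> 0" "card S \<noteq> 1" using that(3) by simp_all
    then obtain x z where xz: "x \<in> S" "z \<in> S" "x \<noteq> z"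
      by (metis card_eq_0_iff is_singletonI' is_singleton_altdef)
    then have "m \<le> card (dual_cube_nbrs n x)"
      using nb[of x] that(2) nb' by (intro packs_trees_le_degree[OF that(1) xz]) auto
    then show ?thesis using nb[of x] xz that(2) by auto
  qed
  have lower: "n - 1 \<le> kappa_set ?V ?adj S" if "S \<subseteq> ?V" "card S = 4" for S
    unfolding kappa_set_eq_Greatest
    by (rule Greatest_le_nat[where b = n])
      (use dual_cube_packs_trees[OF assms that] bound[OF _ that] in auto)
  define x where "x = replicate (2 * n - 1) False"
  \<comment> \<open>The upper bound needs four vertices with an edge among them: the zero string and
    three of its neighbours in the first block.\<close>
  define S where "S = {x, x[0 := True], x[1 := True], x[2 := True]}"
  have len: "length x = 2 * n - 1" by (simp add: x_def)
  have xk: "x ! k = False" if "k < 2 * n - 1" for k using that by (simp add: x_def)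
  have d: "x[k := True] ! j = (j = k)" if "k < 2 * n - 1" "j < 2 * n - 1" for j k
    using that len xk by (simp add: nth_list_update)
  have small: "k < 2 * n - 1" if "k < 3" for k using that assms by linarith
  have ne: "x \<noteq> x[k := True]" if "k < 3" for k
    using d[OF small[OF that] small[OF that]] xk[OF small[OF that]] by metis
  have ne2: "x[j := True] \<noteq> x[k := True]" if "k < 3" "j < 3" "j \<noteq> k" for j k
    using d[OF small[OF that(1)] small[OF that(1)]] d[OF small[OF that(2)] small[OF that(1)]] that(3) by metis
  have S4: "card S = 4" unfolding S_def using ne[of 0] ne[of 1] ne[of 2] ne2[of 0 1] ne2[of 0 2] ne2[of 1 2] by simp
  have SV: "S \<subseteq> ?V" using len by (auto simp: S_def dual_cube_V_def)
  have adj: "?adj x (x[0 := True])"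
    by (rule dual_cube_adjI[of _ _ _ 0]) (use len xk assms in \<open>auto simp: nth_list_update\<close>)
  have "packs_trees ?V ?adj S (kappa_set ?V ?adj S)"
    unfolding kappa_set_eq_Greatest
    by (rule GreatestI_nat[where b = n and k = "n - 1"])
      (use dual_cube_packs_trees[OF assms SV S4] bound[OF _ SV S4] in auto)
  then have "kappa_set ?V ?adj S < n"
  proof (rule packs_trees_less_degree[where x = x and y = "x[0 := True]" and z = "x[1 := True]"
        and Nx = "dual_cube_nbrs n x" and Ny = "dual_cube_nbrs n (x[0 := True])"])
    show "S \<subseteq> ?V" "?adj x (x[0 := True])" by fact+
    show "x \<in> S" "x[0 := True] \<in> S" "x[1 := True] \<in> S" by (auto simp: S_def)
    show "x[1 := True] \<noteq> x" "x[1 := True] \<noteq> x[0 := True]" "x \<noteq> x[0 := True]"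
      using ne[of 1] ne[of 0] ne2[of 1 0] by auto
    show "finite (dual_cube_nbrs n x)" "card (dual_cube_nbrs n x) = n"
      "finite (dual_cube_nbrs n (x[0 := True]))" "card (dual_cube_nbrs n (x[0 := True])) = n"
      using nb SV by (auto simp: S_def)
  qed (use nb' in auto)
  then have "n - 1 = kappa_set ?V ?adj S" using lower[OF SV S4] by simp
  then have "n - 1 \<in> {kappa_set ?V ?adj S | S. S \<subseteq> ?V \<and> card S = 4}" using SV S4 by blast
  moreover have "finite {kappa_set ?V ?adj S | S. S \<subseteq> ?V \<and> card S = 4}"
    using finite_subset[of "{kappa_set ?V ?adj S | S. S \<subseteq> ?V \<and> card S = 4}" "kappa_set ?V ?adj ` Pow ?V"] fin by auto
  ultimately show ?thesis unfolding gen_connectivity_def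
    using lower by (intro Min_eqI) auto
qed

end
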